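(* Let $(X_k)_{k\in\mathbf{Z}}$ be defined by $$X_k=H\big((\varepsilon_{k-i})_{i\in\mathbf{N}}\big)-\mathbf{E}\big[H\big((\varepsilon_{k-i})_{i\in\mathbf{N}}\big)\big],$$ where $(\varepsilon_i)_{i\in\mathbf{Z}}$ is a stationary sequence of $\phi$-mixing random variables with values in a subset $A$ of a Polish space $\mathcal{X}$, and $H:A^{\mathbf{N}}\to\mathbf{R}$ is a (measurable) function such that $$\text{for any }i\ge0,\qquad\sup_{x\in A^{\mathbf{N}},\,y\in A^{\mathbf{N}}}\big|H(x)-H(x^{(i)}y)\big|\le R_i,\quad\text{where }R_i\text{ decreases to }0.$$ Assume that $$R_n+\sum_{i=1}^nR_{n-i}\,\phi_\varepsilon(i)=O(n^{-\beta}),\qquad n\to\infty,$$ for some constant $\beta>1$, and that $\sigma^2:=\sum_{k\in\mathbf{Z}}\mathbf{E}[X_0X_k]>0$. [i] If $\beta\ge3/2$, then $\dfrac{\mathbf{P}(W_n\ge x\sigma_n)}{1-\Phi(x)}=1+o(1)$ uniformly for $0\le x=o(n^{1/14}/\sqrt{\ln n})$ as $n\to\infty$. [ii] If $\beta\in(1,3/2)$, then $\dfrac{\mathbf{P}(W_n\ge x\sigma_n)}{1-\Phi(x)}=1+o(1)$ uniformly for $0\le x=o(n^{(\beta-1)/(6\beta-2)})$ as $n\to\infty$.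
   Context: Setting: $(\Omega,\mathcal{F},\mathbf{P})$ is a probability space, $T:\Omega\to\Omega$ is a bijective bimeasurable transformation preserving $\mathbf{P}$, and $\varepsilon_i=\varepsilon_0\circ T^i$, $i\in\mathbf{Z}$ (so that $X_k=X_0\circ T^k$). Here $\mathbf{N}=\{0,1,2,\dots\}$. For $x,y\in A^{\mathbf{N}}$, the sequence $x^{(i)}y$ is defined by $(x^{(i)}y)_j=x_j$ for $j<i$ and $(x^{(i)}y)_j=y_j$ for $j\ge i$. For a random variable $Y$ with values in a Polish space $\mathcal{Y}$ and a $\sigma$-field $\mathcal{M}$, $\phi(\mathcal{M},\sigma(Y))=\sup_{B\in\mathfrak{B}(\mathcal{Y})}\|\mathbf{P}_{Y|\mathcal{M}}(B)-\mathbf{P}_Y(B)\|_\infty$, where $\mathbf{P}_{Y|\mathcal{M}}$ is the conditional distribution of $Y$ given $\mathcal{M}$, $\mathbf{P}_Y$ its distribution, and $\|\cdot\|_\infty$ the $\mathbf{L}^\infty$-norm. Then $$\phi_\varepsilon(n)=\phi\big(\sigma(\varepsilon_i,\,i\le0),\,\sigma(\varepsilon_i,\,i\ge n)\big).$$ Put $S_n=\sum_{i=1}^nX_i$, $W_n=S_n/\sqrt n$, $\sigma_n=\sqrt{\mathbf{E}W_n^2}$; $\Phi$ is the standard normal distribution function. "Uniformly for $0\le x=o(b_n)$" means: for every nonnegative sequence $(x_n)$ with $x_n=o(b_n)$, the supremum over $0\le x\le x_n$ of the absolute value of the ratio minus $1$ tends to $0$ as $n\to\infty$. *)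

theory Defs
  imports "HOL-Probability.Probability"
begin

definition bimeasurable_mp :: "'w measure \<Rightarrow> ('w \<Rightarrow> 'w) \<Rightarrow> bool" where
  "bimeasurable_mp M T \<longleftrightarrow>
     bij_betw T (space M) (space M) \<and>
     T \<in> measurable M M \<and>
     the_inv_into (space M) T \<in> measurable M M \<and>
     distr M M T = M"

definition int_iterate :: "'w measure \<Rightarrow> ('w \<Rightarrow> 'w) \<Rightarrow> int \<Rightarrow> 'w \<Rightarrow> 'w" where
  "int_iterate M T k =
     (if 0 \<le> k then T ^^ nat k else the_inv_into (space M) T ^^ nat (- k))"

definition splice_at :: "nat \<Rightarrow> (nat \<Rightarrow> 'x) \<Rightarrow> (nat \<Rightarrow> 'x) \<Rightarrow> nat \<Rightarrow> 'x" where
  "splice_at i x y = (\<lambda>j. if j < i then x j else y j)"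

text \<open>
  For a fixed Borel set \<open>B\<close>, the conditional distribution of \<open>Y\<close> given \<open>F\<close>, evaluated at \<open>B\<close>,
  is almost surely the conditional expectation of the indicator of the event \<open>Y \<in> B\<close>.
  For a random variable \<open>Y\<close> on a probability space and a sub-\<open>\<sigma>\<close>-algebra \<open>F\<close>, all the
  extended reals below lie between 0 and 1.
\<close>

definition phi_coeff :: "'w measure \<Rightarrow> 'w measure \<Rightarrow> ('w \<Rightarrow> 'y::polish_space) \<Rightarrow> real" where
  "phi_coeff M F Y = real_of_ereal
     (SUP B\<in>sets borel.
        esssup M (\<lambda>\<omega>. ereal \<bar>real_cond_exp M F (indicator (Y -` B \<inter> space M)) \<omega>
                              - measure (distr M borel Y) B\<bar>))"

definition past_algebra :: "'w measure \<Rightarrow> (int \<Rightarrow> 'w \<Rightarrow> 'x::topological_space) \<Rightarrow> 'w measure" where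
  "past_algebra M e = sigma (space M) {e i -` B \<inter> space M | i B. i \<le> 0 \<and> B \<in> sets borel}"

text \<open>
  The future after time \<open>n\<close> is generated by the single random variable
  \<open>(e\<^sub>n, e\<^sub>n\<^sub>+\<^sub>1, \<dots>)\<close> with values in the Polish space \<open>nat \<Rightarrow> 'x\<close> of sequences.
\<close>

definition phi_mix :: "'w measure \<Rightarrow> (int \<Rightarrow> 'w \<Rightarrow> 'x::polish_space) \<Rightarrow> nat \<Rightarrow> real" where
  "phi_mix M e n = phi_coeff M (past_algebra M e) (\<lambda>\<omega> j. e (int n + int j) \<omega>)"

definition normalized_sum :: "(int \<Rightarrow> 'w \<Rightarrow> real) \<Rightarrow> nat \<Rightarrow> 'w \<Rightarrow> real" where
  "normalized_sum X n \<omega> = (\<Sum>i=1..n. X (int i) \<omega>) / sqrt (real n)"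

definition normalized_sd :: "'w measure \<Rightarrow> (int \<Rightarrow> 'w \<Rightarrow> real) \<Rightarrow> nat \<Rightarrow> real" where
  "normalized_sd M X n = sqrt (\<integral>\<omega>. (normalized_sum X n \<omega>)\<^sup>2 \<partial>M)"

definition normal_tail_ratio :: "'w measure \<Rightarrow> (int \<Rightarrow> 'w \<Rightarrow> real) \<Rightarrow> nat \<Rightarrow> real \<Rightarrow> real" where
  "normal_tail_ratio M X n x =
     measure M {\<omega> \<in> space M. normalized_sum X n \<omega> \<ge> x * normalized_sd M X n}
       / (1 - cdf std_normal_distribution x)"

definition tends_to_one_uniformly :: "(nat \<Rightarrow> real \<Rightarrow> real) \<Rightarrow> (nat \<Rightarrow> real) \<Rightarrow> bool" where
  "tends_to_one_uniformly f b \<longleftrightarrow>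
     (\<forall>u :: nat \<Rightarrow> real. (\<forall>n. 0 \<le> u n) \<longrightarrow> u \<in> o(b) \<longrightarrow>
        (\<lambda>n. SUP x\<in>{0..u n}. \<bar>f n x - 1\<bar>) \<longlonglongrightarrow> 0)"

end

theory Submission
  imports Defs "HOL-Real_Asymp.Real_Asymp"
begin

text \<open>
  The tail indicator is replaced by the logistic function \<open>L(\<kappa>(w - y))\<close>, whose first three
  derivatives are bounded by powers of \<open>\<kappa>\<close> times the function itself. For such test functions
  all errors in a Lindeberg replacement of \<open>X\<^sub>1, X\<^sub>2, \<dots>\<close> by independent Gaussian variables are
  relative: they are multiples of the expectation being estimated. The dependence is handled by
  telescoping every \<open>g(S\<^sub>k)\<close> into increments \<open>g(S\<^sub>p\<^sub>+\<^sub>1) - g(S\<^sub>p)\<close> and decorrelating each of them from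
  \<open>X\<^sub>k\<^sub>+\<^sub>1\<close> by \<open>\<phi>\<close>-mixing; second-order expansion is used only for lags up to \<open>m = n^(1 / (3\<beta> - 1))\<close>.
  With \<open>\<theta> = \<kappa> / (\<sigma>\<^sub>n \<surd>n)\<close> the total relative error is \<open>O(n \<theta>\<^sup>3 m^(2 - \<beta>) + n \<theta>\<^sup>2 m^(1 - \<beta>))\<close>,
  which vanishes for \<open>\<kappa> = o(n^((\<beta> - 1) / (6\<beta> - 2)))\<close>. Choosing \<open>\<kappa>\<close> as the geometric mean of
  \<open>1 + x\<^sub>n\<close> and \<open>n^((\<beta> - 1) / (6\<beta> - 2))\<close>, the logistic function changes on a scale much shorter than
  \<open>1 / (1 + x\<^sub>n)\<close>, the scale of the Gaussian tail. The case \<open>\<beta> \<ge> 3/2\<close> follows from \<open>\<beta> = 3/2\<close>.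
\<close>

section \<open>Slowly varying test functions\<close>

text \<open>For x growing like a power of n the Gaussian tail is smaller than every power of n, so
  an additive error bound would be void: each estimate has to carry the tail as a factor. Two facts
  make this possible. phi-mixing bounds a covariance with a past variable V by a multiple of the L^1
  norm of V, and the increments of the logistic function and of its Gaussian averages are bounded by
  multiples of the function. The errors are then multiples of expectations at earlier times and with
  other amounts of Gaussian smoothing. Monotonicity of the test function compares all of them with
  one maximum, and this maximum is absorbed because its coefficient is small. Put \<alpha> =
  (\<beta> - 1) / (6 \<beta> - 2). Up to rounding, m is the least power of n that keeps n^(2
  \<alpha>) m^(1 - \<beta>) bounded. The error term with \<theta>^2 thus has no power of n left and
  vanishes through \<kappa> = o(n^\<alpha>) alone, while the term with \<theta>^3 keeps the negative
  exponent of m^(1 - \<beta>).\<close>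

definition logistic :: "real \<Rightarrow> real" where
  "logistic y = 1 / (1 + exp (- y))"

lemma logistic_pos: "0 < logistic y" and logistic_less_1: "logistic y < 1"
  and logistic_mono: "x \<le> y \<Longrightarrow> logistic x \<le> logistic y"
  by (auto simp: logistic_def add_pos_pos intro!: divide_left_mono mult_pos_pos)

lemma logistic_le_exp: "logistic y \<le> exp y"
  by (simp add: logistic_def field_simps exp_minus add_pos_pos)

lemma logistic_ge: "logistic y \<ge> 1 - exp (- y)"
proof -
  have "(1 - exp (- y)) * (1 + exp (- y)) \<le> 1"
    by (simp add: algebra_simps)
  then show ?thesis
    by (simp add: logistic_def pos_le_divide_eq add_pos_pos)
qed

text \<open>\<open>ln (logistic y)\<close> is 1-Lipschitz, since its derivative
  \<open>1 - logistic y\<close> lies between 0 and 1. This is what makes the later errors relative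
  to the value at the base point.\<close>

lemma logistic_shift: "logistic (y + h) \<le> exp \<bar>h\<bar> * logistic y"
proof -
  have "exp (- y) \<le> exp (\<bar>h\<bar> + - (y + h))" by simp
  then have "exp (- y) \<le> exp \<bar>h\<bar> * exp (- (y + h))"
    by (simp only: exp_add)
  moreover have "1 \<le> exp \<bar>h\<bar>" by simp
  ultimately have "1 + exp (- y) \<le> exp \<bar>h\<bar> * (1 + exp (- (y + h)))"
    unfolding distrib_left by linarith
  then show ?thesis
    by (simp add: logistic_def field_simps add_pos_pos)
qed

text \<open>Every derivative of \<open>logistic\<close> is \<open>logistic\<close> times a
  polynomial in \<open>logistic\<close>. That factor is bounded, which is the source of all bounds
  by the function itself.\<close>

definition logistic1 :: "real \<Rightarrow> real" where
  "logistic1 y = logistic y * (1 - logistic y)"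

definition logistic2 :: "real \<Rightarrow> real" where
  "logistic2 y = logistic y * (1 - logistic y) * (1 - 2 * logistic y)"

lemma DERIV_logistic: "(logistic has_real_derivative logistic1 y) (at y)"
proof -
  have "1 + exp (- y) \<noteq> 0" by (smt (verit) exp_gt_zero)
  then show ?thesis
    unfolding logistic_def logistic1_def
    by (auto intro!: derivative_eq_intros simp: field_simps power2_eq_square)
qed

lemma DERIV_logistic1: "(logistic1 has_real_derivative logistic2 y) (at y)"
  unfolding logistic1_def [abs_def] logistic2_def
  by (rule derivative_eq_intros DERIV_logistic refl)+ (simp add: logistic1_def algebra_simps)

lemma DERIV_logistic2:
  "(logistic2 has_real_derivative
      logistic y * ((1 - logistic y) * (1 - 6 * logistic y + 6 * (logistic y)\<^sup>2))) (at y)"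
  unfolding logistic2_def [abs_def]
  by (rule derivative_eq_intros DERIV_logistic refl)+
     (simp add: logistic1_def algebra_simps power2_eq_square power3_eq_cube)

lemma abs_mult_le_one: "\<bar>a\<bar> \<le> 1 \<Longrightarrow> \<bar>b\<bar> \<le> 1 \<Longrightarrow> \<bar>a * b :: real\<bar> \<le> 1"
  by (simp add: abs_mult mult_le_one)

lemma logistic1_bound: "\<bar>logistic1 y\<bar> \<le> logistic y"
  using logistic_pos[of y] logistic_less_1[of y]
  by (simp add: logistic1_def abs_mult mult_left_le)

lemma logistic2_bound: "\<bar>logistic2 y\<bar> \<le> logistic y"
proof -
  have "\<bar>(1 - logistic y) * (1 - 2 * logistic y)\<bar> \<le> 1"
    using logistic_pos[of y] logistic_less_1[of y] by (intro abs_mult_le_one) auto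
  then show ?thesis
    using logistic_pos[of y] logistic_less_1[of y]
    by (simp add: logistic2_def abs_mult mult_left_le mult.assoc)
qed

lemma logistic3_bound:
  "\<bar>logistic y * ((1 - logistic y) * (1 - 6 * logistic y + 6 * (logistic y)\<^sup>2))\<bar> \<le> logistic y"
proof -
  \<comment> \<open>With p for the logistic value, \<open>p^2 \<le> p\<close> bounds
    \<open>1 - 6 p + 6 p^2\<close> above by 1, and \<open>(2 p - 1)^2 \<ge> 0\<close> bounds it
    below by -1/2.\<close>
  have "logistic y * logistic y \<le> logistic y"
    using logistic_pos[of y] logistic_less_1[of y] by (simp add: mult_left_le)
  moreover have "0 \<le> (2 * logistic y - 1)\<^sup>2" by simp
  ultimately have "\<bar>1 - 6 * logistic y + 6 * (logistic y)\<^sup>2\<bar> \<le> 1"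
    by (simp add: power2_eq_square algebra_simps abs_le_iff)
  then have "\<bar>(1 - logistic y) * (1 - 6 * logistic y + 6 * (logistic y)\<^sup>2)\<bar> \<le> 1"
    using logistic_pos[of y] logistic_less_1[of y] by (intro abs_mult_le_one) auto
  then show ?thesis
    using logistic_pos[of y] by (simp add: abs_mult mult_left_le)
qed

section \<open>Taylor estimates with errors relative to the function\<close>

lemma mvt_bound:
  fixes g g' :: "real \<Rightarrow> real"
  assumes "\<And>t. (g has_real_derivative g' t) (at t)"
    and "\<And>t. \<bar>t\<bar> \<le> \<bar>h\<bar> \<Longrightarrow> \<bar>g' t\<bar> \<le> B"
  shows "\<bar>g h - g 0\<bar> \<le> \<bar>h\<bar> * B"
proof -
  have "norm (g h - g 0) \<le> B * norm (h - 0)"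
  proof (rule field_differentiable_bound[of "closed_segment 0 h" g g' B])
    show "convex (closed_segment 0 h)" by simp
    fix z assume "z \<in> closed_segment 0 h"
    then show "norm (g' z) \<le> B"
      using assms(2)[of z] by (auto simp: closed_segment_eq_real_ivl split: if_splits)
  qed (auto intro: has_field_derivative_at_within assms(1))
  then show ?thesis by (simp add: mult.commute)
qed

text \<open>Generic in \<open>g\<close> because the derivatives of \<open>logistic1\<close> and of
  \<open>logistic2\<close> are both dominated by \<open>logistic\<close>;
  \<open>logistic_shift\<close> carries that bound along the segment back to
  \<open>y\<close>.\<close>

lemma logistic_increment_bound:
  assumes D: "\<And>t. (g has_real_derivative g' t) (at t)"
    and B: "\<And>t. \<bar>g' t\<bar> \<le> logistic t"
  shows "\<bar>g (y + h) - g y\<bar> \<le> \<bar>h\<bar> * (exp \<bar>h\<bar> * logistic y)"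
proof -
  have "\<bar>g (y + h) - g (y + 0)\<bar> \<le> \<bar>h\<bar> * (exp \<bar>h\<bar> * logistic y)"
  proof (rule mvt_bound[where g = "\<lambda>t. g (y + t)"])
    show "((\<lambda>t. g (y + t)) has_real_derivative g' (y + t)) (at t)" for t
      using D[of "y + t"] DERIV_shift[of g "g' (y + t)" t y] by (simp add: add.commute)
    show "\<bar>g' (y + t)\<bar> \<le> exp \<bar>h\<bar> * logistic y" if "\<bar>t\<bar> \<le> \<bar>h\<bar>" for t
      using B[of "y + t"] logistic_shift[of y t] that logistic_pos[of y]
      by (smt (verit) exp_le_cancel_iff mult_right_mono)
  qed
  then show ?thesis by simp
qed

text \<open>One integration of the increment bound for \<open>logistic2\<close>; integrating once
  more gives the third-order remainder of \<open>logistic\<close>. The factorials of Taylor's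
  formula are given up, so the constant stays 1.\<close>

lemma logistic1_taylor:
  "\<bar>logistic1 (y + h) - logistic1 y - h * logistic2 y\<bar> \<le> \<bar>h\<bar>\<^sup>2 * (exp \<bar>h\<bar> * logistic y)"
proof -
  have "\<bar>(logistic1 (y + h) - h * logistic2 y) - (logistic1 (y + 0) - 0 * logistic2 y)\<bar>
      \<le> \<bar>h\<bar> * (\<bar>h\<bar> * (exp \<bar>h\<bar> * logistic y))"
  proof (rule mvt_bound[where g = "\<lambda>t. logistic1 (y + t) - t * logistic2 y"])
    show "((\<lambda>t. logistic1 (y + t) - t * logistic2 y) has_real_derivative
        logistic2 (y + t) - logistic2 y) (at t)" for t
      using DERIV_shift[of logistic1 "logistic2 (y + t)" t y] DERIV_logistic1[of "y + t"]
      by (auto intro!: derivative_eq_intros simp: add.commute)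
    show "\<bar>logistic2 (y + t) - logistic2 y\<bar> \<le> \<bar>h\<bar> * (exp \<bar>h\<bar> * logistic y)" if "\<bar>t\<bar> \<le> \<bar>h\<bar>" for t
    proof -
      have "\<bar>logistic2 (y + t) - logistic2 y\<bar> \<le> \<bar>t\<bar> * (exp \<bar>t\<bar> * logistic y)"
        by (rule logistic_increment_bound[OF DERIV_logistic2 logistic3_bound])
      also have "\<dots> \<le> \<bar>h\<bar> * (exp \<bar>h\<bar> * logistic y)"
        using that logistic_pos[of y] by (intro mult_mono) auto
      finally show ?thesis .
    qed
  qed
  then show ?thesis by (simp add: power2_eq_square mult.assoc diff_right_commute)
qed

lemma logistic_taylor:
  "\<bar>logistic (y + h) - logistic y - h * logistic1 y - h\<^sup>2 / 2 * logistic2 y\<bar>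
     \<le> \<bar>h\<bar> ^ 3 * (exp \<bar>h\<bar> * logistic y)"
proof -
  have "\<bar>(logistic (y + h) - h * logistic1 y - h\<^sup>2 / 2 * logistic2 y)
        - (logistic (y + 0) - 0 * logistic1 y - 0\<^sup>2 / 2 * logistic2 y)\<bar>
      \<le> \<bar>h\<bar> * (\<bar>h\<bar>\<^sup>2 * (exp \<bar>h\<bar> * logistic y))"
  proof (rule mvt_bound[where g = "\<lambda>t. logistic (y + t) - t * logistic1 y - t\<^sup>2 / 2 * logistic2 y"])
    show "((\<lambda>t. logistic (y + t) - t * logistic1 y - t\<^sup>2 / 2 * logistic2 y) has_real_derivative
        logistic1 (y + t) - logistic1 y - t * logistic2 y) (at t)" for t
      using DERIV_shift[of logistic "logistic1 (y + t)" t y] DERIV_logistic[of "y + t"]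
      by (auto intro!: derivative_eq_intros simp: add.commute)
    show "\<bar>logistic1 (y + t) - logistic1 y - t * logistic2 y\<bar> \<le> \<bar>h\<bar>\<^sup>2 * (exp \<bar>h\<bar> * logistic y)"
      if "\<bar>t\<bar> \<le> \<bar>h\<bar>" for t
    proof -
      have "\<bar>logistic1 (y + t) - logistic1 y - t * logistic2 y\<bar> \<le> \<bar>t\<bar>\<^sup>2 * (exp \<bar>t\<bar> * logistic y)"
        by (rule logistic1_taylor)
      also have "\<dots> \<le> \<bar>h\<bar>\<^sup>2 * (exp \<bar>h\<bar> * logistic y)"
        using that logistic_pos[of y] by (intro mult_mono power_mono) auto
      finally show ?thesis .
    qed
  qed
  then show ?thesis
    by (simp add: power2_eq_square power3_eq_cube mult.assoc algebra_simps)
qed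

text \<open>
  The functions \<open>u1\<close> and \<open>u2\<close> stand for the first two derivatives of \<open>u\<close>. Only increments are
  controlled, so that the class is visibly closed under averaging over translates.
\<close>

definition slow :: "real \<Rightarrow> (real \<Rightarrow> real) \<Rightarrow> (real \<Rightarrow> real) \<Rightarrow> (real \<Rightarrow> real) \<Rightarrow> bool" where
  "slow \<theta> u u1 u2 \<longleftrightarrow>
     u \<in> borel_measurable borel \<and> u1 \<in> borel_measurable borel \<and> u2 \<in> borel_measurable borel \<and>
     mono u \<and>
     (\<forall>w. 0 \<le> u w \<and> u w \<le> 1 \<and> \<bar>u1 w\<bar> \<le> \<theta> * u w \<and> \<bar>u2 w\<bar> \<le> \<theta>\<^sup>2 * u w) \<and>
     (\<forall>w h. u (w + h) \<le> exp (\<theta> * \<bar>h\<bar>) * u w \<and>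
       \<bar>u1 (w + h) - u1 w\<bar> \<le> \<theta>\<^sup>2 * \<bar>h\<bar> * exp (\<theta> * \<bar>h\<bar>) * u w \<and>
       \<bar>u2 (w + h) - u2 w\<bar> \<le> \<theta> ^ 3 * \<bar>h\<bar> * exp (\<theta> * \<bar>h\<bar>) * u w \<and>
       \<bar>u1 (w + h) - u1 w - h * u2 w\<bar> \<le> \<theta> ^ 3 * \<bar>h\<bar>\<^sup>2 * exp (\<theta> * \<bar>h\<bar>) * u w \<and>
       \<bar>u (w + h) - u w - h * u1 w - h\<^sup>2 / 2 * u2 w\<bar> \<le> \<theta> ^ 3 * \<bar>h\<bar> ^ 3 * exp (\<theta> * \<bar>h\<bar>) * u w)"

lemma logistic_borel [measurable]: "logistic \<in> borel_measurable borel"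
  "logistic1 \<in> borel_measurable borel" "logistic2 \<in> borel_measurable borel"
  unfolding logistic_def[abs_def] logistic1_def[abs_def] logistic2_def[abs_def] by measurable

lemma slow_logistic:
  assumes "0 < \<theta>"
  shows "slow \<theta> (\<lambda>w. logistic (\<theta> * w - b)) (\<lambda>w. \<theta> * logistic1 (\<theta> * w - b))
           (\<lambda>w. \<theta>\<^sup>2 * logistic2 (\<theta> * w - b))"
  unfolding slow_def
proof (intro conjI allI)
  show "mono (\<lambda>w. logistic (\<theta> * w - b))"
    using assms by (auto intro!: monoI logistic_mono)
  fix w h :: real
  have eq: "\<theta> * (w + h) - b = (\<theta> * w - b) + \<theta> * h" by (simp add: algebra_simps)
  have ab: "\<bar>\<theta> * h\<bar> = \<theta> * \<bar>h\<bar>" using assms by (simp add: abs_mult)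
  show "0 \<le> logistic (\<theta> * w - b)" "logistic (\<theta> * w - b) \<le> 1"
    using logistic_pos logistic_less_1 less_imp_le by auto
  show "\<bar>\<theta> * logistic1 (\<theta> * w - b)\<bar> \<le> \<theta> * logistic (\<theta> * w - b)"
    using logistic1_bound[of "\<theta> * w - b"] assms by (simp add: abs_mult)
  show "\<bar>\<theta>\<^sup>2 * logistic2 (\<theta> * w - b)\<bar> \<le> \<theta>\<^sup>2 * logistic (\<theta> * w - b)"
    using logistic2_bound[of "\<theta> * w - b"] assms by (simp add: abs_mult)
  show "logistic (\<theta> * (w + h) - b) \<le> exp (\<theta> * \<bar>h\<bar>) * logistic (\<theta> * w - b)"
    unfolding eq using logistic_shift[of "\<theta> * w - b" "\<theta> * h"] by (simp add: ab)
  have "\<bar>\<theta> * logistic1 (\<theta> * (w + h) - b) - \<theta> * logistic1 (\<theta> * w - b)\<bar>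
     = \<theta> * \<bar>logistic1 ((\<theta> * w - b) + \<theta> * h) - logistic1 (\<theta> * w - b)\<bar>"
    unfolding eq using assms by (simp add: right_diff_distrib[symmetric] abs_mult)
  also have "\<dots> \<le> \<theta> * (\<bar>\<theta> * h\<bar> * (exp \<bar>\<theta> * h\<bar> * logistic (\<theta> * w - b)))"
    using assms by (intro mult_left_mono logistic_increment_bound[OF DERIV_logistic1 logistic2_bound]) auto
  finally show "\<bar>\<theta> * logistic1 (\<theta> * (w + h) - b) - \<theta> * logistic1 (\<theta> * w - b)\<bar>
      \<le> \<theta>\<^sup>2 * \<bar>h\<bar> * exp (\<theta> * \<bar>h\<bar>) * logistic (\<theta> * w - b)"
    by (simp add: ab power2_eq_square mult_ac)
  have "\<bar>\<theta>\<^sup>2 * logistic2 (\<theta> * (w + h) - b) - \<theta>\<^sup>2 * logistic2 (\<theta> * w - b)\<bar>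
     = \<theta>\<^sup>2 * \<bar>logistic2 ((\<theta> * w - b) + \<theta> * h) - logistic2 (\<theta> * w - b)\<bar>"
    unfolding eq using assms by (simp add: right_diff_distrib[symmetric] abs_mult)
  also have "\<dots> \<le> \<theta>\<^sup>2 * (\<bar>\<theta> * h\<bar> * (exp \<bar>\<theta> * h\<bar> * logistic (\<theta> * w - b)))"
    using assms by (intro mult_left_mono logistic_increment_bound[OF DERIV_logistic2 logistic3_bound]) auto
  finally show "\<bar>\<theta>\<^sup>2 * logistic2 (\<theta> * (w + h) - b) - \<theta>\<^sup>2 * logistic2 (\<theta> * w - b)\<bar>
      \<le> \<theta> ^ 3 * \<bar>h\<bar> * exp (\<theta> * \<bar>h\<bar>) * logistic (\<theta> * w - b)"
    by (simp add: ab power2_eq_square power3_eq_cube mult_ac)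
  have "\<bar>\<theta> * logistic1 (\<theta> * (w + h) - b) - \<theta> * logistic1 (\<theta> * w - b) - h * (\<theta>\<^sup>2 * logistic2 (\<theta> * w - b))\<bar>
     = \<bar>\<theta> * (logistic1 ((\<theta> * w - b) + \<theta> * h) - logistic1 (\<theta> * w - b) - \<theta> * h * logistic2 (\<theta> * w - b))\<bar>"
    unfolding eq by (simp add: algebra_simps power2_eq_square)
  also have "\<dots> = \<theta> * \<bar>logistic1 ((\<theta> * w - b) + \<theta> * h) - logistic1 (\<theta> * w - b) - \<theta> * h * logistic2 (\<theta> * w - b)\<bar>"
    using assms by (simp add: abs_mult)
  also have "\<dots> \<le> \<theta> * (\<bar>\<theta> * h\<bar>\<^sup>2 * (exp \<bar>\<theta> * h\<bar> * logistic (\<theta> * w - b)))"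
    using assms by (intro mult_left_mono logistic1_taylor) auto
  finally show "\<bar>\<theta> * logistic1 (\<theta> * (w + h) - b) - \<theta> * logistic1 (\<theta> * w - b) - h * (\<theta>\<^sup>2 * logistic2 (\<theta> * w - b))\<bar>
      \<le> \<theta> ^ 3 * \<bar>h\<bar>\<^sup>2 * exp (\<theta> * \<bar>h\<bar>) * logistic (\<theta> * w - b)"
    unfolding ab by (simp add: power2_eq_square power3_eq_cube mult_ac)
  have "\<bar>logistic (\<theta> * (w + h) - b) - logistic (\<theta> * w - b) - h * (\<theta> * logistic1 (\<theta> * w - b))
         - h\<^sup>2 / 2 * (\<theta>\<^sup>2 * logistic2 (\<theta> * w - b))\<bar>
     = \<bar>logistic ((\<theta> * w - b) + \<theta> * h) - logistic (\<theta> * w - b) - \<theta> * h * logistic1 (\<theta> * w - b)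
         - (\<theta> * h)\<^sup>2 / 2 * logistic2 (\<theta> * w - b)\<bar>"
    unfolding eq by (simp add: algebra_simps power2_eq_square)
  also have "\<dots> \<le> \<bar>\<theta> * h\<bar> ^ 3 * (exp \<bar>\<theta> * h\<bar> * logistic (\<theta> * w - b))"
    by (rule logistic_taylor)
  finally show "\<bar>logistic (\<theta> * (w + h) - b) - logistic (\<theta> * w - b) - h * (\<theta> * logistic1 (\<theta> * w - b))
         - h\<^sup>2 / 2 * (\<theta>\<^sup>2 * logistic2 (\<theta> * w - b))\<bar>
      \<le> \<theta> ^ 3 * \<bar>h\<bar> ^ 3 * exp (\<theta> * \<bar>h\<bar>) * logistic (\<theta> * w - b)"
    unfolding ab by (simp add: power_mult_distrib mult_ac)
qed measurable

section \<open>Gaussian averaging\<close>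

interpretation std_normal: prob_space std_normal_distribution
  using real_dist_normal_dist by (simp add: real_distribution_def)

lemma sets_std_normal [simp, measurable_cong]: "sets std_normal_distribution = sets borel"
  and space_std_normal [simp]: "space std_normal_distribution = UNIV"
  by (auto simp: space_density)

text \<open>The heat semigroup whose generator is half the second derivative. Gaussian variables
  that are still in the sum act on the test function only through it, and with the variance as time
  parameter their contributions add up.\<close>

definition heat :: "real \<Rightarrow> (real \<Rightarrow> real) \<Rightarrow> real \<Rightarrow> real" where
  "heat s u w = (\<integral>z. u (w + sqrt s * z) \<partial>std_normal_distribution)"

lemma heat_0 [simp]: "heat 0 u = u"
  by (rule ext) (simp add: heat_def std_normal.prob_space[simplified])

lemma slowD:
  assumes "slow \<theta> u u1 u2"
  shows slow_measurable: "u \<in> borel_measurable borel" "u1 \<in> borel_measurable borel" "u2 \<in> borel_measurable borel"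
    and slow_mono: "mono u"
    and slow_nonneg: "0 \<le> u w" and slow_le_1: "u w \<le> 1"
    and slow_bound1: "\<bar>u1 w\<bar> \<le> \<theta> * u w"
    and slow_bound2: "\<bar>u2 w\<bar> \<le> \<theta>\<^sup>2 * u w"
    and slow_shift: "u (w + h) \<le> exp (\<theta> * \<bar>h\<bar>) * u w"
    and slow_increment1: "\<bar>u1 (w + h) - u1 w\<bar> \<le> \<theta>\<^sup>2 * \<bar>h\<bar> * exp (\<theta> * \<bar>h\<bar>) * u w"
    and slow_increment2: "\<bar>u2 (w + h) - u2 w\<bar> \<le> \<theta> ^ 3 * \<bar>h\<bar> * exp (\<theta> * \<bar>h\<bar>) * u w"
    and slow_taylor1: "\<bar>u1 (w + h) - u1 w - h * u2 w\<bar> \<le> \<theta> ^ 3 * \<bar>h\<bar>\<^sup>2 * exp (\<theta> * \<bar>h\<bar>) * u w"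
    and slow_taylor: "\<bar>u (w + h) - u w - h * u1 w - h\<^sup>2 / 2 * u2 w\<bar> \<le> \<theta> ^ 3 * \<bar>h\<bar> ^ 3 * exp (\<theta> * \<bar>h\<bar>) * u w"
  using assms unfolding slow_def by blast+

lemma slow_integrable_std_normal:
  assumes "slow \<theta> u u1 u2" "0 \<le> \<theta>"
  shows "integrable std_normal_distribution (\<lambda>z. u (w + s * z))"
    "integrable std_normal_distribution (\<lambda>z. u1 (w + s * z))"
    "integrable std_normal_distribution (\<lambda>z. u2 (w + s * z))"
proof -
  note [measurable] = slow_measurable[OF assms(1)]
  note b = slow_nonneg[OF assms(1)] slow_le_1[OF assms(1)] slow_bound1[OF assms(1)]
    slow_bound2[OF assms(1)]
  have "\<bar>u1 w\<bar> \<le> \<theta>" for w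
    using b(3)[of w] mult_left_mono[OF b(2)[of w] assms(2)] by simp
  moreover have "\<bar>u2 w\<bar> \<le> \<theta>\<^sup>2" for w
    using b(4)[of w] mult_left_mono[OF b(2)[of w], of "\<theta>\<^sup>2"] by simp
  ultimately show "integrable std_normal_distribution (\<lambda>z. u (w + s * z))"
    "integrable std_normal_distribution (\<lambda>z. u1 (w + s * z))"
    "integrable std_normal_distribution (\<lambda>z. u2 (w + s * z))"
    using b(1,2)
    by (simp_all add: std_normal.integrable_const_bound[where B = 1]
        std_normal.integrable_const_bound[where B = \<theta>]
        std_normal.integrable_const_bound[where B = "\<theta>\<^sup>2"])
qed

text \<open>An integrand that is not integrable has integral 0 by convention, so integrability is
  asked of the majorant only.\<close>

lemma abs_integral_le:
  fixes f g :: "'a \<Rightarrow> real"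
  assumes "integrable M g" "\<And>x. x \<in> space M \<Longrightarrow> \<bar>f x\<bar> \<le> g x"
  shows "\<bar>\<integral>x. f x \<partial>M\<bar> \<le> (\<integral>x. g x \<partial>M)"
proof (cases "integrable M f")
  case True
  have "\<bar>\<integral>x. f x \<partial>M\<bar> \<le> (\<integral>x. \<bar>f x\<bar> \<partial>M)" by (rule integral_abs_bound)
  also have "\<dots> \<le> (\<integral>x. g x \<partial>M)"
    using assms True by (intro integral_mono) auto
  finally show ?thesis .
next
  case False
  have "0 \<le> (\<integral>x. g x \<partial>M)"
    using assms(2) by (intro integral_nonneg_AE AE_I2) (meson abs_ge_zero order_trans)
  then show ?thesis using False by (simp add: not_integrable_integral_eq)
qed

lemma slow_heat:
  assumes "slow \<theta> u u1 u2" "0 \<le> \<theta>"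
  shows "slow \<theta> (heat s u) (heat s u1) (heat s u2)"
proof -
  note S = assms(1)
  note [measurable] = slow_measurable[OF S]
  note int = slow_integrable_std_normal[OF assms]
  \<comment> \<open>Each clause of \<open>slow\<close> is linear in the three functions and has a
    multiple of \<open>u\<close> at the translated point on its right side, so integrating over the
    Gaussian shift keeps the constants.\<close>
  have bnd: "\<bar>\<integral>z. F z \<partial>std_normal_distribution\<bar> \<le> c * heat s u w"
    if "\<And>z. \<bar>F z\<bar> \<le> c * u (w + sqrt s * z)" for F c w
    using abs_integral_le[of std_normal_distribution "\<lambda>z. c * u (w + sqrt s * z)" F] int(1) that
    by (simp add: heat_def)
  have "heat s f \<in> borel_measurable borel" if [measurable]: "f \<in> borel_measurable borel" for f
    unfolding heat_def[abs_def] by measurable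
  then have "heat s u \<in> borel_measurable borel" "heat s u1 \<in> borel_measurable borel"
    "heat s u2 \<in> borel_measurable borel" by simp_all
  moreover have "mono (heat s u)"
    unfolding heat_def by (intro monoI integral_mono int monoD[OF slow_mono[OF S]]) simp
  moreover have "0 \<le> heat s u w" for w
    unfolding heat_def by (intro integral_nonneg_AE AE_I2) (simp add: slow_nonneg[OF S])
  moreover have "heat s u w \<le> 1" for w
    unfolding heat_def
    by (rule std_normal.integral_le_const[OF int(1)]) (simp add: slow_le_1[OF S])
  moreover have "\<bar>heat s u1 w\<bar> \<le> \<theta> * heat s u w" for w
    unfolding heat_def[of s u1] by (rule bnd) (rule slow_bound1[OF S])
  moreover have "\<bar>heat s u2 w\<bar> \<le> \<theta>\<^sup>2 * heat s u w" for w
    unfolding heat_def[of s u2] by (rule bnd) (rule slow_bound2[OF S])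
  moreover have "heat s u (w + h) \<le> exp (\<theta> * \<bar>h\<bar>) * heat s u w" for w h
  proof -
    have "\<bar>heat s u (w + h)\<bar> \<le> exp (\<theta> * \<bar>h\<bar>) * heat s u w"
      unfolding heat_def[of s u "w + h"]
    proof (rule bnd)
      fix z
      have "w + h + sqrt s * z = (w + sqrt s * z) + h" by simp
      then show "\<bar>u (w + h + sqrt s * z)\<bar> \<le> exp (\<theta> * \<bar>h\<bar>) * u (w + sqrt s * z)"
        using slow_shift[OF S, of "w + sqrt s * z" h] slow_nonneg[OF S] by (simp only: abs_of_nonneg)
    qed
    then show ?thesis by simp
  qed
  moreover have "\<bar>heat s u1 (w + h) - heat s u1 w\<bar> \<le> \<theta>\<^sup>2 * \<bar>h\<bar> * exp (\<theta> * \<bar>h\<bar>) * heat s u w" for w h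
    unfolding heat_def[of s u1] Bochner_Integration.integral_diff[OF int(2) int(2), symmetric]
    by (rule bnd) (metis slow_increment1[OF S] add.assoc add.commute)
  moreover have "\<bar>heat s u2 (w + h) - heat s u2 w\<bar> \<le> \<theta> ^ 3 * \<bar>h\<bar> * exp (\<theta> * \<bar>h\<bar>) * heat s u w" for w h
    unfolding heat_def[of s u2] Bochner_Integration.integral_diff[OF int(3) int(3), symmetric]
    by (rule bnd) (metis slow_increment2[OF S] add.assoc add.commute)
  moreover have "\<bar>heat s u1 (w + h) - heat s u1 w - h * heat s u2 w\<bar>
      \<le> \<theta> ^ 3 * \<bar>h\<bar>\<^sup>2 * exp (\<theta> * \<bar>h\<bar>) * heat s u w" for w h
  proof -
    have "heat s u1 (w + h) - heat s u1 w - h * heat s u2 w =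
      (\<integral>z. u1 ((w + sqrt s * z) + h) - u1 (w + sqrt s * z) - h * u2 (w + sqrt s * z) \<partial>std_normal_distribution)"
      using int(2)[of "w + h" "sqrt s"] int by (simp add: heat_def add_ac)
    then show ?thesis
      by (simp only:) (rule bnd, rule slow_taylor1[OF S])
  qed
  moreover have "\<bar>heat s u (w + h) - heat s u w - h * heat s u1 w - h\<^sup>2 / 2 * heat s u2 w\<bar>
      \<le> \<theta> ^ 3 * \<bar>h\<bar> ^ 3 * exp (\<theta> * \<bar>h\<bar>) * heat s u w" for w h
  proof -
    have "heat s u (w + h) - heat s u w - h * heat s u1 w - h\<^sup>2 / 2 * heat s u2 w =
      (\<integral>z. u ((w + sqrt s * z) + h) - u (w + sqrt s * z) - h * u1 (w + sqrt s * z)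
          - h\<^sup>2 / 2 * u2 (w + sqrt s * z) \<partial>std_normal_distribution)"
      using int(1)[of "w + h" "sqrt s"] int by (simp add: heat_def add_ac)
    then show ?thesis
      by (simp only:) (rule bnd, rule slow_taylor[OF S])
  qed
  ultimately show ?thesis unfolding slow_def by blast
qed

section \<open>Symmetry, moments and expansion of one Gaussian step\<close>

lemma std_normal_moments:
  "integrable std_normal_distribution (\<lambda>z. z)" "(\<integral>z. z \<partial>std_normal_distribution) = 0"
  "integrable std_normal_distribution (\<lambda>z. z\<^sup>2)" "(\<integral>z. z\<^sup>2 \<partial>std_normal_distribution) = 1"
  using integrable_std_normal_distribution_moment[of 1] integrable_std_normal_distribution_moment[of 2]
    integral_std_normal_distribution_moment_odd[of 1] std_normal_distribution_even_moments(1)[of 1]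
  by simp_all

lemma std_normal_uminus:
  "distr std_normal_distribution borel uminus = std_normal_distribution"
proof -
  have "distributed std_normal_distribution lborel (\<lambda>x. x) std_normal_density"
    by (auto simp: distributed_def distr_id2[of lborel] measurable_ident_sets)
  from std_normal.normal_density_affine[OF this, of "-1" 0]
  have "distributed std_normal_distribution lborel (\<lambda>x. - x) std_normal_density"
    by simp
  then have "distr std_normal_distribution lborel (\<lambda>x. - x) = std_normal_distribution"
    by (simp add: distributed_distr_eq_density)
  then show ?thesis by (simp cong: distr_cong)
qed

lemma std_normal_half: "measure std_normal_distribution {0..} \<ge> 1/2"
proof -
  have "measure std_normal_distribution {0..} = measure (distr std_normal_distribution borel uminus) {0..}"
    by (simp add: std_normal_uminus)
  also have "\<dots> = measure std_normal_distribution {..0}"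
    by (subst measure_distr) (auto intro!: arg_cong2[where f = measure])
  finally have eq: "measure std_normal_distribution {0..} = measure std_normal_distribution {..0}" .
  have "1 = measure std_normal_distribution ({0..} \<union> {..0})"
  proof -
    have "{0..} \<union> {..0} = (UNIV :: real set)" by auto
    then show ?thesis using std_normal.prob_space by simp
  qed
  also have "\<dots> \<le> measure std_normal_distribution {0..} + measure std_normal_distribution {..0}"
    by (rule measure_Un_le) auto
  finally show ?thesis using eq by simp
qed

text \<open>\<open>u\<close> is monotone, and with probability at least 1/2 the Gaussian shift goes
  to the right. This compares different amounts of smoothing when the Lindeberg errors are
  absorbed.\<close>

lemma slow_le_heat:
  assumes "slow \<theta> u u1 u2" "0 \<le> \<theta>" "0 \<le> s"
  shows "u w \<le> 2 * heat s u w"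
proof -
  have "u w * (1/2) \<le> u w * measure std_normal_distribution {0..}"
    using slow_nonneg[OF assms(1)] std_normal_half by (intro mult_left_mono) auto
  also have "\<dots> = (\<integral>z. u w * indicator {0..} z \<partial>std_normal_distribution)"
    by simp
  also have "\<dots> \<le> heat s u w"
    unfolding heat_def
  proof (rule integral_mono)
    show "integrable std_normal_distribution (\<lambda>z. u w * indicator {0..} z)"
      by (intro integrable_mult_right std_normal.integrable_const_bound[where B = 1]) auto
    show "integrable std_normal_distribution (\<lambda>z. u (w + sqrt s * z))"
      by (rule slow_integrable_std_normal[OF assms(1,2)])
    show "u w * indicator {0..} z \<le> u (w + sqrt s * z)" for z
      using monoD[OF slow_mono[OF assms(1)], of w "w + sqrt s * z"] slow_nonneg[OF assms(1)] assms(3)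
      by (auto simp: indicator_def)
  qed
  finally show ?thesis by simp
qed

lemma integrable_std_normal_exp: "integrable std_normal_distribution (\<lambda>z. exp (c * z))"
proof -
  have "std_normal_density z * exp (c * z) = exp (c\<^sup>2 / 2) * normal_density c 1 z" for z
  proof -
    have e: "- (z\<^sup>2 / 2) + c * z = c\<^sup>2 / 2 + - ((z - c)\<^sup>2 / 2)"
      by (simp add: power2_eq_square algebra_simps) (simp add: field_simps)
    have "exp (- (z\<^sup>2 / 2)) * exp (c * z) = exp (c\<^sup>2 / 2) * exp (- ((z - c)\<^sup>2 / 2))"
      unfolding exp_add[symmetric] e ..
    then show ?thesis by (simp add: normal_density_def)
  qed
  then have "integrable lborel (\<lambda>z. std_normal_density z * exp (c * z))"
    by simp
  then show ?thesis
    by (subst integrable_real_density) auto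
qed

lemma integrable_std_normal_cube_exp:
  "integrable std_normal_distribution (\<lambda>z. \<bar>z\<bar> ^ 3 * exp \<bar>z\<bar>)"
proof (rule Bochner_Integration.integrable_bound)
  show "integrable std_normal_distribution (\<lambda>z. 6 * (exp (2 * z) + exp (- 2 * z)))"
    using integrable_std_normal_exp[of 2] integrable_std_normal_exp[of "-2"]
    by (intro integrable_mult_right Bochner_Integration.integrable_add) simp_all
  have "\<bar>z\<bar> ^ 3 * exp \<bar>z\<bar> \<le> 6 * (exp (2 * z) + exp (- 2 * z))" for z :: real
  proof -
    \<comment> \<open>The first four terms of the exponential series give
      \<open>|z|^3 \<le> 3! * exp |z|\<close>.\<close>
    have "(\<Sum>n<4. \<bar>z\<bar> ^ n / fact n) \<le> exp \<bar>z\<bar>"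
      using sum_le_suminf[OF summable_exp_generic[of "\<bar>z\<bar>"], of "{..<4}"]
      by (simp add: exp_def divide_inverse_commute)
    then have "1 + \<bar>z\<bar> + \<bar>z\<bar>\<^sup>2 / 2 + \<bar>z\<bar> ^ 3 / 6 \<le> exp \<bar>z\<bar>"
      by (simp add: eval_nat_numeral)
    moreover have "0 \<le> \<bar>z\<bar>\<^sup>2" by simp
    ultimately have "\<bar>z\<bar> ^ 3 \<le> 6 * exp \<bar>z\<bar>" by linarith
    then have "\<bar>z\<bar> ^ 3 * exp \<bar>z\<bar> \<le> 6 * exp \<bar>z\<bar> * exp \<bar>z\<bar>"
      by (intro mult_right_mono) auto
    also have "\<dots> = 6 * exp (2 * \<bar>z\<bar>)" by (simp add: exp_add[symmetric])
    also have "\<dots> \<le> 6 * (exp (2 * z) + exp (- 2 * z))"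
      by (cases "0 \<le> z") auto
    finally show ?thesis .
  qed
  then show "AE z in std_normal_distribution. norm (\<bar>z\<bar> ^ 3 * exp \<bar>z\<bar>) \<le> norm (6 * (exp (2 * z) + exp (- 2 * z)))"
    by (intro AE_I2) (simp add: abs_mult add_pos_pos)
qed auto

text \<open>Remainder constant for the third-order expansion of one Gaussian step; the factor
  \<open>exp |z|\<close> pays for the growth of the test function over that step.\<close>

definition gauss_const :: real where
  "gauss_const = (\<integral>z. \<bar>z\<bar> ^ 3 * exp \<bar>z\<bar> \<partial>std_normal_distribution)"

lemma gauss_const_nonneg: "0 \<le> gauss_const"
  unfolding gauss_const_def by (intro integral_nonneg_AE AE_I2) auto

text \<open>The first-order term integrates to 0 and the second-order term to
  \<open>s / 2 * u2 w\<close>, so only the Taylor remainder is left. The condition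
  \<open>\<theta> * sqrt s \<le> 1\<close> bounds its exponential factor by \<open>exp |z|\<close>,
  free of \<theta> and s.\<close>

lemma slow_heat_taylor:
  assumes S: "slow \<theta> u u1 u2" and "0 \<le> \<theta>" "0 \<le> s" "\<theta> * sqrt s \<le> 1"
  shows "\<bar>heat s u w - u w - s / 2 * u2 w\<bar> \<le> gauss_const * \<theta> ^ 3 * sqrt s ^ 3 * u w"
proof -
  note int = slow_integrable_std_normal[OF S assms(2)]
  have eq: "heat s u w - u w - s / 2 * u2 w =
    (\<integral>z. u (w + sqrt s * z) - u w - sqrt s * z * u1 w - (sqrt s * z)\<^sup>2 / 2 * u2 w \<partial>std_normal_distribution)"
  proof -
    have 1: "integrable std_normal_distribution (\<lambda>z. sqrt s * z * u1 w)"
      "(\<integral>z. sqrt s * z * u1 w \<partial>std_normal_distribution) = 0"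
      using std_normal_moments(1,2) by simp_all
    have "(\<lambda>z. (sqrt s * z)\<^sup>2 / 2 * u2 w) = (\<lambda>z. s / 2 * u2 w * z\<^sup>2)"
      using assms(3) by (simp add: power_mult_distrib mult_ac)
    then have 2: "integrable std_normal_distribution (\<lambda>z. (sqrt s * z)\<^sup>2 / 2 * u2 w)"
      "(\<integral>z. (sqrt s * z)\<^sup>2 / 2 * u2 w \<partial>std_normal_distribution) = s / 2 * u2 w"
      using std_normal_moments(3,4) by simp_all
    have 3: "(\<integral>z. u w \<partial>std_normal_distribution) = u w"
      using std_normal.prob_space by simp
    have 4: "integrable std_normal_distribution (\<lambda>z. u w)"
      by (rule std_normal.integrable_const)
    note i = int(1)[of w "sqrt s"]
    show ?thesis
      unfolding heat_def
      apply (subst Bochner_Integration.integral_diff)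
      apply (intro Bochner_Integration.integrable_diff i 4 1(1))
      apply (rule 2(1))
      apply (subst Bochner_Integration.integral_diff)
      apply (intro Bochner_Integration.integrable_diff i 4)
      apply (rule 1(1))
      apply (subst Bochner_Integration.integral_diff[OF i 4])
      apply (subst 1(2), subst 2(2), subst 3)
      apply (simp only: diff_0_right)
      done
  qed
  have "\<bar>heat s u w - u w - s / 2 * u2 w\<bar> \<le> (\<integral>z. (\<theta> ^ 3 * sqrt s ^ 3 * u w) * (\<bar>z\<bar> ^ 3 * exp \<bar>z\<bar>) \<partial>std_normal_distribution)"
    unfolding eq
  proof (rule abs_integral_le)
    show "integrable std_normal_distribution (\<lambda>z. (\<theta> ^ 3 * sqrt s ^ 3 * u w) * (\<bar>z\<bar> ^ 3 * exp \<bar>z\<bar>))"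
      by (intro integrable_mult_right integrable_std_normal_cube_exp)
    fix z
    have "\<theta> * sqrt s * \<bar>z\<bar> \<le> 1 * \<bar>z\<bar>"
      using assms(4) by (intro mult_right_mono) auto
    then have e: "exp (\<theta> * \<bar>sqrt s * z\<bar>) \<le> exp \<bar>z\<bar>"
      using assms(3) by (simp add: abs_mult mult.assoc)
    have "\<bar>u (w + sqrt s * z) - u w - sqrt s * z * u1 w - (sqrt s * z)\<^sup>2 / 2 * u2 w\<bar>
       \<le> \<theta> ^ 3 * \<bar>sqrt s * z\<bar> ^ 3 * exp (\<theta> * \<bar>sqrt s * z\<bar>) * u w"
      by (rule slow_taylor[OF S])
    also have "\<dots> \<le> \<theta> ^ 3 * \<bar>sqrt s * z\<bar> ^ 3 * exp \<bar>z\<bar> * u w"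
      using e assms(2,3) slow_nonneg[OF S, of w] by (intro mult_right_mono mult_left_mono) auto
    finally show "\<bar>u (w + sqrt s * z) - u w - sqrt s * z * u1 w - (sqrt s * z)\<^sup>2 / 2 * u2 w\<bar>
       \<le> (\<theta> ^ 3 * sqrt s ^ 3 * u w) * (\<bar>z\<bar> ^ 3 * exp \<bar>z\<bar>)"
      using assms(3) by (simp only: abs_mult power_mult_distrib abs_of_nonneg real_sqrt_ge_zero mult_ac)
  qed
  also have "\<dots> = (\<theta> ^ 3 * sqrt s ^ 3 * u w) * gauss_const"
    unfolding gauss_const_def by (rule integral_mult_right_zero)
  finally show ?thesis by (simp only: mult_ac)
qed

text \<open>Variances of independent centred normal variables add up. Zero times are treated apart
  because a normal law of variance 0 has no density.\<close>

lemma heat_heat: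
  assumes "slow \<theta> u u1 u2" "0 \<le> \<theta>" "0 \<le> s" "0 \<le> t"
  shows "heat t (heat s u) = heat (s + t) u"
proof (cases "s = 0 \<or> t = 0")
  case False
  then have st: "0 < s" "0 < t" using assms by auto
  note [measurable] = slow_measurable[OF assms(1)]
  define G where "G r = density lborel (normal_density 0 (sqrt r))" for r
  have [simp, measurable_cong]: "sets (G r) = sets borel" for r by (simp add: G_def)
  have prob: "prob_space (G r)" if "0 < r" for r
    unfolding G_def using prob_space_normal_density that by simp
  have G_eq: "G r = distr std_normal_distribution borel (\<lambda>z. sqrt r * z)" if "0 < r" for r
  proof -
    have "distributed std_normal_distribution lborel (\<lambda>x. x) std_normal_density"
      by (auto simp: distributed_def distr_id2[of lborel] measurable_ident_sets)
    from std_normal.normal_density_affine[OF this, of "sqrt r" 0]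
    have "distributed std_normal_distribution lborel (\<lambda>x. sqrt r * x) (normal_density 0 (sqrt r))"
      using that by simp
    then have "distr std_normal_distribution lborel (\<lambda>x. sqrt r * x) = G r"
      by (simp add: distributed_distr_eq_density G_def)
    then show ?thesis by (simp cong: distr_cong)
  qed
  have heat_eq: "heat r f w = (\<integral>y. f (w + y) \<partial>G r)"
    if "0 < r" and [measurable]: "f \<in> borel_measurable borel" for r f w
    unfolding heat_def G_eq[OF that(1)] by (subst integral_distr) auto
  interpret s: prob_space "G s" by (rule prob) (fact st)
  interpret t: prob_space "G t" by (rule prob) (fact st)
  interpret P: pair_prob_space "G t" "G s" ..
  have "G t \<star> G s = G (t + s)"
    unfolding G_def using st conv_normal_density_zero_mean[of "sqrt t" "sqrt s"]
    by (subst convolution_density)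
       (auto simp: ennreal_mult'[symmetric] prob_space.finite_measure prob_space_normal_density)
  then have conv: "distr (G t \<Otimes>\<^sub>M G s) borel (\<lambda>(x, y). x + y) = G (s + t)"
    by (simp add: convolution_def add.commute)
  show ?thesis
  proof
    fix w
    have int: "integrable (G t \<Otimes>\<^sub>M G s) (\<lambda>(x, y). u (w + x + y))"
      using slow_nonneg[OF assms(1)] slow_le_1[OF assms(1)]
      by (intro P.integrable_const_bound[where B = 1]) auto
    have [measurable]: "heat s u \<in> borel_measurable borel"
      unfolding heat_def[abs_def] by measurable
    have "heat t (heat s u) w = (\<integral>x. (\<integral>y. u (w + x + y) \<partial>G s) \<partial>G t)"
      using st by (simp add: heat_eq)
    also have "\<dots> = (\<integral>p. (case p of (x, y) \<Rightarrow> u (w + x + y)) \<partial>(G t \<Otimes>\<^sub>M G s))"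
      using P.integral_fst'[OF int] by simp
    also have "\<dots> = (\<integral>z. u (w + z) \<partial>distr (G t \<Otimes>\<^sub>M G s) borel (\<lambda>(x, y). x + y))"
      by (subst integral_distr) (auto simp: case_prod_beta' add.assoc)
    also have "\<dots> = heat (s + t) u w"
      using st by (simp add: conv heat_eq)
    finally show "heat t (heat s u) w = heat (s + t) u w" .
  qed
qed auto

section \<open>Lindeberg replacement for mixing sequences\<close>

text \<open>Exactly the decorrelation that the expansion consumes: one variable, or a product of
  two, against a past variable \<open>V\<close>. The L^1 norm of \<open>V\<close> on the right is
  what keeps errors relative. In \<open>mixing2\<close> the rate depends on the first gap
  \<open>l\<close> only, however far apart the two factors are.\<close>

locale mixing_sequence = prob_space M for M :: "'w measure" +
  fixes F :: "nat \<Rightarrow> 'w measure" and X :: "nat \<Rightarrow> 'w \<Rightarrow> real"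
    and c \<psi> :: "nat \<Rightarrow> real" and K :: real
  assumes subalg: "\<And>i. subalgebra M (F i)"
    and filtration: "\<And>i j. i \<le> j \<Longrightarrow> subalgebra (F j) (F i)"
    and adapted: "\<And>i. X i \<in> borel_measurable (F i)"
    and K_ge_1: "1 \<le> K"
    and X_bound: "\<And>i \<omega>. \<omega> \<in> space M \<Longrightarrow> \<bar>X i \<omega>\<bar> \<le> K"
    and centered: "\<And>i. expectation (X i) = 0"
    and covariance: "\<And>i j. expectation (\<lambda>\<omega>. X i \<omega> * X (i + j) \<omega>) = c j"
    and \<psi>_nonneg: "\<And>i. 0 \<le> \<psi> i"
    and mixing1: "\<And>V a l. V \<in> borel_measurable (F a) \<Longrightarrow> integrable M V \<Longrightarrow> 1 \<le> l \<Longrightarrow>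
          \<bar>expectation (\<lambda>\<omega>. V \<omega> * X (a + l) \<omega>)\<bar> \<le> \<psi> l * expectation (\<lambda>\<omega>. \<bar>V \<omega>\<bar>)"
    and mixing2: "\<And>V a l j. V \<in> borel_measurable (F a) \<Longrightarrow> integrable M V \<Longrightarrow> 1 \<le> l \<Longrightarrow>
          \<bar>expectation (\<lambda>\<omega>. V \<omega> * (X (a + l) \<omega> * X (a + l + j) \<omega> - c j))\<bar>
            \<le> \<psi> l * expectation (\<lambda>\<omega>. \<bar>V \<omega>\<bar>)"
begin

definition S :: "nat \<Rightarrow> 'w \<Rightarrow> real" where
  "S k \<omega> = (\<Sum>i=1..k. X i \<omega>)"

lemma S_0 [simp]: "S 0 \<omega> = 0"
  and S_Suc: "S (Suc k) \<omega> = S k \<omega> + X (Suc k) \<omega>"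
  by (auto simp: S_def)

lemma S_adapted: "S k \<in> borel_measurable (F k)"
proof -
  have "X i \<in> borel_measurable (F k)" if "i \<in> {1..k}" for i
    using measurable_from_subalg[OF filtration adapted] that by simp
  then show ?thesis unfolding S_def[abs_def] by (rule borel_measurable_sum)
qed

lemma X_measurable [measurable]: "X i \<in> borel_measurable M"
  using measurable_from_subalg[OF subalg adapted] .

lemma S_measurable [measurable]: "S i \<in> borel_measurable M"
  using measurable_from_subalg[OF subalg S_adapted] .

lemma integrable_bounded:
  assumes "f \<in> borel_measurable M" "\<And>\<omega>. \<omega> \<in> space M \<Longrightarrow> \<bar>f \<omega>\<bar> \<le> (C::real)"
  shows "integrable M f"
  using assms by (intro integrable_const_bound[where B = C]) auto

lemma integrable_mult_bounded:
  assumes "integrable M f" "g \<in> borel_measurable M" "\<And>\<omega>. \<omega> \<in> space M \<Longrightarrow> \<bar>g \<omega>\<bar> \<le> (C::real)"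
  shows "integrable M (\<lambda>\<omega>. f \<omega> * g \<omega> :: real)"
proof (rule Bochner_Integration.integrable_bound)
  show "integrable M (\<lambda>\<omega>. C * f \<omega>)" using assms by simp
  show "AE \<omega> in M. norm (f \<omega> * g \<omega>) \<le> norm (C * f \<omega>)"
  proof (intro AE_I2)
    fix \<omega> assume "\<omega> \<in> space M"
    then have "\<bar>g \<omega>\<bar> \<le> \<bar>C\<bar>" using assms(3)[of \<omega>] by linarith
    then show "norm (f \<omega> * g \<omega>) \<le> norm (C * f \<omega>)"
      using mult_left_mono[of "\<bar>g \<omega>\<bar>" "\<bar>C\<bar>" "\<bar>f \<omega>\<bar>"] by (simp add: abs_mult mult.commute)
  qed
qed (use assms in measurable)

lemma X_pair_bound: "\<omega> \<in> space M \<Longrightarrow> \<bar>X i \<omega> * X j \<omega>\<bar> \<le> K * K"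
  using X_bound[of \<omega>] K_ge_1 by (auto simp: abs_mult intro!: mult_mono)

lemma integrable_X [simp]: "integrable M (X i)"
  by (rule integrable_bounded[OF _ X_bound]) simp

lemma integrable_XX [simp]: "integrable M (\<lambda>\<omega>. X i \<omega> * X j \<omega>)"
  by (rule integrable_bounded[OF _ X_pair_bound]) simp_all

lemma c_bound: assumes "1 \<le> j" shows "\<bar>c j\<bar> \<le> K * \<psi> j"
proof -
  have "\<bar>c j\<bar> \<le> \<psi> j * expectation (\<lambda>\<omega>. \<bar>X 0 \<omega>\<bar>)"
    using mixing1[OF adapted integrable_X assms, of 0] covariance[of 0 j] by simp
  also have "\<dots> \<le> \<psi> j * K"
    by (intro mult_left_mono \<psi>_nonneg integral_le_const) (auto simp: X_bound)
  finally show ?thesis by (simp add: mult.commute)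
qed

end

text \<open>Setting for the exchange of one variable after time \<open>k\<close>. \<open>B\<close>
  has to dominate the expectations at all times up to \<open>k\<close>, since an increment of the
  test function at time \<open>p\<close> costs a multiple of
  \<open>expectation (\<lambda>\<omega>. u (S p \<omega>))\<close>.\<close>

locale smooth_test = mixing_sequence M F X c \<psi> K
  for M :: "'w measure" and F X c \<psi> K +
  fixes \<theta> B :: real and u u1 u2 :: "real \<Rightarrow> real" and k :: nat
  assumes slow: "slow \<theta> u u1 u2"
    and \<theta>: "0 \<le> \<theta>" "\<theta> * K \<le> 1"
    and B: "\<And>p. p \<le> k \<Longrightarrow> expectation (\<lambda>\<omega>. u (S p \<omega>)) \<le> B"
begin

lemmas u_measurable [measurable] = slow_measurable[OF slow]
lemmas u_nonneg [simp] = slow_nonneg[OF slow]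

lemma integrable_u [simp]: "integrable M (\<lambda>\<omega>. u (S p \<omega>))"
  "integrable M (\<lambda>\<omega>. u1 (S p \<omega>))" "integrable M (\<lambda>\<omega>. u2 (S p \<omega>))"
proof -
  have "\<bar>u1 w\<bar> \<le> \<theta>" for w
    using slow_bound1[OF slow, of w] mult_left_mono[OF slow_le_1[OF slow, of w] \<theta>(1)] by simp
  moreover have "\<bar>u2 w\<bar> \<le> \<theta>\<^sup>2" for w
    using slow_bound2[OF slow, of w] mult_left_mono[OF slow_le_1[OF slow, of w], of "\<theta>\<^sup>2"] by simp
  moreover have "\<bar>u w\<bar> \<le> 1" for w
    using slow_le_1[OF slow, of w] by simp
  ultimately show "integrable M (\<lambda>\<omega>. u (S p \<omega>))"
  "integrable M (\<lambda>\<omega>. u1 (S p \<omega>))" "integrable M (\<lambda>\<omega>. u2 (S p \<omega>))"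
    by (simp_all add: integrable_bounded[where C = 1] integrable_bounded[where C = \<theta>]
        integrable_bounded[where C = "\<theta>\<^sup>2"])
qed

lemma B_nonneg: "0 \<le> B"
  using B[of 0] u_nonneg[of 0] by (simp add: prob_space del: u_nonneg)

lemma exp_le_3: "\<omega> \<in> space M \<Longrightarrow> exp (\<theta> * \<bar>X i \<omega>\<bar>) \<le> 3"
proof -
  assume "\<omega> \<in> space M"
  then have "\<theta> * \<bar>X i \<omega>\<bar> \<le> \<theta> * K" by (intro mult_left_mono X_bound \<theta>)
  then have "exp (\<theta> * \<bar>X i \<omega>\<bar>) \<le> exp 1" using \<theta> by simp
  then show ?thesis using exp_le by linarith
qed

lemma power_increment_bound:
  assumes "\<omega> \<in> space M" "\<bar>d\<bar> \<le> \<theta> ^ r * \<bar>X i \<omega>\<bar> ^ q * exp (\<theta> * \<bar>X i \<omega>\<bar>) * u w"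
  shows "\<bar>d\<bar> \<le> 3 * K ^ q * \<theta> ^ r * u w"
proof -
  have "\<theta> ^ r * \<bar>X i \<omega>\<bar> ^ q * exp (\<theta> * \<bar>X i \<omega>\<bar>) * u w \<le> \<theta> ^ r * K ^ q * 3 * u w"
    using X_bound[OF assms(1)] exp_le_3[OF assms(1)] \<theta> K_ge_1
    by (intro mult_right_mono mult_mono mult_left_mono power_mono) auto
  then show ?thesis using assms(2) by (simp add: mult_ac)
qed

lemma
  assumes "\<omega> \<in> space M"
  shows increment2: "\<bar>u2 (S (Suc p) \<omega>) - u2 (S p \<omega>)\<bar> \<le> 3 * K * \<theta> ^ 3 * u (S p \<omega>)"
    and increment1: "\<bar>u1 (S (Suc p) \<omega>) - u1 (S p \<omega>)\<bar> \<le> 3 * K * \<theta>\<^sup>2 * u (S p \<omega>)"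
    and taylor1: "\<bar>u1 (S (Suc p) \<omega>) - u1 (S p \<omega>) - X (Suc p) \<omega> * u2 (S p \<omega>)\<bar>
                    \<le> 3 * K\<^sup>2 * \<theta> ^ 3 * u (S p \<omega>)"
    and taylor: "\<bar>u (S (Suc p) \<omega>) - u (S p \<omega>) - X (Suc p) \<omega> * u1 (S p \<omega>)
                    - (X (Suc p) \<omega>)\<^sup>2 / 2 * u2 (S p \<omega>)\<bar> \<le> 3 * K ^ 3 * \<theta> ^ 3 * u (S p \<omega>)"
  using power_increment_bound[OF assms, of "u2 (S p \<omega> + X (Suc p) \<omega>) - u2 (S p \<omega>)" 3 "Suc p" 1 "S p \<omega>"]
    power_increment_bound[OF assms, of "u1 (S p \<omega> + X (Suc p) \<omega>) - u1 (S p \<omega>)" 2 "Suc p" 1 "S p \<omega>"]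
    power_increment_bound[OF assms _, OF slow_taylor1[OF slow]]
    power_increment_bound[OF assms _, OF slow_taylor[OF slow]]
    slow_increment2[OF slow, of "S p \<omega>" "X (Suc p) \<omega>"] slow_increment1[OF slow, of "S p \<omega>" "X (Suc p) \<omega>"]
  unfolding S_Suc power_one_right by blast+

lemma expectation_le:
  assumes "\<And>\<omega>. \<omega> \<in> space M \<Longrightarrow> \<bar>f \<omega>\<bar> \<le> C * u (S p \<omega>)" "0 \<le> C" "p \<le> k"
  shows "\<bar>expectation f\<bar> \<le> C * B" "expectation (\<lambda>\<omega>. \<bar>f \<omega>\<bar>) \<le> C * B"
proof -
  have i: "integrable M (\<lambda>\<omega>. C * u (S p \<omega>))" by simp
  have "(\<integral>\<omega>. C * u (S p \<omega>) \<partial>M) \<le> C * B"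
    using B[OF assms(3)] assms(2) by (simp add: mult_left_mono)
  moreover have "\<bar>expectation f\<bar> \<le> (\<integral>\<omega>. C * u (S p \<omega>) \<partial>M)"
    by (rule abs_integral_le[OF i]) (rule assms(1))
  moreover have "\<bar>expectation (\<lambda>\<omega>. \<bar>f \<omega>\<bar>)\<bar> \<le> (\<integral>\<omega>. C * u (S p \<omega>) \<partial>M)"
    by (rule abs_integral_le[OF i]) (simp add: assms(1))
  ultimately show "\<bar>expectation f\<bar> \<le> C * B" "expectation (\<lambda>\<omega>. \<bar>f \<omega>\<bar>) \<le> C * B"
    by linarith+
qed

text \<open>\<open>S 0\<close> is 0, so the starting term is the constant \<open>g 0\<close> times
  the mean of \<open>Y\<close> and disappears.\<close>

lemma telescope:
  fixes g :: "real \<Rightarrow> real" and Y :: "'w \<Rightarrow> real"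
  assumes "\<And>p. integrable M (\<lambda>\<omega>. g (S p \<omega>) * Y \<omega>)" "expectation Y = 0"
  shows "expectation (\<lambda>\<omega>. g (S n \<omega>) * Y \<omega>) =
    (\<Sum>p<n. expectation (\<lambda>\<omega>. (g (S (Suc p) \<omega>) - g (S p \<omega>)) * Y \<omega>))"
proof -
  have "(\<Sum>p<n. expectation (\<lambda>\<omega>. (g (S (Suc p) \<omega>) - g (S p \<omega>)) * Y \<omega>)) =
    (\<Sum>p<n. expectation (\<lambda>\<omega>. g (S (Suc p) \<omega>) * Y \<omega>) - expectation (\<lambda>\<omega>. g (S p \<omega>) * Y \<omega>))"
    by (intro sum.cong refl) (simp only: left_diff_distrib Bochner_Integration.integral_diff[OF assms(1) assms(1)])
  also have "\<dots> = expectation (\<lambda>\<omega>. g (S n \<omega>) * Y \<omega>) - expectation (\<lambda>\<omega>. g (S 0 \<omega>) * Y \<omega>)"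
    by (rule sum_lessThan_telescope)
  finally show ?thesis using assms(2) by simp
qed

lemma diff_adapted:
  fixes g :: "real \<Rightarrow> real"
  assumes "g \<in> borel_measurable borel"
  shows "(\<lambda>\<omega>. g (S (Suc p) \<omega>) - g (S p \<omega>)) \<in> borel_measurable (F (Suc p))"
proof (rule borel_measurable_diff)
  show "(\<lambda>\<omega>. g (S (Suc p) \<omega>)) \<in> borel_measurable (F (Suc p))"
    by (rule measurable_compose[OF S_adapted assms])
  show "(\<lambda>\<omega>. g (S p \<omega>)) \<in> borel_measurable (F (Suc p))"
    by (rule measurable_compose[OF measurable_from_subalg[OF filtration S_adapted] assms]) simp
qed

text \<open>The increment of \<open>u2\<close> at time \<open>p\<close> costs
  \<open>\<theta> ^ 3\<close> and is known at time \<open>p + 1\<close>; the gap from there to time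
  \<open>k + 1\<close> is \<open>k - p\<close>.\<close>

lemma quadratic_diagonal:
  "\<bar>expectation (\<lambda>\<omega>. u2 (S k \<omega>) * ((X (Suc k) \<omega>)\<^sup>2 - c 0))\<bar> \<le> (\<Sum>p<k. \<psi> (k - p)) * (3 * K * \<theta> ^ 3 * B)"
proof -
  have m: "(\<lambda>\<omega>. (X (Suc k) \<omega>)\<^sup>2 - c 0) \<in> borel_measurable M" by measurable
  have i: "integrable M (\<lambda>\<omega>. g (S p \<omega>) * ((X (Suc k) \<omega>)\<^sup>2 - c 0))"
    if "integrable M (\<lambda>\<omega>. g (S p \<omega>))" for g p
    using that
  proof (rule integrable_mult_bounded[OF _ m])
    fix \<omega> assume "\<omega> \<in> space M"
    from X_pair_bound[OF this, of "Suc k" "Suc k"]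
    show "\<bar>(X (Suc k) \<omega>)\<^sup>2 - c 0\<bar> \<le> K * K + \<bar>c 0\<bar>"
      unfolding power2_eq_square by linarith
  qed
  have z: "expectation (\<lambda>\<omega>. (X (Suc k) \<omega>)\<^sup>2 - c 0) = 0"
    using covariance[of "Suc k" 0] by (simp add: power2_eq_square prob_space)
  have "\<bar>expectation (\<lambda>\<omega>. (u2 (S (Suc p) \<omega>) - u2 (S p \<omega>)) * ((X (Suc k) \<omega>)\<^sup>2 - c 0))\<bar>
      \<le> \<psi> (k - p) * (3 * K * \<theta> ^ 3 * B)" if "p < k" for p
  proof -
    have "\<bar>expectation (\<lambda>\<omega>. (u2 (S (Suc p) \<omega>) - u2 (S p \<omega>)) *
        (X (Suc p + (k - p)) \<omega> * X (Suc p + (k - p) + 0) \<omega> - c 0))\<bar>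
      \<le> \<psi> (k - p) * expectation (\<lambda>\<omega>. \<bar>u2 (S (Suc p) \<omega>) - u2 (S p \<omega>)\<bar>)"
      using that by (intro mixing2 diff_adapted) auto
    also have "\<dots> \<le> \<psi> (k - p) * (3 * K * \<theta> ^ 3 * B)"
      using that \<theta> K_ge_1
      by (intro mult_left_mono expectation_le(2)[where p = p] \<psi>_nonneg increment2) auto
    finally show ?thesis using that by (simp add: power2_eq_square)
  qed
  then show ?thesis
    unfolding telescope[of u2 "\<lambda>\<omega>. (X (Suc k) \<omega>)\<^sup>2 - c 0", OF i[OF integrable_u(3)] z] sum_distrib_right
    by (intro order_trans[OF sum_abs] sum_mono) auto
qed

lemma integrable_mult_X [simp]:
  "integrable M f \<Longrightarrow> integrable M (\<lambda>\<omega>. f \<omega> * X i \<omega>)"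
  by (rule integrable_mult_bounded[OF _ _ X_bound]) auto

lemma integrable_mult_XX:
  "integrable M f \<Longrightarrow> integrable M (\<lambda>\<omega>. f \<omega> * (X i \<omega> * X j \<omega> - a))"
proof (rule integrable_mult_bounded)
  fix \<omega> assume "\<omega> \<in> space M"
  from X_pair_bound[OF this, of i j]
  show "\<bar>X i \<omega> * X j \<omega> - a\<bar> \<le> K * K + \<bar>a\<bar>" by linarith
qed auto

text \<open>An increment at time \<open>q\<close> can be separated in two ways: from the whole
  centred product across the gap \<open>p - q\<close>, or from the last factor alone across the gap
  \<open>k - p\<close>, where the covariance is itself of the order of \<psi>. Taking the smaller
  bound for each \<open>q\<close> keeps the sum over \<open>q\<close> bounded uniformly in
  \<open>p\<close>.\<close>

lemma quadratic_offdiagonal: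
  assumes "p < k"
  shows "\<bar>expectation (\<lambda>\<omega>. u2 (S p \<omega>) * (X (Suc p) \<omega> * X (Suc k) \<omega> - c (k - p)))\<bar>
    \<le> (\<Sum>q<p. min (\<psi> (p - q)) (2 * K * \<psi> (k - p))) * (3 * K * \<theta> ^ 3 * B)"
proof -
  define Y where "Y \<omega> = X (Suc p) \<omega> * X (Suc k) \<omega> - c (k - p)" for \<omega>
  have k: "Suc p + (k - p) = Suc k" using assms by simp
  have z: "expectation Y = 0"
    unfolding Y_def using covariance[of "Suc p" "k - p"] unfolding k by (simp add: prob_space)
  have "\<bar>expectation (\<lambda>\<omega>. (u2 (S (Suc q) \<omega>) - u2 (S q \<omega>)) * Y \<omega>)\<bar>
      \<le> min (\<psi> (p - q)) (2 * K * \<psi> (k - p)) * (3 * K * \<theta> ^ 3 * B)" if q: "q < p" for q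
  proof -
    define V where "V \<omega> = u2 (S (Suc q) \<omega>) - u2 (S q \<omega>)" for \<omega>
    have V: "V \<in> borel_measurable (F (Suc q))" "integrable M V"
      unfolding V_def by (auto intro: diff_adapted)
    have EV: "expectation (\<lambda>\<omega>. \<bar>V \<omega>\<bar>) \<le> 3 * K * \<theta> ^ 3 * B"
      unfolding V_def using assms q \<theta> K_ge_1 by (intro expectation_le(2)[where p = q] increment2) auto
    have EV0: "0 \<le> expectation (\<lambda>\<omega>. \<bar>V \<omega>\<bar>)" by simp
    have "\<bar>expectation (\<lambda>\<omega>. V \<omega> * (X (Suc q + (p - q)) \<omega> * X (Suc q + (p - q) + (k - p)) \<omega> - c (k - p)))\<bar>
        \<le> \<psi> (p - q) * expectation (\<lambda>\<omega>. \<bar>V \<omega>\<bar>)"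
      using q by (intro mixing2 V) auto
    moreover have "Suc q + (p - q) = Suc p" "Suc q + (p - q) + (k - p) = Suc k"
      using q assms by auto
    ultimately have 1: "\<bar>expectation (\<lambda>\<omega>. V \<omega> * Y \<omega>)\<bar> \<le> \<psi> (p - q) * expectation (\<lambda>\<omega>. \<bar>V \<omega>\<bar>)"
      unfolding Y_def by simp
    \<comment> \<open>For the second separation, the first factor of the product joins the past
      variable.\<close>
    have "(\<lambda>\<omega>. V \<omega> * X (Suc p) \<omega>) \<in> borel_measurable (F (Suc p))"
      using measurable_from_subalg[OF filtration V(1), of "Suc p"] q adapted[of "Suc p"] by simp
    then have "\<bar>expectation (\<lambda>\<omega>. (V \<omega> * X (Suc p) \<omega>) * X (Suc p + (k - p)) \<omega>)\<bar>
        \<le> \<psi> (k - p) * expectation (\<lambda>\<omega>. \<bar>V \<omega> * X (Suc p) \<omega>\<bar>)"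
      using assms V by (intro mixing1) auto
    also have "\<dots> \<le> \<psi> (k - p) * expectation (\<lambda>\<omega>. \<bar>V \<omega>\<bar> * K)"
    proof (intro mult_left_mono \<psi>_nonneg integral_mono)
      show "integrable M (\<lambda>\<omega>. \<bar>V \<omega> * X (Suc p) \<omega>\<bar>)" "integrable M (\<lambda>\<omega>. \<bar>V \<omega>\<bar> * K)"
        using V by (auto intro!: integrable_abs)
      show "\<bar>V \<omega> * X (Suc p) \<omega>\<bar> \<le> \<bar>V \<omega>\<bar> * K" if "\<omega> \<in> space M" for \<omega>
        unfolding abs_mult using that by (intro mult_left_mono X_bound) auto
    qed
    finally have "\<bar>expectation (\<lambda>\<omega>. (V \<omega> * X (Suc p) \<omega>) * X (Suc k) \<omega>)\<bar>
        \<le> K * \<psi> (k - p) * expectation (\<lambda>\<omega>. \<bar>V \<omega>\<bar>)"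
      using k by (simp add: mult_ac)
    moreover have "\<bar>c (k - p) * expectation V\<bar> \<le> K * \<psi> (k - p) * expectation (\<lambda>\<omega>. \<bar>V \<omega>\<bar>)"
      unfolding abs_mult using c_bound[of "k - p"] assms K_ge_1 \<psi>_nonneg[of "k - p"]
      by (intro mult_mono integral_abs_bound) auto
    moreover have "expectation (\<lambda>\<omega>. V \<omega> * Y \<omega>)
       = expectation (\<lambda>\<omega>. (V \<omega> * X (Suc p) \<omega>) * X (Suc k) \<omega>) - c (k - p) * expectation V"
    proof -
      have "(\<lambda>\<omega>. V \<omega> * Y \<omega>) = (\<lambda>\<omega>. (V \<omega> * X (Suc p) \<omega>) * X (Suc k) \<omega> - c (k - p) * V \<omega>)"
        by (auto simp: Y_def algebra_simps)
      then show ?thesis using V by simp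
    qed
    ultimately have 2: "\<bar>expectation (\<lambda>\<omega>. V \<omega> * Y \<omega>)\<bar> \<le> 2 * K * \<psi> (k - p) * expectation (\<lambda>\<omega>. \<bar>V \<omega>\<bar>)"
      by linarith
    have "\<bar>expectation (\<lambda>\<omega>. V \<omega> * Y \<omega>)\<bar>
        \<le> min (\<psi> (p - q)) (2 * K * \<psi> (k - p)) * expectation (\<lambda>\<omega>. \<bar>V \<omega>\<bar>)"
      using 1 2 by (simp add: min_def)
    also have "\<dots> \<le> min (\<psi> (p - q)) (2 * K * \<psi> (k - p)) * (3 * K * \<theta> ^ 3 * B)"
      using EV \<psi>_nonneg K_ge_1 by (intro mult_left_mono) auto
    finally show ?thesis unfolding V_def .
  qed
  moreover have "expectation (\<lambda>\<omega>. u2 (S p \<omega>) * Y \<omega>) =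
      (\<Sum>q<p. expectation (\<lambda>\<omega>. (u2 (S (Suc q) \<omega>) - u2 (S q \<omega>)) * Y \<omega>))"
    by (intro telescope z) (auto simp: Y_def intro!: integrable_mult_XX)
  ultimately have "\<bar>expectation (\<lambda>\<omega>. u2 (S p \<omega>) * Y \<omega>)\<bar>
    \<le> (\<Sum>q<p. min (\<psi> (p - q)) (2 * K * \<psi> (k - p))) * (3 * K * \<theta> ^ 3 * B)"
    unfolding sum_distrib_right by (simp del: sum_mult_indicator) (intro order_trans[OF sum_abs] sum_mono, auto)
  then show ?thesis unfolding Y_def .
qed

text \<open>Moves the second derivative from the time \<open>p\<close> of the expansion to the time
  \<open>k\<close> common to all lags.\<close>

lemma u2_drift:
  assumes "p \<le> n" "n \<le> k"
  shows "\<bar>expectation (\<lambda>\<omega>. u2 (S n \<omega>)) - expectation (\<lambda>\<omega>. u2 (S p \<omega>))\<bar> \<le> real (n - p) * (3 * K * \<theta> ^ 3 * B)"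
  using assms
proof (induction n rule: dec_induct)
  case (step n)
  have "\<bar>expectation (\<lambda>\<omega>. u2 (S (Suc n) \<omega>) - u2 (S n \<omega>))\<bar> \<le> 3 * K * \<theta> ^ 3 * B"
    using step \<theta> K_ge_1 by (intro expectation_le(1)[where p = n] increment2) auto
  then have "\<bar>expectation (\<lambda>\<omega>. u2 (S (Suc n) \<omega>)) - expectation (\<lambda>\<omega>. u2 (S n \<omega>))\<bar> \<le> 3 * K * \<theta> ^ 3 * B"
    by simp
  moreover have "real (Suc n - p) * (3 * K * \<theta> ^ 3 * B) = real (n - p) * (3 * K * \<theta> ^ 3 * B) + 3 * K * \<theta> ^ 3 * B"
    using step by (simp add: Suc_diff_le distrib_right)
  moreover have "\<bar>expectation (\<lambda>\<omega>. u2 (S n \<omega>)) - expectation (\<lambda>\<omega>. u2 (S p \<omega>))\<bar> \<le> real (n - p) * (3 * K * \<theta> ^ 3 * B)"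
    using step by simp
  ultimately show ?case by linarith
qed simp

text \<open>For lags beyond the cut-off the increment is decorrelated without being expanded. One
  power of \<theta> is lost compared with near lags, but the weights then sum only to a tail of
  \<psi>.\<close>

lemma linear_term_far:
  assumes "p < k"
  shows "\<bar>expectation (\<lambda>\<omega>. (u1 (S (Suc p) \<omega>) - u1 (S p \<omega>)) * X (Suc k) \<omega>)\<bar>
     \<le> \<psi> (k - p) * (3 * K * \<theta>\<^sup>2 * B)"
proof -
  have "\<bar>expectation (\<lambda>\<omega>. (u1 (S (Suc p) \<omega>) - u1 (S p \<omega>)) * X (Suc p + (k - p)) \<omega>)\<bar>
      \<le> \<psi> (k - p) * expectation (\<lambda>\<omega>. \<bar>u1 (S (Suc p) \<omega>) - u1 (S p \<omega>)\<bar>)"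
    using assms by (intro mixing1 diff_adapted) auto
  also have "\<dots> \<le> \<psi> (k - p) * (3 * K * \<theta>\<^sup>2 * B)"
    using assms \<theta> K_ge_1
    by (intro mult_left_mono expectation_le(2)[where p = p] \<psi>_nonneg increment1) auto
  finally show ?thesis using assms by simp
qed

text \<open>The increment of \<open>u1\<close> is expanded once more. The three weights on the right
  come from its Taylor remainder, from the centred product \<open>X (Suc p) * X (Suc k)\<close>, and
  from moving \<open>u2\<close> from time \<open>p\<close> to time \<open>k\<close>.\<close>

lemma linear_term_near:
  assumes "p < k"
  shows "\<bar>expectation (\<lambda>\<omega>. (u1 (S (Suc p) \<omega>) - u1 (S p \<omega>)) * X (Suc k) \<omega>)
      - c (k - p) * expectation (\<lambda>\<omega>. u2 (S k \<omega>))\<bar>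
    \<le> (K * \<psi> (k - p) + (\<Sum>q<p. min (\<psi> (p - q)) (2 * K * \<psi> (k - p))) + K * (real (k - p) * \<psi> (k - p)))
        * (3 * K * \<theta> ^ 3 * B)"
proof -
  define V where "V \<omega> = u1 (S (Suc p) \<omega>) - u1 (S p \<omega>) - X (Suc p) \<omega> * u2 (S p \<omega>)" for \<omega>
  have "V \<in> borel_measurable (F (Suc p))"
    unfolding V_def
    by (intro borel_measurable_diff[OF diff_adapted] borel_measurable_times adapted
        measurable_compose[OF measurable_from_subalg[OF filtration S_adapted]] u_measurable) simp
  moreover have iV: "integrable M V"
    unfolding V_def using integrable_mult_X[OF integrable_u(3), of p "Suc p"]
    by (auto simp: mult.commute)
  ultimately have "\<bar>expectation (\<lambda>\<omega>. V \<omega> * X (Suc p + (k - p)) \<omega>)\<bar>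
      \<le> \<psi> (k - p) * expectation (\<lambda>\<omega>. \<bar>V \<omega>\<bar>)"
    using assms by (intro mixing1) auto
  also have "\<dots> \<le> \<psi> (k - p) * (3 * K\<^sup>2 * \<theta> ^ 3 * B)"
    unfolding V_def using assms \<theta> K_ge_1
    by (intro mult_left_mono expectation_le(2)[where p = p] \<psi>_nonneg taylor1) auto
  finally have 1: "\<bar>expectation (\<lambda>\<omega>. V \<omega> * X (Suc k) \<omega>)\<bar> \<le> K * \<psi> (k - p) * (3 * K * \<theta> ^ 3 * B)"
    using assms by (simp add: power2_eq_square mult_ac)
  note 2 = quadratic_offdiagonal[OF assms]
  have "\<bar>c (k - p) * (expectation (\<lambda>\<omega>. u2 (S k \<omega>)) - expectation (\<lambda>\<omega>. u2 (S p \<omega>)))\<bar>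
      \<le> K * \<psi> (k - p) * (real (k - p) * (3 * K * \<theta> ^ 3 * B))"
    unfolding abs_mult using assms c_bound[of "k - p"] K_ge_1 \<psi>_nonneg
    by (intro mult_mono u2_drift) auto
  then have 3: "\<bar>c (k - p) * expectation (\<lambda>\<omega>. u2 (S k \<omega>)) - c (k - p) * expectation (\<lambda>\<omega>. u2 (S p \<omega>))\<bar>
      \<le> K * (real (k - p) * \<psi> (k - p)) * (3 * K * \<theta> ^ 3 * B)"
    by (simp add: right_diff_distrib mult_ac)
  have i: "integrable M (\<lambda>\<omega>. V \<omega> * X (Suc k) \<omega>)"
    "integrable M (\<lambda>\<omega>. u2 (S p \<omega>) * (X (Suc p) \<omega> * X (Suc k) \<omega> - c (k - p)))"
    "integrable M (\<lambda>\<omega>. c (k - p) * u2 (S p \<omega>))"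
    using iV by (auto intro!: integrable_mult_XX)
  have eq: "(\<lambda>\<omega>. (u1 (S (Suc p) \<omega>) - u1 (S p \<omega>)) * X (Suc k) \<omega>) =
    (\<lambda>\<omega>. V \<omega> * X (Suc k) \<omega> + u2 (S p \<omega>) * (X (Suc p) \<omega> * X (Suc k) \<omega> - c (k - p))
        + c (k - p) * u2 (S p \<omega>))"
    by (auto simp: V_def algebra_simps)
  have "expectation (\<lambda>\<omega>. (u1 (S (Suc p) \<omega>) - u1 (S p \<omega>)) * X (Suc k) \<omega>) =
    expectation (\<lambda>\<omega>. V \<omega> * X (Suc k) \<omega>)
    + expectation (\<lambda>\<omega>. u2 (S p \<omega>) * (X (Suc p) \<omega> * X (Suc k) \<omega> - c (k - p)))
    + c (k - p) * expectation (\<lambda>\<omega>. u2 (S p \<omega>))"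
    unfolding eq by (subst Bochner_Integration.integral_add, (intro Bochner_Integration.integrable_add i)+)
       (subst Bochner_Integration.integral_add, (intro i)+, simp)
  then show ?thesis using 1 2 3 unfolding distrib_right by linarith
qed

end

section \<open>Summation over the lags and the cost of one replacement\<close>

lemma sum_reverse_gap: "(\<Sum>p<k. f (k - p)) = (\<Sum>j=1..k. f j :: real)" for k :: nat
  by (rule sum.reindex_bij_witness[where i = "\<lambda>j. k - j" and j = "\<lambda>p. k - p"]) auto

lemma sum_reverse: "(\<Sum>p<k. f p) = (\<Sum>j=1..k. f (k - j) :: real)" for k :: nat
  by (rule sum.reindex_bij_witness[where i = "\<lambda>j. k - j" and j = "\<lambda>p. k - p"]) auto

text \<open>The consequences of a decay of \<psi> like \<open>j powr (- \<beta>)\<close>, with one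
  common constant: total mass, tail beyond a cut-off, and lag times weight. The last clause sums the
  resulting near-lag errors and concerns \<beta> alone.\<close>

definition polynomial_decay :: "(nat \<Rightarrow> real) \<Rightarrow> real \<Rightarrow> real \<Rightarrow> bool" where
  "polynomial_decay \<psi> \<beta> P \<longleftrightarrow> 1 \<le> P \<and> (\<forall>k. (\<Sum>j=1..k. \<psi> j) \<le> P) \<and>
     (\<forall>m k. 1 \<le> m \<longrightarrow> (\<Sum>j=m+1..k. \<psi> j) \<le> P * real m powr (1 - \<beta>)) \<and>
     (\<forall>j\<ge>1. real j * \<psi> j \<le> P * real j powr (1 - \<beta>)) \<and>
     (\<forall>m\<ge>1. (\<Sum>j=1..m. real j powr (1 - \<beta>)) \<le> P * real m powr (2 - \<beta>))"

text \<open>The variance that one step at time \<open>n\<close> contributes when lags are cut at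
  \<open>m\<close>. The minimum occurs because the sum up to time \<open>n\<close> offers no lag
  larger than \<open>n\<close>.\<close>

definition (in mixing_sequence) partial_variance :: "nat \<Rightarrow> nat \<Rightarrow> real" where
  "partial_variance m n = c 0 + 2 * (\<Sum>j=1..min m n. c j)"

context smooth_test
begin

text \<open>The sum of minima is split at gap \<open>j\<close>: up to \<open>j\<close> there are
  \<open>j\<close> terms, each at most \<open>2 * K * \<psi> j\<close>, and beyond \<open>j\<close>
  the tail of \<psi> is small. This gives 3 units; the two outer terms give one each.\<close>

lemma near_weight:
  assumes D: "polynomial_decay \<psi> \<beta> P" and j: "1 \<le> j"
  shows "K * \<psi> j + (\<Sum>q<r. min (\<psi> (r - q)) (2 * K * \<psi> j)) + K * (real j * \<psi> j)
    \<le> 5 * K * P * real j powr (1 - \<beta>)"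
proof -
  let ?a = "P * real j powr (1 - \<beta>)"
  have jp: "real j * \<psi> j \<le> ?a" and P: "1 \<le> P"
    and tail: "(\<Sum>l=j+1..r. \<psi> l) \<le> ?a"
    using D j unfolding polynomial_decay_def by blast+
  have a0: "0 \<le> ?a" using P by simp
  have "1 * \<psi> j \<le> real j * \<psi> j" using j \<psi>_nonneg by (intro mult_right_mono) auto
  then have "K * \<psi> j \<le> K * ?a" using jp K_ge_1 by (intro mult_left_mono) auto
  moreover have "K * (real j * \<psi> j) \<le> K * ?a" using jp K_ge_1 by (intro mult_left_mono) auto
  moreover have "(\<Sum>q<r. min (\<psi> (r - q)) (2 * K * \<psi> j)) \<le> 3 * (K * ?a)"
  proof -
    have "(\<Sum>q<r. min (\<psi> (r - q)) (2 * K * \<psi> j)) = (\<Sum>l=1..r. min (\<psi> l) (2 * K * \<psi> j))"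
      by (rule sum_reverse_gap[where f = "\<lambda>l. min (\<psi> l) (2 * K * \<psi> j)"])
    also have "\<dots> \<le> (\<Sum>l\<in>{1..j} \<union> {j+1..r}. min (\<psi> l) (2 * K * \<psi> j))"
      using \<psi>_nonneg K_ge_1 by (intro sum_mono2) auto
    also have "\<dots> = (\<Sum>l=1..j. min (\<psi> l) (2 * K * \<psi> j)) + (\<Sum>l=j+1..r. min (\<psi> l) (2 * K * \<psi> j))"
      by (rule sum.union_disjoint) auto
    also have "\<dots> \<le> (\<Sum>l=1..j. 2 * K * \<psi> j) + (\<Sum>l=j+1..r. \<psi> l)"
      by (intro add_mono sum_mono) auto
    also have "(\<Sum>l=1..j. 2 * K * \<psi> j) = 2 * (K * (real j * \<psi> j))" by simp
    also have "\<dots> \<le> 2 * (K * ?a)" using jp K_ge_1 by (intro mult_left_mono) auto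
    also have "(\<Sum>l=j+1..r. \<psi> l) \<le> K * ?a"
      using tail mult_right_mono[OF K_ge_1 a0] by linarith
    finally show ?thesis by simp
  qed
  ultimately show ?thesis by (simp add: mult_ac)
qed

text \<open>In the expansion of \<open>u\<close> at \<open>S k\<close> the quadratic term supplies
  \<open>c 0 / 2\<close>, and the linear term, telescoped, supplies the covariances of the near
  lags; together they form half of \<open>partial_variance m k\<close>. Near-lag errors have weights
  \<open>j powr (1 - \<beta>)\<close> and sum to the order
  \<open>m powr (2 - \<beta>)\<close>.\<close>

lemma one_step:
  assumes D: "polynomial_decay \<psi> \<beta> P" and m: "1 \<le> m" and \<beta>: "\<beta> < 2"
  shows "\<bar>expectation (\<lambda>\<omega>. u (S (Suc k) \<omega>)) - expectation (\<lambda>\<omega>. u (S k \<omega>))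
        - partial_variance m k / 2 * expectation (\<lambda>\<omega>. u2 (S k \<omega>))\<bar>
    \<le> 20 * K ^ 3 * P\<^sup>2 * (\<theta> ^ 3 * real m powr (2 - \<beta>) + \<theta>\<^sup>2 * real m powr (1 - \<beta>)) * B"
proof -
  have P: "1 \<le> P" and sum_\<psi>: "(\<Sum>j=1..k. \<psi> j) \<le> P"
    and tail: "(\<Sum>j=m+1..k. \<psi> j) \<le> P * real m powr (1 - \<beta>)"
    and sum_powr: "(\<Sum>j=1..m. real j powr (1 - \<beta>)) \<le> P * real m powr (2 - \<beta>)"
    using D m unfolding polynomial_decay_def by blast+
  let ?U2 = "expectation (\<lambda>\<omega>. u2 (S k \<omega>))"
  let ?b = "3 * K * \<theta> ^ 3 * B"
  let ?mm = "real m powr (2 - \<beta>)"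
  have b0: "0 \<le> ?b" using \<theta> K_ge_1 B_nonneg by simp
  have mm: "1 \<le> ?mm" using m \<beta> by (intro ge_one_powr_ge_zero) auto
  define T where "T p = expectation (\<lambda>\<omega>. (u1 (S (Suc p) \<omega>) - u1 (S p \<omega>)) * X (Suc k) \<omega>)" for p
  have "expectation (\<lambda>\<omega>. u1 (S k \<omega>) * X (Suc k) \<omega>) = (\<Sum>p<k. T p)"
    unfolding T_def by (rule telescope) (auto simp: centered)
  then have lin: "expectation (\<lambda>\<omega>. u1 (S k \<omega>) * X (Suc k) \<omega>) = (\<Sum>j=1..k. T (k - j))"
    by (simp only: sum_reverse)
  have split: "(\<Sum>j=1..k. f j) = (\<Sum>j=1..min m k. f j) + (\<Sum>j=m+1..k. f j)" for f :: "nat \<Rightarrow> real"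
    by (subst sum.union_disjoint[symmetric]) (auto intro!: sum.cong)
  have near: "\<bar>(\<Sum>j=1..min m k. T (k - j)) - (\<Sum>j=1..min m k. c j) * ?U2\<bar> \<le> 5 * K * P * (P * ?mm) * ?b"
  proof -
    have "\<bar>(\<Sum>j=1..min m k. T (k - j) - c j * ?U2)\<bar> \<le> (\<Sum>j=1..min m k. 5 * K * P * real j powr (1 - \<beta>) * ?b)"
    proof (intro order_trans[OF sum_abs] sum_mono)
      fix j assume j: "j \<in> {1..min m k}"
      then have kj: "k - (k - j) = j" by auto
      have "\<bar>T (k - j) - c j * ?U2\<bar> \<le>
        (K * \<psi> j + (\<Sum>q<k - j. min (\<psi> (k - j - q)) (2 * K * \<psi> j)) + K * (real j * \<psi> j)) * ?b"
        using linear_term_near[of "k - j"] j unfolding kj T_def by simp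
      also have "\<dots> \<le> 5 * K * P * real j powr (1 - \<beta>) * ?b"
        using j by (intro mult_right_mono near_weight[OF D] b0) auto
      finally show "\<bar>T (k - j) - c j * ?U2\<bar> \<le> 5 * K * P * real j powr (1 - \<beta>) * ?b" .
    qed
    also have "\<dots> = 5 * K * P * (\<Sum>j=1..min m k. real j powr (1 - \<beta>)) * ?b"
      by (simp add: sum_distrib_left sum_distrib_right)
    also have "\<dots> \<le> 5 * K * P * (P * ?mm) * ?b"
    proof (intro mult_right_mono mult_left_mono b0)
      have "(\<Sum>j=1..min m k. real j powr (1 - \<beta>)) \<le> (\<Sum>j=1..m. real j powr (1 - \<beta>))"
        by (intro sum_mono2) auto
      then show "(\<Sum>j=1..min m k. real j powr (1 - \<beta>)) \<le> P * ?mm" using sum_powr by linarith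
    qed (use K_ge_1 P in auto)
    finally show ?thesis by (simp add: sum_subtractf sum_distrib_right)
  qed
  have far: "\<bar>\<Sum>j=m+1..k. T (k - j)\<bar> \<le> P * real m powr (1 - \<beta>) * (3 * K * \<theta>\<^sup>2 * B)"
  proof -
    have "\<bar>\<Sum>j=m+1..k. T (k - j)\<bar> \<le> (\<Sum>j=m+1..k. \<psi> j * (3 * K * \<theta>\<^sup>2 * B))"
    proof (intro order_trans[OF sum_abs] sum_mono)
      fix j assume "j \<in> {m+1..k}"
      then show "\<bar>T (k - j)\<bar> \<le> \<psi> j * (3 * K * \<theta>\<^sup>2 * B)"
        using linear_term_far[of "k - j"] unfolding T_def by simp
    qed
    also have "\<dots> \<le> P * real m powr (1 - \<beta>) * (3 * K * \<theta>\<^sup>2 * B)"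
      unfolding sum_distrib_right[symmetric] using tail \<theta> K_ge_1 B_nonneg
      by (intro mult_right_mono) auto
    finally show ?thesis .
  qed
  have diag: "\<bar>expectation (\<lambda>\<omega>. u2 (S k \<omega>) * ((X (Suc k) \<omega>)\<^sup>2 - c 0))\<bar> \<le> P * ?b"
    using quadratic_diagonal sum_\<psi> mult_right_mono[OF sum_\<psi> b0] unfolding sum_reverse_gap by linarith
  define V where "V \<omega> = u (S (Suc k) \<omega>) - u (S k \<omega>) - X (Suc k) \<omega> * u1 (S k \<omega>)
                    - (X (Suc k) \<omega>)\<^sup>2 / 2 * u2 (S k \<omega>)" for \<omega>
  have rem: "\<bar>expectation V\<bar> \<le> 3 * K ^ 3 * \<theta> ^ 3 * B"
    unfolding V_def using \<theta> K_ge_1 by (intro expectation_le(1)[where p = k] taylor) auto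
  have i1: "integrable M (\<lambda>\<omega>. u1 (S k \<omega>) * X (Suc k) \<omega>)" by simp
  have i2: "integrable M (\<lambda>\<omega>. u2 (S k \<omega>) * ((X (Suc k) \<omega>)\<^sup>2 - c 0))"
    unfolding power2_eq_square by (rule integrable_mult_XX) simp
  have V_eq: "V = (\<lambda>\<omega>. u (S (Suc k) \<omega>) - u (S k \<omega>) - u1 (S k \<omega>) * X (Suc k) \<omega>
                    - (u2 (S k \<omega>) * ((X (Suc k) \<omega>)\<^sup>2 - c 0)) / 2 - c 0 / 2 * u2 (S k \<omega>))"
    by (auto simp: V_def field_simps)
  have "expectation V = expectation (\<lambda>\<omega>. u (S (Suc k) \<omega>)) - expectation (\<lambda>\<omega>. u (S k \<omega>))
     - expectation (\<lambda>\<omega>. u1 (S k \<omega>) * X (Suc k) \<omega>)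
     - expectation (\<lambda>\<omega>. u2 (S k \<omega>) * ((X (Suc k) \<omega>)\<^sup>2 - c 0)) / 2 - c 0 / 2 * ?U2"
    unfolding V_eq using i1 i2 by simp
  moreover have "partial_variance m k / 2 * ?U2 = c 0 / 2 * ?U2 + (\<Sum>j=1..min m k. c j) * ?U2"
    by (simp add: partial_variance_def algebra_simps add_divide_distrib)
  ultimately have "\<bar>expectation (\<lambda>\<omega>. u (S (Suc k) \<omega>)) - expectation (\<lambda>\<omega>. u (S k \<omega>))
        - partial_variance m k / 2 * ?U2\<bar>
    \<le> 3 * K ^ 3 * \<theta> ^ 3 * B + 5 * K * P * (P * ?mm) * ?b
      + P * real m powr (1 - \<beta>) * (3 * K * \<theta>\<^sup>2 * B) + P * ?b / 2"
    using rem near far diag unfolding lin split by linarith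
  also have "\<dots> = (3 * K ^ 3 + 3 / 2 * K * P + 15 * (K\<^sup>2 * P\<^sup>2 * ?mm)) * (\<theta> ^ 3 * B)
     + 3 * (K * P) * (\<theta>\<^sup>2 * real m powr (1 - \<beta>) * B)"
    by (simp add: field_simps power2_eq_square power3_eq_cube)
  \<comment> \<open>After all powers of \<open>K\<close> and \<open>P\<close> are raised to
    \<open>K ^ 3 * P\<^sup>2\<close>, the coefficients 3, 3/2 and 15 add up to less than 20.\<close>
  also have "\<dots> \<le> 20 * K ^ 3 * P\<^sup>2 * ?mm * (\<theta> ^ 3 * B) + 20 * K ^ 3 * P\<^sup>2 * (\<theta>\<^sup>2 * real m powr (1 - \<beta>) * B)"
  proof (intro add_mono mult_right_mono)
    have K: "1 \<le> K ^ 3" "K \<le> K ^ 3" "K\<^sup>2 \<le> K ^ 3"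
      using K_ge_1 power_increasing[of 1 3 K] power_increasing[of 2 3 K] by (auto intro: one_le_power)
    have PP: "1 \<le> P\<^sup>2" "P \<le> P\<^sup>2" using P power_increasing[of 1 2 P] by (auto intro: one_le_power)
    have KP: "K ^ 3 * 1 \<le> K ^ 3 * P\<^sup>2" "K * P \<le> K ^ 3 * P\<^sup>2" "K\<^sup>2 * P\<^sup>2 \<le> K ^ 3 * P\<^sup>2"
      using K PP K_ge_1 P by (auto intro!: mult_mono mult_right_mono)
    have Q0: "0 \<le> K ^ 3 * P\<^sup>2" using K_ge_1 by simp
    have "K ^ 3 * P\<^sup>2 * 1 \<le> K ^ 3 * P\<^sup>2 * ?mm" by (rule mult_left_mono[OF mm Q0])
    moreover have "K\<^sup>2 * P\<^sup>2 * ?mm \<le> K ^ 3 * P\<^sup>2 * ?mm" using KP(3) by (rule mult_right_mono) simp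
    ultimately show "3 * K ^ 3 + 3 / 2 * K * P + 15 * (K\<^sup>2 * P\<^sup>2 * ?mm) \<le> 20 * K ^ 3 * P\<^sup>2 * ?mm"
      using KP mult_nonneg_nonneg[OF Q0, of ?mm] by (simp add: mult.assoc)
    show "3 * (K * P) \<le> 20 * K ^ 3 * P\<^sup>2" using KP Q0 by (simp add: mult.assoc)
  qed (use \<theta> B_nonneg in auto)
  also have "\<dots> = 20 * K ^ 3 * P\<^sup>2 * (\<theta> ^ 3 * ?mm + \<theta>\<^sup>2 * real m powr (1 - \<beta>)) * B"
    by (simp add: algebra_simps)
  finally show ?thesis .
qed

end

section \<open>Variance of the partial sums and the complete replacement\<close>

context mixing_sequence
begin

lemma integrable_S_power2: "integrable M (\<lambda>\<omega>. (S k \<omega>)\<^sup>2)"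
proof (rule integrable_bounded)
  fix \<omega> assume \<omega>: "\<omega> \<in> space M"
  have "\<bar>S k \<omega>\<bar> \<le> real k * K"
    unfolding S_def using sum_bounded_above[of "{1..k}" "\<lambda>i. \<bar>X i \<omega>\<bar>" K] X_bound[OF \<omega>]
    by (intro order_trans[OF sum_abs]) auto
  then show "\<bar>(S k \<omega>)\<^sup>2\<bar> \<le> (real k * K)\<^sup>2"
    using power_mono[of "\<bar>S k \<omega>\<bar>" "real k * K" 2] by simp
qed simp

lemma variance_S: "expectation (\<lambda>\<omega>. (S n \<omega>)\<^sup>2) = (\<Sum>k<n. c 0 + 2 * (\<Sum>j=1..k. c j))"
proof (induction n)
  case (Suc k)
  have cross: "expectation (\<lambda>\<omega>. S k \<omega> * X (Suc k) \<omega>) = (\<Sum>j=1..k. c j)"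
  proof -
    have "expectation (\<lambda>\<omega>. S k \<omega> * X (Suc k) \<omega>) = (\<Sum>i=1..k. expectation (\<lambda>\<omega>. X i \<omega> * X (Suc k) \<omega>))"
      unfolding S_def sum_distrib_right by (rule Bochner_Integration.integral_sum) simp
    also have "\<dots> = (\<Sum>i=1..k. c (Suc k - i))"
    proof (rule sum.cong)
      fix i assume "i \<in> {1..k}"
      then show "expectation (\<lambda>\<omega>. X i \<omega> * X (Suc k) \<omega>) = c (Suc k - i)"
        using covariance[of i "Suc k - i"] by simp
    qed simp
    also have "\<dots> = (\<Sum>j=1..k. c j)"
      by (rule sum.reindex_bij_witness[where i = "\<lambda>j. Suc k - j" and j = "\<lambda>j. Suc k - j"]) auto
    finally show ?thesis .
  qed
  have i: "integrable M (\<lambda>\<omega>. S k \<omega> * X (Suc k) \<omega>)"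
    unfolding S_def sum_distrib_right by (intro Bochner_Integration.integrable_sum) simp
  have "(\<lambda>\<omega>. (S (Suc k) \<omega>)\<^sup>2) = (\<lambda>\<omega>. (S k \<omega>)\<^sup>2 + 2 * (S k \<omega> * X (Suc k) \<omega>) + X (Suc k) \<omega> * X (Suc k) \<omega>)"
    by (auto simp: S_Suc power2_eq_square algebra_simps)
  then have "expectation (\<lambda>\<omega>. (S (Suc k) \<omega>)\<^sup>2)
      = expectation (\<lambda>\<omega>. (S k \<omega>)\<^sup>2) + 2 * expectation (\<lambda>\<omega>. S k \<omega> * X (Suc k) \<omega>)
        + expectation (\<lambda>\<omega>. X (Suc k) \<omega> * X (Suc k) \<omega>)"
    using i integrable_S_power2 by simp
  then show ?case
    using Suc cross covariance[of "Suc k" 0] by simp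
qed simp

text \<open>The square of sigma_n, and the variance given to each Gaussian replacement, so that the
  Gaussian sum has exactly the variance of \<open>S n\<close>.\<close>

definition mean_variance :: "nat \<Rightarrow> real" where
  "mean_variance n = expectation (\<lambda>\<omega>. (S n \<omega>)\<^sup>2) / real n"

lemma mean_variance_nonneg: "0 \<le> mean_variance n"
  by (simp add: mean_variance_def)

context
  fixes \<beta> P :: real
  assumes D: "polynomial_decay \<psi> \<beta> P" and \<beta>: "1 < \<beta>" "\<beta> < 2"
begin

lemma P_ge_1: "1 \<le> P"
  using D by (simp add: polynomial_decay_def)

lemma sum_c_tail:
  assumes "1 \<le> m" shows "\<bar>\<Sum>j=m+1..n. c j\<bar> \<le> K * P * real m powr (1 - \<beta>)"
proof -
  have "\<bar>\<Sum>j=m+1..n. c j\<bar> \<le> (\<Sum>j=m+1..n. K * \<psi> j)"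
    by (intro order_trans[OF sum_abs] sum_mono c_bound) auto
  also have "\<dots> \<le> K * (P * real m powr (1 - \<beta>))"
    unfolding sum_distrib_left[symmetric]
    using D assms K_ge_1 by (intro mult_left_mono) (auto simp: polynomial_decay_def)
  finally show ?thesis by simp
qed

lemma sum_c_bound: "\<bar>\<Sum>j=1..n. c j\<bar> \<le> K * P"
proof -
  have "\<bar>\<Sum>j=1..n. c j\<bar> \<le> (\<Sum>j=1..n. K * \<psi> j)"
    by (intro order_trans[OF sum_abs] sum_mono c_bound) auto
  also have "\<dots> \<le> K * P"
    unfolding sum_distrib_left[symmetric]
    using D K_ge_1 by (intro mult_left_mono) (auto simp: polynomial_decay_def)
  finally show ?thesis .
qed

text \<open>The difference is twice the sum of the covariances at lags beyond
  \<open>min m k\<close>. At \<open>k = 0\<close> all lags are missing, whereas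
  \<open>0 powr (1 - \<beta>)\<close> is 0; hence the separate value 1.\<close>

lemma partial_variance_error:
  assumes "k < n" "m \<le> n" "1 \<le> m"
  shows "\<bar>partial_variance m k - partial_variance n n\<bar> \<le>
    2 * K * P * (real m powr (1 - \<beta>) + (if k = 0 then 1 else real k powr (1 - \<beta>)))"
proof -
  let ?q = "min m k"
  have "{1..n} = {1..?q} \<union> {?q+1..n}" using assms by auto
  then have "(\<Sum>j=1..n. c j) = (\<Sum>j\<in>{1..?q} \<union> {?q+1..n}. c j)" by simp
  also have "\<dots> = (\<Sum>j=1..?q. c j) + (\<Sum>j=?q+1..n. c j)"
    by (rule sum.union_disjoint) auto
  finally have *: "\<bar>partial_variance m k - partial_variance n n\<bar> = 2 * \<bar>\<Sum>j=?q+1..n. c j\<bar>"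
    by (simp add: partial_variance_def abs_mult)
  show ?thesis
  proof (cases "k = 0")
    case True
    have "0 \<le> K * P * real m powr (1 - \<beta>)" using K_ge_1 P_ge_1 by simp
    moreover have "2 * K * P * (real m powr (1 - \<beta>) + 1) = 2 * (K * P * real m powr (1 - \<beta>)) + 2 * (K * P)"
      by (simp add: algebra_simps)
    moreover have "\<bar>partial_variance m k - partial_variance n n\<bar> \<le> 2 * (K * P)"
      using * sum_c_bound[of n] True by simp
    ultimately show ?thesis unfolding if_P[OF True] by linarith
  next
    case False
    then have "1 \<le> ?q" using assms by simp
    have "real ?q powr (1 - \<beta>) \<le> real m powr (1 - \<beta>) + real k powr (1 - \<beta>)"
      by (cases "m \<le> k") (auto simp: min_def)
    then have "K * P * real ?q powr (1 - \<beta>) \<le> K * P * (real m powr (1 - \<beta>) + real k powr (1 - \<beta>))"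
      using K_ge_1 P_ge_1 by (intro mult_left_mono) auto
    then show ?thesis
      using * sum_c_tail[OF \<open>1 \<le> ?q\<close>, of n] False by simp
  qed
qed

lemma sum_partial_variance_error:
  assumes "m \<le> n" "1 \<le> m"
  shows "(\<Sum>k<n. \<bar>partial_variance m k - partial_variance n n\<bar>) \<le> 6 * K * P\<^sup>2 * (real n * real m powr (1 - \<beta>))"
proof -
  let ?Q = "real n * real m powr (1 - \<beta>)"
  have n: "1 \<le> n" using assms by simp
  have KP: "0 \<le> 2 * K * P" using K_ge_1 P_ge_1 by simp
  \<comment> \<open>Times \<open>k\<close> below the cut-off contribute at the order
    \<open>n powr (2 - \<beta>)\<close>, which is no more than the cut-off error because
    \<open>m \<le> n\<close>.\<close>
  have "real n powr (2 - \<beta>) = real n powr 1 * real n powr (1 - \<beta>)"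
    by (subst powr_add[symmetric]) simp
  also have "\<dots> \<le> real n * real m powr (1 - \<beta>)"
    using assms n \<beta> by (auto intro!: mult_left_mono powr_mono2')
  finally have Q: "real n powr (2 - \<beta>) \<le> ?Q" .
  moreover have "1 \<le> real n powr (2 - \<beta>)" using n \<beta> by (intro ge_one_powr_ge_zero) auto
  ultimately have Q1: "1 \<le> ?Q" by linarith
  have "(\<Sum>k<n. (if k = 0 then 1 else real k powr (1 - \<beta>))) \<le> 1 + (\<Sum>k=1..n. real k powr (1 - \<beta>))"
  proof -
    have "(\<Sum>k<n. (if k = 0 then 1 else real k powr (1 - \<beta>))) \<le> (\<Sum>k\<in>insert 0 {1..n}. (if k = 0 then 1 else real k powr (1 - \<beta>)))"
      by (intro sum_mono2) auto
    also have "\<dots> = 1 + (\<Sum>k=1..n. (if k = 0 then 1 else real k powr (1 - \<beta>)))" by simp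
    also have "(\<Sum>k=1..n. (if k = 0 then 1 else real k powr (1 - \<beta>))) = (\<Sum>k=1..n. real k powr (1 - \<beta>))"
      by (intro sum.cong) auto
    finally show ?thesis .
  qed
  also have "(\<Sum>k=1..n. real k powr (1 - \<beta>)) \<le> P * real n powr (2 - \<beta>)"
    using D n by (simp add: polynomial_decay_def)
  also have "\<dots> \<le> P * ?Q" using Q P_ge_1 by (intro mult_left_mono) auto
  finally have s: "(\<Sum>k<n. (if k = 0 then 1 else real k powr (1 - \<beta>))) \<le> 1 + P * ?Q" by simp
  have "(\<Sum>k<n. \<bar>partial_variance m k - partial_variance n n\<bar>)
     \<le> (\<Sum>k<n. 2 * K * P * (real m powr (1 - \<beta>) + (if k = 0 then 1 else real k powr (1 - \<beta>))))"
    by (intro sum_mono partial_variance_error assms) auto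
  also have "\<dots> = 2 * K * P * (?Q + (\<Sum>k<n. (if k = 0 then 1 else real k powr (1 - \<beta>))))"
    unfolding sum_distrib_left[symmetric] sum.distrib by simp
  also have "\<dots> \<le> 2 * K * P * (?Q + (1 + P * ?Q))"
    using s by (intro mult_left_mono KP) auto
  also have "\<dots> \<le> 2 * K * P * (3 * (P * ?Q))"
  proof (intro mult_left_mono KP)
    have "1 * ?Q \<le> P * ?Q" using P_ge_1 Q1 by (intro mult_right_mono) auto
    then show "?Q + (1 + P * ?Q) \<le> 3 * (P * ?Q)" using Q1 by linarith
  qed
  finally show ?thesis by (simp add: power2_eq_square mult_ac)
qed

lemma mean_variance_eq:
  "real n * mean_variance n = (\<Sum>k<n. partial_variance n k)"
proof -
  have "(\<Sum>k<n. c 0 + 2 * (\<Sum>j=1..k. c j)) = (\<Sum>k<n. partial_variance n k)"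
    by (intro sum.cong) (auto simp: partial_variance_def min_def)
  then show ?thesis
    by (cases "n = 0") (auto simp: mean_variance_def variance_S)
qed

text \<open>\<open>mean_variance n\<close> is the average of \<open>partial_variance n k\<close>
  over \<open>k < n\<close>, so the previous sum with cut-off \<open>n\<close> applies.\<close>

lemma mean_variance_error:
  assumes "m \<le> n" "1 \<le> m"
  shows "real n * \<bar>mean_variance n - partial_variance n n\<bar> \<le> 6 * K * P\<^sup>2 * (real n * real m powr (1 - \<beta>))"
proof -
  have "real n * \<bar>mean_variance n - partial_variance n n\<bar> = \<bar>real n * mean_variance n - real n * partial_variance n n\<bar>"
    by (simp add: abs_mult flip: right_diff_distrib)
  also have "\<dots> = \<bar>\<Sum>k<n. partial_variance n k - partial_variance n n\<bar>"
    unfolding mean_variance_eq by (simp add: sum_subtractf)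
  also have "\<dots> \<le> (\<Sum>k<n. \<bar>partial_variance n k - partial_variance n n\<bar>)"
    by (rule sum_abs)
  also have "\<dots> \<le> 6 * K * P\<^sup>2 * (real n * real n powr (1 - \<beta>))"
    using assms by (intro sum_partial_variance_error) auto
  also have "\<dots> \<le> 6 * K * P\<^sup>2 * (real n * real m powr (1 - \<beta>))"
    using assms K_ge_1 \<beta> by (intro mult_left_mono powr_mono2') auto
  finally show ?thesis .
qed

lemma mean_variance_bound: "mean_variance n \<le> 3 * K\<^sup>2 * P"
proof (cases "n = 0")
  case False
  have "\<bar>c 0\<bar> \<le> K * K"
    using covariance[of 0 0] abs_integral_le[of M "\<lambda>_. K * K" "\<lambda>\<omega>. X 0 \<omega> * X 0 \<omega>"] X_pair_bound[of _ 0 0]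
    by (simp add: prob_space)
  also have "\<dots> \<le> K\<^sup>2 * P" using P_ge_1 K_ge_1 by (simp add: power2_eq_square)
  finally have c0: "\<bar>c 0\<bar> \<le> K\<^sup>2 * P" .
  have "K * P \<le> K\<^sup>2 * P" using K_ge_1 P_ge_1 by (simp add: power2_eq_square)
  then have "partial_variance n k \<le> 3 * K\<^sup>2 * P" for k
    unfolding partial_variance_def using sum_c_bound[of "min n k"] c0 by linarith
  then have "real n * mean_variance n \<le> real n * (3 * K\<^sup>2 * P)"
    unfolding mean_variance_eq using sum_bounded_above[of "{..<n}" "partial_variance n" "3 * K\<^sup>2 * P"] by simp
  then show ?thesis using False by simp
qed (use P_ge_1 in \<open>simp add: mean_variance_def\<close>)

text \<open>Replacing one variable costs a multiple of \<open>B\<close>, which is twice the largest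
  interpolated expectation. That largest value exceeds the Gaussian one by at most
  \<open>err * B\<close>, so smallness of \<open>err\<close> absorbs it and the error becomes
  relative to the Gaussian value.\<close>

theorem lindeberg:
  fixes n m :: nat and \<theta> :: real and f f1 f2 :: "real \<Rightarrow> real"
  defines "v \<equiv> mean_variance n"
  defines "err \<equiv> (26 + 9 * gauss_const) * K ^ 4 * P\<^sup>2 * (real n * (\<theta> ^ 3 * real m powr (2 - \<beta>) + \<theta>\<^sup>2 * real m powr (1 - \<beta>)))"
  assumes slow: "slow \<theta> f f1 f2" and \<theta>: "0 \<le> \<theta>" "\<theta> * K \<le> 1" "\<theta> * sqrt v \<le> 1"
    and m: "1 \<le> m" "m \<le> n" and err: "err \<le> 1/4"
  shows "\<bar>expectation (\<lambda>\<omega>. f (S n \<omega>)) - heat (real n * v) f 0\<bar> \<le> 4 * err * heat (real n * v) f 0"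
proof -
  have v0: "0 \<le> v" unfolding v_def by (rule mean_variance_nonneg)
  define U where "U j = heat (real j * v) f" for j
  define U1 where "U1 j = heat (real j * v) f1" for j
  define U2 where "U2 j = heat (real j * v) f2" for j
  have sU: "slow \<theta> (U j) (U1 j) (U2 j)" for j
    unfolding U_def U1_def U2_def by (rule slow_heat[OF slow \<theta>(1)])
  have U_add: "heat (real i * v) (U j) = U (j + i)" for i j
    unfolding U_def using v0 by (subst heat_heat[OF slow \<theta>(1)]) (auto simp: algebra_simps)
  have U_le: "U j w \<le> 2 * U (j + i) w" for i j w
    unfolding U_add[symmetric] using v0 by (intro slow_le_heat[OF sU \<theta>(1)]) auto
  have iU: "integrable M (\<lambda>\<omega>. U j (S p \<omega>))" "integrable M (\<lambda>\<omega>. U2 j (S p \<omega>))" for j p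
  proof -
    note [measurable] = slow_measurable[OF sU]
    have "\<bar>U2 j w\<bar> \<le> \<theta>\<^sup>2" for w
      using slow_bound2[OF sU, of j w] mult_left_mono[OF slow_le_1[OF sU, of j w], of "\<theta>\<^sup>2"] by simp
    moreover have "\<bar>U j w\<bar> \<le> 1" for w
      using slow_le_1[OF sU, of j w] slow_nonneg[OF sU, of j w] by simp
    ultimately show "integrable M (\<lambda>\<omega>. U j (S p \<omega>))" "integrable M (\<lambda>\<omega>. U2 j (S p \<omega>))"
      by (simp_all add: integrable_bounded[where C = 1] integrable_bounded[where C = "\<theta>\<^sup>2"])
  qed
  \<comment> \<open>The first \<open>k\<close> variables are the given ones and the other
    \<open>n - k\<close> are Gaussian; the latter are already integrated out inside
    \<open>U\<close>.\<close>
  define A where "A k = expectation (\<lambda>\<omega>. U (n - k) (S k \<omega>))" for k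
  define Mx where "Mx = Max (A ` {..n})"
  define B where "B = 2 * Mx"
  have A_le: "A k \<le> Mx" if "k \<le> n" for k
    unfolding Mx_def using that by (intro Max_ge) auto
  have A0: "0 \<le> A k" for k
    unfolding A_def by (intro integral_nonneg_AE AE_I2 slow_nonneg[OF sU])
  have B0: "0 \<le> B" using A0[of 0] A_le[of 0] by (simp add: B_def)
  let ?mm = "real m powr (2 - \<beta>)" and ?m1 = "real m powr (1 - \<beta>)"
  have mm: "1 \<le> ?mm" using m \<beta> by (intro ge_one_powr_ge_zero) auto
  define pv where "pv k = \<bar>partial_variance m k - v\<bar>" for k
  define w where "w = 20 * K ^ 3 * P\<^sup>2 * (\<theta> ^ 3 * ?mm + \<theta>\<^sup>2 * ?m1) * B + gauss_const * \<theta> ^ 3 * sqrt v ^ 3 * B"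
  have step: "\<bar>A (Suc k) - A k\<bar> \<le> w + pv k * (\<theta>\<^sup>2 * B / 2)" if k: "k < n" for k
  proof -
    let ?j = "n - Suc k"
    \<comment> \<open>For \<open>p \<le> k\<close> the function \<open>U ?j\<close> is smoothed less
      than \<open>U (n - p)\<close>, hence is at most twice as large. This is the factor 2 in
      \<open>B\<close>.\<close>
    have Bk: "expectation (\<lambda>\<omega>. U ?j (S p \<omega>)) \<le> B" if "p \<le> k" for p
    proof -
      have "expectation (\<lambda>\<omega>. U ?j (S p \<omega>)) \<le> expectation (\<lambda>\<omega>. 2 * U (n - p) (S p \<omega>))"
        using U_le[of ?j _ "Suc k - p"] that k iU by (intro integral_mono) auto
      also have "\<dots> = 2 * A p" by (simp add: A_def)
      finally show ?thesis using A_le[of p] that k by (simp add: B_def)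
    qed
    interpret st: smooth_test M F X c \<psi> K \<theta> B "U ?j" "U1 ?j" "U2 ?j" k
      by unfold_locales (use sU \<theta> Bk in auto)
    let ?E2 = "expectation (\<lambda>\<omega>. U2 ?j (S k \<omega>))"
    have 1: "\<bar>A (Suc k) - expectation (\<lambda>\<omega>. U ?j (S k \<omega>)) - partial_variance m k / 2 * ?E2\<bar>
        \<le> 20 * K ^ 3 * P\<^sup>2 * (\<theta> ^ 3 * ?mm + \<theta>\<^sup>2 * ?m1) * B"
      unfolding A_def by (rule st.one_step[OF D m(1) \<beta>(2)])
    have Uk: "U (n - k) = heat v (U ?j)"
      using U_add[of 1 ?j] k by (simp add: Suc_diff_Suc)
    have "\<bar>expectation (\<lambda>\<omega>. heat v (U ?j) (S k \<omega>) - U ?j (S k \<omega>) - v / 2 * U2 ?j (S k \<omega>))\<bar>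
      \<le> gauss_const * \<theta> ^ 3 * sqrt v ^ 3 * B"
      using \<theta> v0 gauss_const_nonneg
      by (intro st.expectation_le(1)[where p = k] slow_heat_taylor[OF sU]) auto
    then have 2: "\<bar>A k - expectation (\<lambda>\<omega>. U ?j (S k \<omega>)) - v / 2 * ?E2\<bar> \<le> gauss_const * \<theta> ^ 3 * sqrt v ^ 3 * B"
      unfolding A_def Uk using iU(1)[of "n - k" k] iU[of ?j k] unfolding Uk by simp
    have "\<bar>?E2\<bar> \<le> \<theta>\<^sup>2 * B"
      by (intro st.expectation_le(1)[where p = k] slow_bound2[OF sU]) auto
    then have "\<bar>(partial_variance m k - v) / 2\<bar> * \<bar>?E2\<bar> \<le> \<bar>(partial_variance m k - v) / 2\<bar> * (\<theta>\<^sup>2 * B)"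
      by (intro mult_left_mono) auto
    then have "\<bar>(partial_variance m k - v) / 2 * ?E2\<bar> \<le> pv k * (\<theta>\<^sup>2 * B / 2)"
      unfolding pv_def abs_mult[symmetric] by (simp add: abs_mult)
    moreover have "(partial_variance m k - v) / 2 * ?E2 = partial_variance m k / 2 * ?E2 - v / 2 * ?E2"
      by (simp add: algebra_simps diff_divide_distrib)
    ultimately show ?thesis using 1 2 unfolding w_def by linarith
  qed
  \<comment> \<open>The variance produced at a single time may differ from \<open>v\<close>. The
    mismatches are measured through \<open>partial_variance n n\<close>, at the price 6 for each of
    the two comparisons.\<close>
  have "(\<Sum>k<n. pv k) \<le> (\<Sum>k<n. \<bar>partial_variance m k - partial_variance n n\<bar> + \<bar>v - partial_variance n n\<bar>)"
    unfolding pv_def by (intro sum_mono) linarith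
  also have "\<dots> \<le> 6 * K * P\<^sup>2 * (real n * ?m1) + 6 * K * P\<^sup>2 * (real n * ?m1)"
    unfolding sum.distrib using sum_partial_variance_error[OF m(2,1)] mean_variance_error[OF m(2,1)]
    unfolding v_def by (simp only: sum_constant card_lessThan)
  finally have pv: "(\<Sum>k<n. pv k) \<le> 12 * K * P\<^sup>2 * (real n * ?m1)" by (simp add: mult_ac)
  \<comment> \<open>With \<open>v\<close> at most \<open>3 * K\<^sup>2 * P\<close>, a number not
    below 1, the power 3/2 of \<open>v\<close> is at most the square of that number.\<close>
  have v3: "sqrt v ^ 3 \<le> 9 * K ^ 4 * P\<^sup>2"
  proof -
    let ?y = "3 * K\<^sup>2 * P"
    have vy: "v \<le> ?y" unfolding v_def by (rule mean_variance_bound)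
    have "1 * 1 \<le> K\<^sup>2 * P" using K_ge_1 P_ge_1 by (intro mult_mono) (auto intro: one_le_power)
    then have y1: "1 \<le> ?y" by linarith
    have "sqrt v \<le> sqrt ?y" using vy by simp
    also have "\<dots> \<le> ?y"
      using y1 power_increasing[of 1 2 ?y] order_trans[OF zero_le_one y1]
      by (intro real_le_lsqrt) (simp_all only: power_one_right)
    finally have "v * sqrt v \<le> ?y * ?y"
      using v0 by (intro mult_mono[OF vy _ order_trans[OF zero_le_one y1]]) simp_all
    moreover have "sqrt v ^ 3 = v * sqrt v" using v0 by (simp add: power3_eq_cube)
    ultimately show ?thesis by (simp add: power2_eq_square power4_eq_xxxx mult_ac)
  qed
  have total: "real n * w + (\<Sum>k<n. pv k) * (\<theta>\<^sup>2 * B / 2) \<le> err * B"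
  proof -
    let ?C = "K ^ 4 * P\<^sup>2"
    have K34: "K ^ 3 \<le> K ^ 4" "K \<le> K ^ 4"
      using K_ge_1 power_increasing[of 3 4 K] power_increasing[of 1 4 K] by auto
    have C3: "20 * K ^ 3 * P\<^sup>2 \<le> 20 * ?C" using K34 by (simp add: mult_right_mono)
    have C1: "K * P\<^sup>2 \<le> ?C" using K34 by (simp add: mult_right_mono)
    have g: "gauss_const * \<theta> ^ 3 * sqrt v ^ 3 * B \<le> 9 * gauss_const * ?C * (\<theta> ^ 3 * ?mm) * B"
    proof -
      have "gauss_const * \<theta> ^ 3 * sqrt v ^ 3 * B \<le> gauss_const * \<theta> ^ 3 * (9 * K ^ 4 * P\<^sup>2) * B"
        using v3 gauss_const_nonneg \<theta> B0 by (intro mult_right_mono mult_left_mono) auto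
      also have "\<dots> = 9 * gauss_const * ?C * (\<theta> ^ 3 * 1) * B" by (simp add: mult_ac)
      also have "\<dots> \<le> 9 * gauss_const * ?C * (\<theta> ^ 3 * ?mm) * B"
        using mm gauss_const_nonneg \<theta> B0 by (intro mult_right_mono mult_left_mono) auto
      finally show ?thesis .
    qed
    have h0: "0 \<le> \<theta> ^ 3 * ?mm" "0 \<le> \<theta>\<^sup>2 * ?m1" using \<theta> by auto
    have "20 * K ^ 3 * P\<^sup>2 * (\<theta> ^ 3 * ?mm + \<theta>\<^sup>2 * ?m1) * B \<le> 20 * ?C * (\<theta> ^ 3 * ?mm + \<theta>\<^sup>2 * ?m1) * B"
      using C3 h0 B0 by (intro mult_right_mono) auto
    then have "w \<le> 20 * ?C * (\<theta> ^ 3 * ?mm + \<theta>\<^sup>2 * ?m1) * B + 9 * gauss_const * ?C * (\<theta> ^ 3 * ?mm) * B"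
      unfolding w_def using g by linarith
    then have wn: "real n * w \<le> real n * (20 * ?C * (\<theta> ^ 3 * ?mm + \<theta>\<^sup>2 * ?m1) * B + 9 * gauss_const * ?C * (\<theta> ^ 3 * ?mm) * B)"
      by (intro mult_left_mono) auto
    have "(\<Sum>k<n. pv k) * (\<theta>\<^sup>2 * B / 2) \<le> 12 * ?C * (real n * ?m1) * (\<theta>\<^sup>2 * B / 2)"
    proof (rule mult_right_mono)
      have "12 * (K * P\<^sup>2) * (real n * ?m1) \<le> 12 * ?C * (real n * ?m1)"
        by (intro mult_right_mono mult_left_mono C1) auto
      then show "(\<Sum>k<n. pv k) \<le> 12 * ?C * (real n * ?m1)" using pv by (simp add: mult.assoc)
    qed (use B0 in auto)
    then have "real n * w + (\<Sum>k<n. pv k) * (\<theta>\<^sup>2 * B / 2) \<le>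
      real n * (20 * ?C * (\<theta> ^ 3 * ?mm + \<theta>\<^sup>2 * ?m1) * B + 9 * gauss_const * ?C * (\<theta> ^ 3 * ?mm) * B)
      + 12 * ?C * (real n * ?m1) * (\<theta>\<^sup>2 * B / 2)"
      using wn by linarith
    \<comment> \<open>26 is 20 from the single steps plus half of 12 from the variance
      mismatches.\<close>
    also have "\<dots> = real n * ?C * B * ((20 + 9 * gauss_const) * (\<theta> ^ 3 * ?mm) + 26 * (\<theta>\<^sup>2 * ?m1))"
      by (simp add: algebra_simps)
    also have "\<dots> \<le> real n * ?C * B * ((26 + 9 * gauss_const) * (\<theta> ^ 3 * ?mm) + (26 + 9 * gauss_const) * (\<theta>\<^sup>2 * ?m1))"
      using h0 gauss_const_nonneg B0 K_ge_1
      by (intro mult_left_mono add_mono mult_right_mono) auto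
    also have "\<dots> = err * B" unfolding err_def by (simp add: algebra_simps)
    finally show ?thesis .
  qed
  have w0: "0 \<le> w"
    unfolding w_def using gauss_const_nonneg \<theta> v0 B0 K_ge_1 by auto
  have dist: "\<bar>A k - A 0\<bar> \<le> err * B" if "k \<le> n" for k
  proof -
    have "\<bar>A k - A 0\<bar> \<le> (\<Sum>i<k. w + pv i * (\<theta>\<^sup>2 * B / 2))"
      using that
    proof (induction k)
      case (Suc k)
      then show ?case using step[of k] by simp
    qed simp
    also have "\<dots> \<le> (\<Sum>i<n. w + pv i * (\<theta>\<^sup>2 * B / 2))"
      using that w0 B0 by (intro sum_mono2) (auto simp: pv_def)
    also have "\<dots> = real n * w + (\<Sum>k<n. pv k) * (\<theta>\<^sup>2 * B / 2)"
      by (simp add: sum.distrib sum_distrib_right)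
    finally show ?thesis using total by linarith
  qed
  have "Mx \<in> A ` {..n}" unfolding Mx_def by (intro Max_in) auto
  then obtain k where "k \<le> n" "Mx = A k" by auto
  then have "Mx \<le> A 0 + err * B" using dist[of k] by simp
  \<comment> \<open>\<open>1/4 * B\<close> is \<open>Mx / 2\<close>, so \<open>Mx\<close> is at most
    \<open>2 * A 0\<close>.\<close>
  also have "err * B \<le> 1/4 * B" using err B0 by (intro mult_right_mono)
  finally have "B \<le> 4 * A 0" unfolding B_def by simp
  moreover have "0 \<le> err" unfolding err_def using gauss_const_nonneg \<theta> K_ge_1 by auto
  ultimately have "err * B \<le> err * (4 * A 0)" by (intro mult_left_mono)
  then have "\<bar>A n - A 0\<bar> \<le> 4 * err * A 0" using dist[of n] by simp
  moreover have "A n = expectation (\<lambda>\<omega>. f (S n \<omega>))" by (simp add: A_def U_def)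
  moreover have "A 0 = heat (real n * v) f 0" by (simp add: A_def U_def prob_space)
  ultimately show ?thesis by simp
qed

end

end

section \<open>Gaussian tails\<close>

definition normal_tail :: "real \<Rightarrow> real" where
  "normal_tail x = measure std_normal_distribution {x<..}"

lemma normal_tail_eq: "normal_tail x = 1 - cdf std_normal_distribution x"
proof -
  have "normal_tail x = measure std_normal_distribution (space std_normal_distribution - {..x})"
    unfolding normal_tail_def by (auto intro!: arg_cong2[where f = measure])
  also have "\<dots> = 1 - measure std_normal_distribution {..x}"
    by (rule std_normal.prob_compl) simp
  finally show ?thesis by (simp add: cdf_def)
qed

definition smoothed_tail :: "real \<Rightarrow> real \<Rightarrow> real" where
  "smoothed_tail \<kappa> y = (\<integral>z. logistic (\<kappa> * (z - y)) \<partial>std_normal_distribution)"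

lemma (in prob_space) integrable_logistic:
  "W \<in> borel_measurable M \<Longrightarrow> integrable M (\<lambda>\<omega>. logistic (W \<omega>))"
  by (rule integrable_const_bound[where B = 1]) (use logistic_less_1 logistic_pos in \<open>auto simp: less_imp_le\<close>)

lemma smoothed_tail_antimono:
  assumes "0 \<le> \<kappa>" "x \<le> y" shows "smoothed_tail \<kappa> y \<le> smoothed_tail \<kappa> x"
  unfolding smoothed_tail_def
  by (intro integral_mono std_normal.integrable_logistic logistic_mono mult_left_mono) (use assms in auto)

section \<open>Comparison of the Gaussian density with the Gaussian tail\<close>

lemma std_normal_measure:
  assumes "A \<in> sets borel"
  shows "emeasure std_normal_distribution A = (\<integral>\<^sup>+z. ennreal (std_normal_density z) * indicator A z \<partial>lborel)"
  using assms by (subst emeasure_density) auto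

text \<open>The parabola \<open>z^2 / 2\<close> lies above its tangent at \<open>a\<close>, so the
  density is dominated by an exponential that can be integrated explicitly.\<close>

lemma std_normal_density_shift:
  assumes "a \<le> z"
  shows "std_normal_density z \<le> std_normal_density a * exp (- (a * (z - a)))"
proof -
  have "0 \<le> (z - a)\<^sup>2" by simp
  then have "- (z\<^sup>2 / 2) \<le> - (a\<^sup>2 / 2) + - (a * (z - a))"
    by (simp add: power2_eq_square algebra_simps)
  then have "exp (- (z\<^sup>2 / 2)) \<le> exp (- (a\<^sup>2 / 2)) * exp (- (a * (z - a)))"
    unfolding exp_add[symmetric] by simp
  then show ?thesis by (simp add: std_normal_density_def divide_right_mono)
qed

lemma std_normal_density_uminus: "std_normal_density (- z) = std_normal_density z"
  by (simp add: std_normal_density_def)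

lemma std_normal_density_shift':
  assumes "z \<le> x"
  shows "std_normal_density z \<le> std_normal_density x * exp (x * (x - z))"
  using std_normal_density_shift[of "- x" "- z"] assms
  by (simp add: std_normal_density_uminus)

lemma normal_interval_le:
  assumes "x \<le> y" "0 \<le> b" "\<And>z. x < z \<Longrightarrow> z \<le> y \<Longrightarrow> std_normal_density z \<le> b"
  shows "measure std_normal_distribution {x<..y} \<le> (y - x) * b"
proof -
  have "emeasure std_normal_distribution {x<..y} \<le> (\<integral>\<^sup>+z. ennreal b * indicator {x<..y} z \<partial>lborel)"
    using assms by (subst std_normal_measure) (auto intro!: nn_integral_mono ennreal_leI split: split_indicator)
  also have "\<dots> = ennreal ((y - x) * b)"
    using assms by (simp add: nn_integral_cmult_indicator ennreal_mult' mult.commute)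
  finally show ?thesis
    using assms by (simp add: std_normal.emeasure_eq_measure)
qed

lemma normal_tail_split:
  assumes "x \<le> y" shows "normal_tail x = measure std_normal_distribution {x<..y} + normal_tail y"
proof -
  have "measure std_normal_distribution ({x<..y} \<union> {y<..})
      = measure std_normal_distribution {x<..y} + measure std_normal_distribution {y<..}"
    by (rule std_normal.finite_measure_Union) auto
  moreover have "{x<..y} \<union> {y<..} = {x<..}" using assms by auto
  ultimately show ?thesis unfolding normal_tail_def by simp
qed

lemma normal_tail_left:
  assumes "z \<le> x" "0 \<le> x"
  shows "normal_tail z \<le> normal_tail x + (x - z) * (std_normal_density x * exp (x * (x - z)))"
proof -
  have "measure std_normal_distribution {z<..x} \<le> (x - z) * (std_normal_density x * exp (x * (x - z)))"
  proof (rule normal_interval_le)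
    fix t assume t: "z < t" "t \<le> x"
    have "std_normal_density t \<le> std_normal_density x * exp (x * (x - t))"
      by (rule std_normal_density_shift'[OF t(2)])
    also have "\<dots> \<le> std_normal_density x * exp (x * (x - z))"
      using t assms by (intro mult_left_mono) (auto intro!: mult_left_mono)
    finally show "std_normal_density t \<le> std_normal_density x * exp (x * (x - z))" .
  qed (use assms in auto)
  then show ?thesis using normal_tail_split[OF assms(1)] by simp
qed

lemma normal_tail_right:
  assumes "0 \<le> x" "x \<le> y"
  shows "normal_tail x \<le> normal_tail y + (y - x) * std_normal_density x"
proof -
  have "measure std_normal_distribution {x<..y} \<le> (y - x) * std_normal_density x"
  proof (rule normal_interval_le)
    fix t assume t: "x < t" "t \<le> y"
    have "std_normal_density t \<le> std_normal_density x * exp (- (x * (t - x)))"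
      using t by (intro std_normal_density_shift) auto
    also have "\<dots> \<le> std_normal_density x * 1"
      using t assms by (intro mult_left_mono) auto
    finally show "std_normal_density t \<le> std_normal_density x" by simp
  qed (use assms in auto)
  then show ?thesis using normal_tail_split[OF assms(2)] by simp
qed

text \<open>A Mills-ratio bound. On an interval of length \<open>1 / (1 + x)\<close> to the right of
  \<open>x\<close> the exponent falls by at most 3/2, hence by less than 2, and
  \<open>exp 2 \<le> 9\<close>. It turns additive errors proportional to the density into errors
  relative to the tail.\<close>

lemma std_normal_density_le_tail:
  assumes "0 \<le> x"
  shows "std_normal_density x \<le> 9 * (1 + x) * normal_tail x"
proof -
  define d where "d = 1 / (1 + x)"
  have d: "0 < d" "d \<le> 1" "x * d \<le> 1" using assms by (auto simp: d_def field_simps)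
  have low: "std_normal_density x / 9 \<le> std_normal_density z" if "z \<in> {x<..x + d}" for z
  proof -
    define t where "t = z - x"
    have t: "0 \<le> t" "t \<le> d" using that by (auto simp: t_def)
    have "x * t \<le> x * d" using t assms by (intro mult_left_mono) auto
    moreover have "t\<^sup>2 \<le> 1" using t d by (intro power_le_one) auto
    moreover have "z\<^sup>2 = x\<^sup>2 + 2 * (x * t) + t\<^sup>2" by (simp add: t_def power2_eq_square algebra_simps)
    ultimately have "- (x\<^sup>2 / 2) + - 2 \<le> - (z\<^sup>2 / 2)" using d by linarith
    then have "exp (- (x\<^sup>2 / 2)) * exp (- 2) \<le> exp (- (z\<^sup>2 / 2))"
      unfolding exp_add[symmetric] by simp
    moreover have "exp (2::real) \<le> 9"
    proof -
      have "exp (1::real) * exp 1 \<le> 3 * 3" using exp_le by (intro mult_mono) auto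
      then show ?thesis by (simp add: exp_add[symmetric])
    qed
    then have "1 / 9 \<le> exp (- 2 :: real)" by (simp add: exp_minus field_simps)
    then have "exp (- (x\<^sup>2 / 2)) * (1 / 9) \<le> exp (- (x\<^sup>2 / 2)) * exp (- 2)"
      by (intro mult_left_mono) auto
    ultimately have "exp (- (x\<^sup>2 / 2)) / 9 \<le> exp (- (z\<^sup>2 / 2))" by linarith
    then have "exp (- (x\<^sup>2 / 2)) / 9 / sqrt (2 * pi) \<le> exp (- (z\<^sup>2 / 2)) / sqrt (2 * pi)"
      by (rule divide_right_mono) simp
    then show ?thesis by (simp add: std_normal_density_def)
  qed
  have "ennreal (d * (std_normal_density x / 9)) = (\<integral>\<^sup>+z. ennreal (std_normal_density x / 9) * indicator {x<..x + d} z \<partial>lborel)"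
    using d by (subst nn_integral_cmult_indicator) (auto simp: ennreal_mult'[symmetric] mult.commute)
  also have "\<dots> \<le> emeasure std_normal_distribution {x<..x + d}"
    using low by (subst std_normal_measure) (auto intro!: nn_integral_mono ennreal_leI split: split_indicator)
  finally have "d * (std_normal_density x / 9) \<le> measure std_normal_distribution {x<..x + d}"
    by (simp add: std_normal.emeasure_eq_measure)
  also have "\<dots> \<le> normal_tail x"
    unfolding normal_tail_def by (intro std_normal.finite_measure_mono) auto
  finally show ?thesis using assms by (simp add: d_def field_simps)
qed

lemma std_normal_density_pos: "0 < std_normal_density x"
  by (rule normal_density_pos) simp

lemma normal_tail_pos: assumes "0 \<le> x" shows "0 < normal_tail x"
  using std_normal_density_le_tail[OF assms] std_normal_density_pos[of x] assms
  by (smt (verit) mult_nonneg_nonpos)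

section \<open>The Gaussian tail after logistic smoothing\<close>

lemma smoothed_tail_lower:
  assumes "0 < \<kappa>" "0 \<le> \<eta>"
  shows "(1 - exp (- (\<kappa> * \<eta>))) * normal_tail (y + \<eta>) \<le> smoothed_tail \<kappa> y"
proof -
  have "(1 - exp (- (\<kappa> * \<eta>))) * normal_tail (y + \<eta>) =
      (\<integral>z. (1 - exp (- (\<kappa> * \<eta>))) * indicator {y + \<eta><..} z \<partial>std_normal_distribution)"
    by (simp add: normal_tail_def)
  also have "\<dots> \<le> smoothed_tail \<kappa> y"
    unfolding smoothed_tail_def
  proof (rule integral_mono)
    show "integrable std_normal_distribution (\<lambda>z. (1 - exp (- (\<kappa> * \<eta>))) * indicator {y + \<eta><..} z)"
      by (intro integrable_mult_right std_normal.integrable_const_bound[where B = 1]) auto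
    fix z
    show "(1 - exp (- (\<kappa> * \<eta>))) * indicator {y + \<eta><..} z \<le> logistic (\<kappa> * (z - y))"
    proof (cases "y + \<eta> < z")
      case True
      then have "1 - exp (- (\<kappa> * \<eta>)) \<le> logistic (\<kappa> * \<eta>)" by (intro logistic_ge)
      also have "\<dots> \<le> logistic (\<kappa> * (z - y))" using True assms by (intro logistic_mono mult_left_mono) auto
      finally show ?thesis using True by simp
    qed (use logistic_pos[of "\<kappa> * (z - y)"] in auto)
  qed (rule std_normal.integrable_logistic, simp)
  finally show ?thesis .
qed

lemma nn_integral_exp_tail:
  assumes "0 < (r::real)" "0 \<le> b"
  shows "(\<integral>\<^sup>+z. ennreal (b * exp (- (r * (z - a)))) * indicator {a..} z \<partial>lborel) = ennreal (b / r)"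
proof -
  have "(\<integral>\<^sup>+z. ennreal (b * exp (- (r * (z - a)))) * indicator {a..} z \<partial>lborel)
      = ennreal (0 - (- (b / r) * exp (- (r * (a - a)))))"
  proof (rule nn_integral_FTC_atLeast[where F = "\<lambda>z. - (b / r) * exp (- (r * (z - a)))"])
    show "((\<lambda>z. - (b / r) * exp (- (r * (z - a)))) has_real_derivative b * exp (- (r * (z - a)))) (at z)" for z
      using assms by (auto intro!: derivative_eq_intros)
    have "((\<lambda>z. exp (- (r * (z - a)))) \<longlongrightarrow> 0) at_top"
      by (rule filterlim_compose[OF exp_at_bot])
         (use assms in \<open>real_asymp\<close>)
    then show "((\<lambda>z. - (b / r) * exp (- (r * (z - a)))) \<longlongrightarrow> 0) at_top"
      using tendsto_mult_right_zero by blast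
  qed (use assms in auto)
  then show ?thesis by simp
qed

text \<open>Left of \<open>y\<close> the density grows at most at rate \<open>y\<close> while the
  logistic function decays at rate \<kappa>; the net rate \<open>\<kappa> - y\<close> is at least
  \<open>\<kappa> / 2\<close>, so the overshoot is at most
  \<open>2 * std_normal_density y / \<kappa>\<close>.\<close>

lemma smoothed_tail_upper:
  assumes "0 < \<kappa>" "y \<le> \<kappa> / 2"
  shows "smoothed_tail \<kappa> y \<le> normal_tail y + 2 * std_normal_density y / \<kappa>"
proof -
  let ?N = std_normal_distribution
  let ?b = "std_normal_density y"
  have int: "integrable ?N (\<lambda>z. logistic (\<kappa> * (- z - y)))"
    by (rule std_normal.integrable_logistic) simp
  \<comment> \<open>Reflection turns the overshoot on the left of \<open>y\<close> into an integral
    over the upper half-line from \<open>- y\<close>.\<close>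
  have "smoothed_tail \<kappa> y = (\<integral>z. logistic (\<kappa> * (z - y)) \<partial>distr ?N borel uminus)"
    unfolding smoothed_tail_def std_normal_uminus ..
  also have "\<dots> = (\<integral>z. logistic (\<kappa> * (- z - y)) \<partial>?N)"
    by (subst integral_distr) auto
  finally have "ennreal (smoothed_tail \<kappa> y) = (\<integral>\<^sup>+z. ennreal (logistic (\<kappa> * (- z - y))) \<partial>?N)"
    using int by (simp add: nn_integral_eq_integral less_imp_le[OF logistic_pos])
  also have "\<dots> = (\<integral>\<^sup>+z. ennreal (std_normal_density z) * ennreal (logistic (\<kappa> * (- z - y))) \<partial>lborel)"
    by (subst nn_integral_density) auto
  also have "\<dots> \<le> (\<integral>\<^sup>+z. ennreal (std_normal_density z) * indicator {..<- y} z
      + ennreal (?b * exp (- ((\<kappa> - y) * (z - (- y))))) * indicator {- y..} z \<partial>lborel)"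
  proof (rule nn_integral_mono)
    fix z :: real
    show "ennreal (std_normal_density z) * ennreal (logistic (\<kappa> * (- z - y)))
      \<le> ennreal (std_normal_density z) * indicator {..<- y} z
      + ennreal (?b * exp (- ((\<kappa> - y) * (z - (- y))))) * indicator {- y..} z"
    proof (cases "z < - y")
      case True
      have "std_normal_density z * logistic (\<kappa> * (- z - y)) \<le> std_normal_density z * 1"
        using logistic_less_1 by (intro mult_left_mono) (auto intro: less_imp_le)
      then show ?thesis
        using True by (simp add: ennreal_mult'[symmetric] ennreal_leI less_imp_le[OF logistic_pos])
    next
      case False
      have "std_normal_density z \<le> ?b * exp (y * (z + y))"
        using std_normal_density_shift[of "- y" z] False by (simp add: std_normal_density_uminus)
      moreover have "logistic (\<kappa> * (- z - y)) \<le> exp (\<kappa> * (- z - y))" by (rule logistic_le_exp)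
      ultimately have "std_normal_density z * logistic (\<kappa> * (- z - y)) \<le> (?b * exp (y * (z + y))) * exp (\<kappa> * (- z - y))"
        by (intro mult_mono) (auto intro: less_imp_le[OF logistic_pos])
      also have "\<dots> = ?b * exp (- ((\<kappa> - y) * (z - (- y))))"
        by (simp add: mult.assoc exp_add[symmetric] algebra_simps)
      finally show ?thesis
        using False by (simp add: ennreal_mult'[symmetric] ennreal_leI less_imp_le[OF logistic_pos])
    qed
  qed
  also have "\<dots> = emeasure ?N {..<- y} + ennreal (?b / (\<kappa> - y))"
  proof -
    have "(\<integral>\<^sup>+z. ennreal (?b * exp (- ((\<kappa> - y) * (z - (- y))))) * indicator {- y..} z \<partial>lborel) = ennreal (?b / (\<kappa> - y))"
      using assms by (intro nn_integral_exp_tail) auto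
    then show ?thesis
      by (subst nn_integral_add) (simp_all add: std_normal_measure)
  qed
  also have "emeasure ?N {..<- y} = emeasure (distr ?N borel uminus) {..<- y}"
    by (simp add: std_normal_uminus)
  also have "\<dots> = emeasure ?N {y<..}"
    by (subst emeasure_distr) (auto intro!: arg_cong2[where f = emeasure])
  also have "emeasure ?N {y<..} + ennreal (?b / (\<kappa> - y)) = ennreal (normal_tail y + ?b / (\<kappa> - y))"
    using assms by (subst ennreal_plus) (auto simp: normal_tail_def std_normal.emeasure_eq_measure)
  finally have "smoothed_tail \<kappa> y \<le> normal_tail y + ?b / (\<kappa> - y)"
    using assms by (subst (asm) ennreal_le_iff) (auto simp: normal_tail_def)
  also have "?b / (\<kappa> - y) \<le> ?b / (\<kappa> / 2)"
    using assms by (intro divide_left_mono mult_pos_pos) auto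
  finally show ?thesis by (simp add: mult.commute)
qed

text \<open>On the event the logistic value is at least \<open>logistic (\<kappa> * \<eta>)\<close>,
  the reciprocal of \<open>1 + exp (- (\<kappa> * \<eta>))\<close>.\<close>

lemma (in prob_space) tail_le_logistic:
  assumes [measurable]: "W \<in> borel_measurable M" and "0 < \<kappa>"
  shows "prob {\<omega> \<in> space M. W \<omega> \<ge> x} \<le> (1 + exp (- (\<kappa> * \<eta>))) * expectation (\<lambda>\<omega>. logistic (\<kappa> * (W \<omega> - (x - \<eta>))))"
proof -
  have int: "integrable M (\<lambda>\<omega>. logistic (\<kappa> * (W \<omega> - (x - \<eta>))))"
    by (rule integrable_logistic) measurable
  have "prob {\<omega> \<in> space M. W \<omega> \<ge> x} = expectation (indicator {\<omega> \<in> space M. W \<omega> \<ge> x})"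
    by simp
  also have "\<dots> \<le> expectation (\<lambda>\<omega>. (1 + exp (- (\<kappa> * \<eta>))) * logistic (\<kappa> * (W \<omega> - (x - \<eta>))))"
  proof (rule integral_mono)
    show "integrable M (indicator {\<omega> \<in> space M. W \<omega> \<ge> x} :: _ \<Rightarrow> real)"
      by (rule integrable_const_bound[where B = 1]) auto
    fix \<omega>
    show "indicator {\<omega> \<in> space M. W \<omega> \<ge> x} \<omega> \<le> (1 + exp (- (\<kappa> * \<eta>))) * logistic (\<kappa> * (W \<omega> - (x - \<eta>)))"
    proof (cases "W \<omega> \<ge> x")
      case True
      have "1 = (1 + exp (- (\<kappa> * \<eta>))) * logistic (\<kappa> * \<eta>)"
        using exp_gt_zero[of "- (\<kappa> * \<eta>)"] by (simp add: logistic_def del: exp_gt_zero)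
      also have "\<dots> \<le> (1 + exp (- (\<kappa> * \<eta>))) * logistic (\<kappa> * (W \<omega> - (x - \<eta>)))"
        using True assms(2) by (intro mult_left_mono logistic_mono) auto
      finally show ?thesis by (simp add: indicator_def)
    qed (use logistic_pos[of "\<kappa> * (W \<omega> - (x - \<eta>))"] in \<open>auto simp: add_nonneg_nonneg\<close>)
  qed (use int in auto)
  finally show ?thesis using int by simp
qed

text \<open>Off the event the logistic function must be removed without an additive error, which
  would swamp the tail. Its bound \<open>exp s\<close> is split into two equal factors: one is at
  most \<open>exp (- (\<kappa> * \<eta> / 2))\<close>, the other at most twice the logistic function
  of half the slope, whose expectation is again comparable with the tail.\<close>

lemma (in prob_space) tail_ge_logistic:
  assumes [measurable]: "W \<in> borel_measurable M" and "0 < \<kappa>" "0 \<le> \<eta>"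
  shows "expectation (\<lambda>\<omega>. logistic (\<kappa> * (W \<omega> - (x + \<eta>))))
      - 2 * exp (- (\<kappa> * \<eta> / 2)) * expectation (\<lambda>\<omega>. logistic (\<kappa> / 2 * (W \<omega> - (x + \<eta>))))
    \<le> prob {\<omega> \<in> space M. W \<omega> \<ge> x}"
proof -
  have int: "integrable M (\<lambda>\<omega>. logistic (r * (W \<omega> - (x + \<eta>))))" for r
    by (rule integrable_logistic) measurable
  have inti: "integrable M (indicator {\<omega> \<in> space M. W \<omega> \<ge> x} :: _ \<Rightarrow> real)"
    by (rule integrable_const_bound[where B = 1]) auto
  have "expectation (\<lambda>\<omega>. logistic (\<kappa> * (W \<omega> - (x + \<eta>))))
     \<le> expectation (\<lambda>\<omega>. indicator {\<omega> \<in> space M. W \<omega> \<ge> x} \<omega>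
          + 2 * exp (- (\<kappa> * \<eta> / 2)) * logistic (\<kappa> / 2 * (W \<omega> - (x + \<eta>))))"
  proof (rule integral_mono)
    fix \<omega> assume \<omega>: "\<omega> \<in> space M"
    define s where "s = \<kappa> * (W \<omega> - (x + \<eta>))"
    have s2: "\<kappa> / 2 * (W \<omega> - (x + \<eta>)) = s / 2" by (simp add: s_def)
    have "logistic s \<le> indicator {\<omega> \<in> space M. W \<omega> \<ge> x} \<omega> + 2 * exp (- (\<kappa> * \<eta> / 2)) * logistic (s / 2)"
    proof (cases "W \<omega> \<ge> x")
      case True
      then show ?thesis
        using \<omega> logistic_less_1[of s] logistic_pos[of "s / 2"] by (simp add: add_increasing2 less_imp_le)
    next
      case False
      then have s: "s \<le> - (\<kappa> * \<eta>)"
        using assms(2) mult_left_mono[of "W \<omega> - x" 0 \<kappa>] by (simp add: s_def algebra_simps)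
      then have s0: "s \<le> 0" using assms(2,3) mult_nonneg_nonneg[of \<kappa> \<eta>] by linarith
      have "exp (s / 2) \<le> 2 * logistic (s / 2)"
      proof -
        have "1 + exp (- (s / 2)) \<le> 2 * exp (- (s / 2))" using s0 by simp
        then have "exp (s / 2) * (1 + exp (- (s / 2))) \<le> exp (s / 2) * (2 * exp (- (s / 2)))"
          by (intro mult_left_mono) auto
        also have "\<dots> = 2" by (simp add: exp_minus)
        finally show ?thesis by (simp add: logistic_def pos_le_divide_eq add_pos_pos)
      qed
      moreover have "logistic s \<le> exp (s / 2) * exp (s / 2)"
        using logistic_le_exp[of s] by (simp add: exp_add[symmetric])
      moreover have "exp (s / 2) * exp (s / 2) \<le> exp (- (\<kappa> * \<eta> / 2)) * (2 * logistic (s / 2))"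
        using s calculation(1) by (intro mult_mono) auto
      ultimately show ?thesis by (simp add: indicator_def False mult_ac)
    qed
    then show "logistic (\<kappa> * (W \<omega> - (x + \<eta>))) \<le> indicator {\<omega> \<in> space M. W \<omega> \<ge> x} \<omega>
          + 2 * exp (- (\<kappa> * \<eta> / 2)) * logistic (\<kappa> / 2 * (W \<omega> - (x + \<eta>)))"
      unfolding s2 s_def[symmetric] .
  qed (intro Bochner_Integration.integrable_add integrable_mult_right int inti)+
  also have "\<dots> = prob {\<omega> \<in> space M. W \<omega> \<ge> x}
      + 2 * exp (- (\<kappa> * \<eta> / 2)) * expectation (\<lambda>\<omega>. logistic (\<kappa> / 2 * (W \<omega> - (x + \<eta>))))"
    using int[of "\<kappa> / 2"] inti by (subst Bochner_Integration.integral_add) auto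
  finally show ?thesis by simp
qed

text \<open>Bounds for the tail ratio at slope \<open>\<kappa> = \<rho> * a\<close> and shift
  \<open>\<eta> = 1 / (a * sqrt \<rho>)\<close>, where \<epsilon> is the relative error of the
  Gaussian approximation.\<close>

definition ratio_upper :: "real \<Rightarrow> real \<Rightarrow> real" where
  "ratio_upper \<rho> \<epsilon> = (1 + exp (- sqrt \<rho>)) * ((1 + \<epsilon>) * (1 + 27 * (1 / sqrt \<rho> + 2 / \<rho>)))"

definition ratio_lower :: "real \<Rightarrow> real \<Rightarrow> real" where
  "ratio_lower \<rho> \<epsilon> = (1 - \<epsilon>) * ((1 - exp (- sqrt \<rho>)) * (1 - 18 / sqrt \<rho>))
     - 2 * exp (- (sqrt \<rho> / 2)) * ((1 + \<epsilon>) * (1 + 36 / \<rho>))"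

lemma (in prob_space) tail_ratio_bounds:
  assumes W [measurable]: "W \<in> borel_measurable M" and a: "1 \<le> a" and \<rho>: "4 \<le> \<rho>" and \<epsilon>: "0 \<le> \<epsilon>" "\<epsilon> \<le> 1"
    and approx: "\<And>y \<kappa>. \<kappa> \<in> {\<rho> * a, \<rho> * a / 2} \<Longrightarrow>
        \<bar>expectation (\<lambda>\<omega>. logistic (\<kappa> * (W \<omega> - y))) - smoothed_tail \<kappa> y\<bar> \<le> \<epsilon> * smoothed_tail \<kappa> y"
    and x: "0 \<le> x" "1 + x \<le> a"
  shows "prob {\<omega> \<in> space M. W \<omega> \<ge> x} \<le> ratio_upper \<rho> \<epsilon> * normal_tail x"
    and "ratio_lower \<rho> \<epsilon> * normal_tail x \<le> prob {\<omega> \<in> space M. W \<omega> \<ge> x}"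
proof -
  define \<kappa> where "\<kappa> = \<rho> * a"
  define r where "r = sqrt \<rho>"
  \<comment> \<open>A compromise: \<open>\<kappa> * \<eta>\<close> is \<open>sqrt \<rho>\<close>, so
    the logistic function saturates over the shift, while \<open>a * \<eta>\<close> is
    \<open>1 / sqrt \<rho>\<close>, so the Gaussian tail hardly changes over it.\<close>
  define \<eta> where "\<eta> = 1 / (a * r)"
  let ?Q = "normal_tail x" and ?\<phi> = "std_normal_density x"
  have r: "2 \<le> r" "r * r = \<rho>" using \<rho> by (auto simp: r_def intro: real_le_rsqrt)
  have \<kappa>0: "0 < \<kappa>" using \<rho> a by (simp add: \<kappa>_def)
  have \<eta>0: "0 < \<eta>" using r a by (simp add: \<eta>_def)
  have \<kappa>\<eta>: "\<kappa> * \<eta> = r" using r a by (simp add: \<kappa>_def \<eta>_def field_simps)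
  have a\<eta>: "a * \<eta> = 1 / r" using r a by (simp add: \<eta>_def)
  have Q: "0 < ?Q" by (rule normal_tail_pos[OF x(1)])
  have \<phi>: "?\<phi> \<le> 9 * a * ?Q"
  proof -
    have "9 * (1 + x) * ?Q \<le> 9 * a * ?Q" using x Q by (intro mult_right_mono) auto
    then show ?thesis using std_normal_density_le_tail[OF x(1)] by linarith
  qed
  have up: "expectation (\<lambda>\<omega>. logistic (\<kappa> * (W \<omega> - y))) \<le> (1 + \<epsilon>) * smoothed_tail \<kappa> y"
    and lo: "(1 - \<epsilon>) * smoothed_tail \<kappa> y \<le> expectation (\<lambda>\<omega>. logistic (\<kappa> * (W \<omega> - y)))"
    and up2: "expectation (\<lambda>\<omega>. logistic (\<kappa> / 2 * (W \<omega> - y))) \<le> (1 + \<epsilon>) * smoothed_tail (\<kappa> / 2) y" for y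
    using approx[of \<kappa> y] approx[of "\<kappa> / 2" y] unfolding \<kappa>_def
    by (auto simp: distrib_right left_diff_distrib abs_le_iff)
  have xa: "x \<le> a" using x by simp
  have x\<eta>: "x * \<eta> \<le> 1"
  proof -
    have "x * \<eta> \<le> a * \<eta>" using xa \<eta>0 by (intro mult_right_mono) auto
    also have "\<dots> \<le> 1" using a\<eta> r by simp
    finally show ?thesis .
  qed
  have e3: "exp (x * \<eta>) \<le> 3" using x\<eta> exp_le by (smt (verit) exp_le_cancel_iff)
  have s_up: "smoothed_tail \<kappa> (x - \<eta>) \<le> (1 + 27 * (1 / r + 2 / \<rho>)) * ?Q"
  proof -
    have "4 * a \<le> \<kappa>" unfolding \<kappa>_def using \<rho> a by (intro mult_right_mono) auto
    then have "x - \<eta> \<le> \<kappa> / 2" using xa \<eta>0 a by linarith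
    then have "smoothed_tail \<kappa> (x - \<eta>) \<le> normal_tail (x - \<eta>) + 2 * std_normal_density (x - \<eta>) / \<kappa>"
      by (rule smoothed_tail_upper[OF \<kappa>0])
    also have "normal_tail (x - \<eta>) \<le> ?Q + \<eta> * (?\<phi> * exp (x * \<eta>))"
      using normal_tail_left[of "x - \<eta>" x] x \<eta>0 by simp
    also have "2 * std_normal_density (x - \<eta>) / \<kappa> \<le> 2 * (?\<phi> * exp (x * \<eta>)) / \<kappa>"
      using std_normal_density_shift'[of "x - \<eta>" x] \<eta>0 \<kappa>0 by (intro divide_right_mono) auto
    also have "?Q + \<eta> * (?\<phi> * exp (x * \<eta>)) + 2 * (?\<phi> * exp (x * \<eta>)) / \<kappa> = ?Q + (\<eta> + 2 / \<kappa>) * (?\<phi> * exp (x * \<eta>))"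
      by (simp add: algebra_simps)
    \<comment> \<open>9 comes from bounding the density by the tail and 3 from
      \<open>exp (x * \<eta>)\<close>; together they give 27.\<close>
    also have "\<dots> \<le> ?Q + (\<eta> + 2 / \<kappa>) * ((9 * a * ?Q) * 3)"
      using \<phi> e3 \<eta>0 \<kappa>0 Q a by (intro add_left_mono mult_left_mono mult_mono) auto
    also have "\<dots> = ?Q + 27 * (a * \<eta> + 2 * (a / \<kappa>)) * ?Q" by (simp add: algebra_simps)
    also have "a / \<kappa> = 1 / \<rho>" using a \<rho> by (simp add: \<kappa>_def)
    also have "a * \<eta> = 1 / r" by (rule a\<eta>)
    finally show ?thesis by (simp add: algebra_simps)
  qed
  have "prob {\<omega> \<in> space M. W \<omega> \<ge> x} \<le> (1 + exp (- r)) * expectation (\<lambda>\<omega>. logistic (\<kappa> * (W \<omega> - (x - \<eta>))))"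
    using tail_le_logistic[OF W \<kappa>0, of x \<eta>] by (simp add: \<kappa>\<eta>)
  also have "\<dots> \<le> (1 + exp (- r)) * ((1 + \<epsilon>) * ((1 + 27 * (1 / r + 2 / \<rho>)) * ?Q))"
    using \<epsilon> by (intro mult_left_mono order_trans[OF up] s_up) (auto simp: add_nonneg_nonneg)
  finally show "prob {\<omega> \<in> space M. W \<omega> \<ge> x} \<le> ratio_upper \<rho> \<epsilon> * ?Q"
    by (simp add: ratio_upper_def r_def mult_ac)
  have s_lo: "((1 - exp (- r)) * (1 - 18 / r)) * ?Q \<le> smoothed_tail \<kappa> (x + \<eta>)"
  proof -
    have "?Q \<le> normal_tail (x + \<eta> + \<eta>) + 2 * \<eta> * ?\<phi>"
      using normal_tail_right[of x "x + \<eta> + \<eta>"] x \<eta>0 by simp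
    also have "2 * \<eta> * ?\<phi> \<le> 2 * \<eta> * (9 * a * ?Q)"
      using \<phi> \<eta>0 by (intro mult_left_mono) auto
    also have "\<dots> = 18 * (a * \<eta>) * ?Q" by simp
    finally have "(1 - 18 / r) * ?Q \<le> normal_tail (x + \<eta> + \<eta>)"
      unfolding a\<eta> by (simp add: left_diff_distrib)
    then have "(1 - exp (- r)) * ((1 - 18 / r) * ?Q) \<le> (1 - exp (- r)) * normal_tail (x + \<eta> + \<eta>)"
      using r by (intro mult_left_mono) auto
    also have "\<dots> \<le> smoothed_tail \<kappa> (x + \<eta>)"
      using smoothed_tail_lower[OF \<kappa>0, of \<eta> "x + \<eta>"] \<eta>0 by (simp add: \<kappa>\<eta>)
    finally show ?thesis by (simp add: mult.assoc)
  qed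
  have s_up2: "smoothed_tail (\<kappa> / 2) (x + \<eta>) \<le> (1 + 36 / \<rho>) * ?Q"
  proof -
    have "4 * a \<le> \<kappa>" unfolding \<kappa>_def using \<rho> a by (intro mult_right_mono) auto
    then have l4: "x \<le> \<kappa> / 2 / 2" using xa by linarith
    have "smoothed_tail (\<kappa> / 2) (x + \<eta>) \<le> smoothed_tail (\<kappa> / 2) x"
      using \<kappa>0 \<eta>0 by (intro smoothed_tail_antimono) auto
    also have "\<dots> \<le> ?Q + 2 * ?\<phi> / (\<kappa> / 2)"
      using l4 \<kappa>0 by (intro smoothed_tail_upper) auto
    also have "\<dots> \<le> ?Q + 2 * (9 * a * ?Q) / (\<kappa> / 2)"
      using \<phi> \<kappa>0 by (intro add_left_mono divide_right_mono mult_left_mono) auto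
    also have "\<dots> = ?Q + 36 * (a / \<kappa>) * ?Q" by simp
    also have "a / \<kappa> = 1 / \<rho>" using a \<rho> by (simp add: \<kappa>_def)
    finally show ?thesis by (simp add: distrib_right)
  qed
  have "(1 - \<epsilon>) * (((1 - exp (- r)) * (1 - 18 / r)) * ?Q) \<le> (1 - \<epsilon>) * smoothed_tail \<kappa> (x + \<eta>)"
    using s_lo \<epsilon> by (intro mult_left_mono) auto
  then have 1: "(1 - \<epsilon>) * (((1 - exp (- r)) * (1 - 18 / r)) * ?Q) \<le> expectation (\<lambda>\<omega>. logistic (\<kappa> * (W \<omega> - (x + \<eta>))))"
    using lo[of "x + \<eta>"] by linarith
  have "(1 + \<epsilon>) * smoothed_tail (\<kappa> / 2) (x + \<eta>) \<le> (1 + \<epsilon>) * ((1 + 36 / \<rho>) * ?Q)"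
    using s_up2 \<epsilon> by (intro mult_left_mono) auto
  then have "expectation (\<lambda>\<omega>. logistic (\<kappa> / 2 * (W \<omega> - (x + \<eta>)))) \<le> (1 + \<epsilon>) * ((1 + 36 / \<rho>) * ?Q)"
    using up2[of "x + \<eta>"] by linarith
  then have 2: "2 * exp (- (r / 2)) * expectation (\<lambda>\<omega>. logistic (\<kappa> / 2 * (W \<omega> - (x + \<eta>))))
      \<le> 2 * exp (- (r / 2)) * ((1 + \<epsilon>) * ((1 + 36 / \<rho>) * ?Q))"
    by (intro mult_left_mono) auto
  have 3: "expectation (\<lambda>\<omega>. logistic (\<kappa> * (W \<omega> - (x + \<eta>))))
      - 2 * exp (- (r / 2)) * expectation (\<lambda>\<omega>. logistic (\<kappa> / 2 * (W \<omega> - (x + \<eta>))))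
    \<le> prob {\<omega> \<in> space M. W \<omega> \<ge> x}"
    using tail_ge_logistic[OF W \<kappa>0, of \<eta> x] \<eta>0 by (simp add: \<kappa>\<eta>)
  have "ratio_lower \<rho> \<epsilon> * ?Q = (1 - \<epsilon>) * (((1 - exp (- r)) * (1 - 18 / r)) * ?Q)
      - 2 * exp (- (r / 2)) * ((1 + \<epsilon>) * ((1 + 36 / \<rho>) * ?Q))"
    by (simp add: ratio_lower_def r_def left_diff_distrib mult.assoc)
  then show "ratio_lower \<rho> \<epsilon> * ?Q \<le> prob {\<omega> \<in> space M. W \<omega> \<ge> x}"
    using 1 2 3 by linarith
qed

lemma ratio_limits:
  assumes \<rho>: "filterlim \<rho> at_top sequentially" and \<epsilon>: "\<epsilon> \<longlonglongrightarrow> 0"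
  shows "(\<lambda>n. ratio_upper (\<rho> n) (\<epsilon> n)) \<longlonglongrightarrow> 1" "(\<lambda>n. ratio_lower (\<rho> n) (\<epsilon> n)) \<longlonglongrightarrow> 1"
proof -
  have s: "filterlim (\<lambda>n. sqrt (\<rho> n)) at_top sequentially"
    by (rule filterlim_compose[OF sqrt_at_top \<rho>])
  have e: "(\<lambda>n. exp (- sqrt (\<rho> n))) \<longlonglongrightarrow> 0"
    by (rule filterlim_compose[OF exp_at_bot filterlim_uminus_at_bot_at_top[THEN filterlim_compose, OF s]])
  have "((\<lambda>x::real. exp (- (sqrt x / 2))) \<longlongrightarrow> 0) at_top" by real_asymp
  then have e2: "(\<lambda>n. exp (- (sqrt (\<rho> n) / 2))) \<longlonglongrightarrow> 0" by (rule filterlim_compose[OF _ \<rho>])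
  have c1: "(\<lambda>n. c / sqrt (\<rho> n)) \<longlonglongrightarrow> 0" for c :: real
    by (rule tendsto_divide_0[OF tendsto_const filterlim_at_top_imp_at_infinity[OF s]])
  have c2: "(\<lambda>n. c / \<rho> n) \<longlonglongrightarrow> 0" for c :: real
    by (rule tendsto_divide_0[OF tendsto_const filterlim_at_top_imp_at_infinity[OF \<rho>]])
  have "(\<lambda>n. ratio_upper (\<rho> n) (\<epsilon> n)) \<longlonglongrightarrow> (1 + 0) * ((1 + 0) * (1 + 27 * (0 + 0)))"
    unfolding ratio_upper_def by (intro tendsto_intros e \<epsilon> c1 c2)
  moreover have "(\<lambda>n. ratio_lower (\<rho> n) (\<epsilon> n)) \<longlonglongrightarrow>
      (1 - 0) * ((1 - 0) * (1 - 0)) - 2 * 0 * ((1 + 0) * (1 + 0))"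
    unfolding ratio_lower_def by (intro tendsto_intros e e2 \<epsilon> c1 c2)
  ultimately show "(\<lambda>n. ratio_upper (\<rho> n) (\<epsilon> n)) \<longlonglongrightarrow> 1" "(\<lambda>n. ratio_lower (\<rho> n) (\<epsilon> n)) \<longlonglongrightarrow> 1"
    by simp_all
qed

section \<open>Moderate deviations for mixing sequences\<close>

context mixing_sequence
begin

context
  fixes \<beta> P :: real
  assumes D: "polynomial_decay \<psi> \<beta> P" and \<beta>: "1 < \<beta>" "\<beta> < 2"
begin

definition lindeberg_const :: real where
  "lindeberg_const = (26 + 9 * gauss_const) * K ^ 4 * P\<^sup>2"

lemma lindeberg_const_nonneg: "0 \<le> lindeberg_const"
  unfolding lindeberg_const_def using gauss_const_nonneg K_ge_1 by auto

text \<open>Returns from \<open>S n\<close> to the normalised sum: a slope \<kappa> there is the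
  slope \<open>t\<close> here. The error increases with the slope, so an upper bound \<theta>
  suffices, and it can be chosen without the exact variance.\<close>

lemma logistic_approx:
  fixes n m :: nat and \<kappa> y \<theta> err :: real
  assumes v: "0 < mean_variance n" and m: "1 \<le> m" "m \<le> n" and \<kappa>: "0 < \<kappa>"
    and \<theta>: "\<kappa> / sqrt (real n * mean_variance n) \<le> \<theta>" "\<theta> * K \<le> 1" "\<theta> * sqrt (mean_variance n) \<le> 1"
    and err: "lindeberg_const * (real n * (\<theta> ^ 3 * real m powr (2 - \<beta>) + \<theta>\<^sup>2 * real m powr (1 - \<beta>))) \<le> err" "err \<le> 1/4"
  shows "\<bar>expectation (\<lambda>\<omega>. logistic (\<kappa> * (S n \<omega> / sqrt (real n * mean_variance n) - y))) - smoothed_tail \<kappa> y\<bar>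
    \<le> 4 * err * smoothed_tail \<kappa> y"
proof -
  let ?v = "mean_variance n"
  let ?s = "sqrt (real n * ?v)"
  define t where "t = \<kappa> / ?s"
  have s: "0 < ?s" using v m by simp
  have t: "0 < t" "t \<le> \<theta>" using \<kappa> s \<theta>(1) by (auto simp: t_def)
  have tK: "t * K \<le> 1" using mult_right_mono[OF t(2), of K] \<theta>(2) K_ge_1 by linarith
  have tv: "t * sqrt ?v \<le> 1"
    using mult_right_mono[OF t(2), of "sqrt ?v"] \<theta>(3) real_sqrt_ge_zero[of ?v] v by linarith
  have "lindeberg_const * (real n * (t ^ 3 * real m powr (2 - \<beta>) + t\<^sup>2 * real m powr (1 - \<beta>)))
    \<le> lindeberg_const * (real n * (\<theta> ^ 3 * real m powr (2 - \<beta>) + \<theta>\<^sup>2 * real m powr (1 - \<beta>)))"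
    using t lindeberg_const_nonneg by (intro mult_left_mono add_mono mult_right_mono power_mono) auto
  then have e: "lindeberg_const * (real n * (t ^ 3 * real m powr (2 - \<beta>) + t\<^sup>2 * real m powr (1 - \<beta>))) \<le> err"
    using err(1) by linarith
  have "t * (0 + ?s * z) - \<kappa> * y = \<kappa> * (z - y)" for z
  proof -
    have "t * ?s = \<kappa>" unfolding t_def using nonzero_eq_divide_eq[of ?s t \<kappa>] s t_def by auto
    then show ?thesis by (simp only: add_0 mult.assoc[symmetric] right_diff_distrib)
  qed
  then have heat: "heat (real n * ?v) (\<lambda>w. logistic (t * w - \<kappa> * y)) 0 = smoothed_tail \<kappa> y"
    unfolding heat_def smoothed_tail_def by simp
  have eq: "(\<lambda>\<omega>. logistic (\<kappa> * (S n \<omega> / ?s - y))) = (\<lambda>\<omega>. logistic (t * S n \<omega> - \<kappa> * y))"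
    by (simp add: t_def right_diff_distrib)
  have "\<bar>expectation (\<lambda>\<omega>. logistic (t * S n \<omega> - \<kappa> * y)) - heat (real n * ?v) (\<lambda>w. logistic (t * w - \<kappa> * y)) 0\<bar>
    \<le> 4 * (lindeberg_const * (real n * (t ^ 3 * real m powr (2 - \<beta>) + t\<^sup>2 * real m powr (1 - \<beta>))))
       * heat (real n * ?v) (\<lambda>w. logistic (t * w - \<kappa> * y)) 0"
    unfolding lindeberg_const_def
    using t tK tv m e err(2)
    by (intro lindeberg[OF D \<beta> slow_logistic]) (auto simp: lindeberg_const_def)
  also have "\<dots> \<le> 4 * err * heat (real n * ?v) (\<lambda>w. logistic (t * w - \<kappa> * y)) 0"
    using e unfolding heat smoothed_tail_def
    by (intro mult_right_mono mult_left_mono integral_nonneg_AE AE_I2) (auto intro: less_imp_le[OF logistic_pos])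
  finally show ?thesis unfolding eq heat .
qed

theorem moderate_deviations:
  fixes x :: "nat \<Rightarrow> real"
  assumes L: "(\<lambda>n. c 0 + 2 * (\<Sum>j=1..n. c j)) \<longlonglongrightarrow> L" "0 < L"
    and x: "\<And>n. 0 \<le> x n" "x \<in> o(\<lambda>n. real n powr ((\<beta> - 1) / (6 * \<beta> - 2)))"
  shows "(\<lambda>n. SUP t\<in>{0..x n}. \<bar>prob {\<omega> \<in> space M. S n \<omega> / sqrt (real n) \<ge> t * sqrt (mean_variance n)} / normal_tail t - 1\<bar>) \<longlonglongrightarrow> 0"
proof -
  define \<alpha> where "\<alpha> = (\<beta> - 1) / (6 * \<beta> - 2)"
  define \<gamma> where "\<gamma> = 1 / (3 * \<beta> - 1)"
  have b2: "0 < 3 * \<beta> - 1" "6 * \<beta> - 2 = 2 * (3 * \<beta> - 1)" using \<beta> by auto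
  have \<alpha>: "0 < \<alpha>" "\<alpha> \<le> 1/2" and \<gamma>: "0 < \<gamma>" "\<gamma> \<le> 1"
    using \<beta> b2 by (auto simp: \<alpha>_def \<gamma>_def field_simps)
  have \<alpha>_eq: "\<alpha> = (\<beta> * \<gamma> - \<gamma>) / 2"
    unfolding \<alpha>_def \<gamma>_def b2(2) by (simp add: diff_divide_distrib)
  have \<gamma>_eq: "3 * (\<beta> * \<gamma>) - \<gamma> = 1"
    using b2(1) unfolding \<gamma>_def by (simp add: diff_divide_distrib[symmetric])
  \<comment> \<open>The exponent of \<open>n\<close> in the error term with the square of \<theta>;
    its decay will come from \<open>s n\<close> alone.\<close>
  have ex1: "2 * \<alpha> + \<gamma> * (1 - \<beta>) = 0"
    unfolding \<alpha>_eq by (simp add: field_simps)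
  \<comment> \<open>The exponent of \<open>n\<close> in the error term with the cube of \<theta>; it
    equals \<open>\<gamma> * (1 - \<beta>)\<close>.\<close>
  have ex2: "3 * \<alpha> - 1/2 + \<gamma> * (2 - \<beta>) \<le> 0"
  proof -
    have "\<gamma> * (2 - \<beta>) = 2 * \<gamma> - \<beta> * \<gamma>" by (simp add: algebra_simps)
    moreover have "1 * \<gamma> \<le> \<beta> * \<gamma>" using \<beta> \<gamma> by (intro mult_right_mono) auto
    ultimately show ?thesis unfolding \<alpha>_eq using \<gamma>_eq by argo
  qed
  define b where "b n = real n powr \<alpha>" for n
  define a where "a n = 1 + x n" for n
  \<comment> \<open>The slope is \<open>b n * s n\<close>, the geometric mean of \<open>a n\<close>
    and \<open>b n\<close>; then \<open>\<rho> n = 1 / s n\<close> is its ratio to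
    \<open>a n\<close>.\<close>
  define s where "s n = sqrt (a n / b n)" for n
  define \<rho> where "\<rho> n = 1 / s n" for n
  \<comment> \<open>Eventually a lower bound for the variance, which makes \<open>\<theta> n\<close>
    an explicit power of \<open>n\<close> times a multiple of \<open>s n\<close>.\<close>
  define v0 where "v0 = L / 2"
  have v0: "0 < v0" using L by (simp add: v0_def)
  define \<theta> where "\<theta> n = b n * s n / (sqrt (real n) * sqrt v0)" for n
  define err where "err n = lindeberg_const * (2 * (s n ^ 3 / sqrt v0 ^ 3) + (s n)\<^sup>2 / v0)" for n
  define m where "m n = nat \<lceil>real n powr \<gamma>\<rceil>" for n
  have b_top: "filterlim b at_top sequentially"
    unfolding b_def using \<alpha> by real_asymp
  have a1: "1 \<le> a n" for n using x(1) by (simp add: a_def)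
  have "(\<lambda>n. x n / b n) \<longlonglongrightarrow> 0"
    using smalloD_tendsto[OF x(2)] unfolding b_def \<alpha>_def .
  moreover have "(\<lambda>n. 1 / b n) \<longlonglongrightarrow> 0"
    by (rule tendsto_divide_0[OF tendsto_const filterlim_at_top_imp_at_infinity[OF b_top]])
  ultimately have "(\<lambda>n. 1 / b n + x n / b n) \<longlonglongrightarrow> 0 + 0" by (intro tendsto_add)
  then have "(\<lambda>n. a n / b n) \<longlonglongrightarrow> 0" by (simp add: a_def add_divide_distrib)
  then have "(\<lambda>n. sqrt (a n / b n)) \<longlonglongrightarrow> sqrt 0" by (rule tendsto_real_sqrt)
  then have s0: "s \<longlonglongrightarrow> 0" by (simp add: s_def[abs_def])
  have b_pos: "0 < b n" if "1 \<le> n" for n using that by (simp add: b_def)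
  have s_pos: "0 < s n" if "1 \<le> n" for n
    using b_pos[OF that] a1[of n] by (simp add: s_def)
  have \<rho>_top: "filterlim \<rho> at_top sequentially"
  proof -
    have "filterlim s (at_right 0) sequentially"
      using s0 by (rule tendsto_imp_filterlim_at_right)
        (auto intro!: eventually_mono[OF eventually_ge_at_top[of 1]] s_pos)
    then have "filterlim (\<lambda>n. inverse (s n)) at_top sequentially"
      by (rule filterlim_compose[OF filterlim_inverse_at_top_right])
    then show ?thesis by (simp add: \<rho>_def[abs_def] inverse_eq_divide)
  qed
  have "(\<lambda>n. lindeberg_const * (2 * (s n ^ 3 / sqrt v0 ^ 3) + (s n)\<^sup>2 / v0)) \<longlonglongrightarrow>
      lindeberg_const * (2 * (0 ^ 3 / sqrt v0 ^ 3) + 0\<^sup>2 / v0)"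
    using v0 by (intro tendsto_intros s0) auto
  then have err0: "err \<longlonglongrightarrow> 0" by (simp add: err_def[abs_def])
  have mv: "(\<lambda>n. mean_variance n) \<longlonglongrightarrow> L"
  proof -
    have "(\<lambda>n. mean_variance n - partial_variance n n) \<longlonglongrightarrow> 0"
    proof (rule tendsto_rabs_zero_cancel[OF tendsto_sandwich[OF _ _ tendsto_const]])
      have "((\<lambda>n. 6 * K * P\<^sup>2 * real n powr (1 - \<beta>)) \<longlongrightarrow> 6 * K * P\<^sup>2 * 0) sequentially"
        using \<beta> by (intro tendsto_intros) real_asymp
      then show "(\<lambda>n. 6 * K * P\<^sup>2 * real n powr (1 - \<beta>)) \<longlonglongrightarrow> 0" by simp
      show "\<forall>\<^sub>F n in sequentially. \<bar>mean_variance n - partial_variance n n\<bar> \<le> 6 * K * P\<^sup>2 * real n powr (1 - \<beta>)"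
        using eventually_ge_at_top[of 1]
      proof eventually_elim
        case (elim n)
        have "real n * \<bar>mean_variance n - partial_variance n n\<bar> \<le> real n * (6 * K * P\<^sup>2 * real n powr (1 - \<beta>))"
          using mean_variance_error[OF D \<beta> order_refl elim] by (simp add: mult_ac)
        then show ?case using elim by simp
      qed
    qed auto
    moreover have "(\<lambda>n. partial_variance n n) \<longlonglongrightarrow> L"
      using L by (simp add: partial_variance_def)
    ultimately have "(\<lambda>n. (mean_variance n - partial_variance n n) + partial_variance n n) \<longlonglongrightarrow> 0 + L"
      by (rule tendsto_add)
    then show ?thesis by simp
  qed
  have "\<forall>\<^sub>F n in sequentially. v0 < mean_variance n"
    by (rule order_tendstoD[OF mv]) (use L in \<open>simp add: v0_def\<close>)
  moreover have "\<forall>\<^sub>F n in sequentially. err n < 1/4" by (rule order_tendstoD[OF err0]) simp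
  \<comment> \<open>The first two thresholds provide \<open>\<theta> n * K \<le> 1\<close> and
    \<open>\<theta> n * sqrt (mean_variance n) \<le> 1\<close>.\<close>
  moreover have "\<forall>\<^sub>F n in sequentially. s n < min (sqrt v0 / K) (min (sqrt v0 / sqrt (3 * K\<^sup>2 * P)) 1)"
    using v0 K_ge_1 P_ge_1[OF D \<beta>] by (intro order_tendstoD[OF s0]) (simp add: zero_less_mult_iff)
  moreover have "\<forall>\<^sub>F n in sequentially. 4 \<le> \<rho> n"
    using \<rho>_top by (simp add: filterlim_at_top)
  moreover have "\<forall>\<^sub>F n::nat in sequentially. 1 \<le> n" by (rule eventually_ge_at_top)
  ultimately have bound: "\<forall>\<^sub>F n in sequentially. \<forall>t\<in>{0..x n}.
      \<bar>prob {\<omega> \<in> space M. S n \<omega> / sqrt (real n) \<ge> t * sqrt (mean_variance n)} / normal_tail t - 1\<bar>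
        \<le> \<bar>ratio_upper (\<rho> n) (4 * err n) - 1\<bar> + \<bar>ratio_lower (\<rho> n) (4 * err n) - 1\<bar>"
  proof eventually_elim
    case (elim n)
    let ?v = "mean_variance n"
    define W where "W \<omega> = S n \<omega> / sqrt (real n * ?v)" for \<omega>
    have v: "0 < ?v" using elim v0 by simp
    have n: "1 \<le> n" "0 < real n" using elim by auto
    have s: "0 < s n" using s_pos elim by simp
    have mn: "real n powr \<gamma> \<le> real (m n)" "real (m n) \<le> 2 * real n powr \<gamma>"
    proof -
      have 1: "1 \<le> real n powr \<gamma>" using n \<gamma> by (intro ge_one_powr_ge_zero) auto
      show "real n powr \<gamma> \<le> real (m n)" unfolding m_def by linarith
      have "real (m n) \<le> real n powr \<gamma> + 1"
        unfolding m_def using 1 by linarith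
      then show "real (m n) \<le> 2 * real n powr \<gamma>" using 1 by linarith
    qed
    have m1: "1 \<le> m n" using mn(1) n \<gamma> ge_one_powr_ge_zero[of "real n" \<gamma>] by simp
    have m2: "m n \<le> n"
    proof -
      have "real n powr \<gamma> \<le> real n powr 1" using n \<gamma> by (intro powr_mono) auto
      then have "real n powr \<gamma> \<le> real n" using n by simp
      then show ?thesis unfolding m_def by (simp add: nat_le_iff ceiling_le_iff)
    qed
    have q: "(1::real) \<le> ?v / v0" using elim v0 by simp
    have \<theta>0: "0 \<le> \<theta> n" unfolding \<theta>_def using b_pos[OF n(1)] s v0 by simp
    have \<kappa>\<theta>: "\<kappa> / sqrt (real n * ?v) \<le> \<theta> n" if "\<kappa> \<le> b n * s n" for \<kappa>
    proof -
      have "\<kappa> / sqrt (real n * ?v) \<le> (b n * s n) / sqrt (real n * ?v)"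
        using that v n by (intro divide_right_mono) auto
      also have "\<dots> \<le> \<theta> n"
        unfolding \<theta>_def real_sqrt_mult using elim v0 n b_pos[OF n(1)] s
        by (intro divide_left_mono mult_left_mono) auto
      finally show ?thesis .
    qed
    have b_sqrt: "b n \<le> sqrt (real n)"
      using powr_mono[of \<alpha> "1/2" "real n"] \<alpha> n by (simp add: b_def powr_half_sqrt)
    have \<theta>_le: "\<theta> n \<le> s n / sqrt v0"
    proof -
      have "\<theta> n = (b n / sqrt (real n)) * (s n / sqrt v0)" by (simp add: \<theta>_def)
      also have "\<dots> \<le> 1 * (s n / sqrt v0)"
        using b_sqrt n s v0 by (intro mult_right_mono) auto
      finally show ?thesis by simp
    qed
    have \<theta>K: "\<theta> n * K \<le> 1"
    proof -
      have "\<theta> n * K \<le> s n / sqrt v0 * K" using \<theta>_le K_ge_1 by (intro mult_right_mono) auto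
      also have "\<dots> \<le> (sqrt v0 / K) / sqrt v0 * K"
        using elim K_ge_1 v0 by (intro mult_right_mono divide_right_mono) auto
      also have "\<dots> = 1" using K_ge_1 v0 by simp
      finally show ?thesis .
    qed
    have \<theta>v: "\<theta> n * sqrt ?v \<le> 1"
    proof -
      define Y where "Y = sqrt (3 * K\<^sup>2 * P)"
      have y: "0 < Y" unfolding Y_def using K_ge_1 P_ge_1[OF D \<beta>] by (simp add: zero_less_mult_iff)
      have "sqrt ?v \<le> Y" unfolding Y_def using mean_variance_bound[OF D \<beta>, of n] by simp
      then have "\<theta> n * sqrt ?v \<le> s n / sqrt v0 * Y"
        using \<theta>_le s v0 v by (intro mult_mono) auto
      also have "\<dots> \<le> (sqrt v0 / Y) / sqrt v0 * Y"
        using elim y v0 unfolding Y_def[symmetric] by (intro mult_right_mono divide_right_mono) auto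
      also have "\<dots> = 1" using y v0 by simp
      finally show ?thesis .
    qed
    have e: "lindeberg_const * (real n * (\<theta> n ^ 3 * real (m n) powr (2 - \<beta>) + (\<theta> n)\<^sup>2 * real (m n) powr (1 - \<beta>))) \<le> err n"
      unfolding err_def
    proof (rule mult_left_mono[OF _ lindeberg_const_nonneg])
      have sn: "sqrt (real n) = real n powr (1/2)" using n by (simp add: powr_half_sqrt)
      have "real (m n) powr (2 - \<beta>) \<le> (2 * real n powr \<gamma>) powr (2 - \<beta>)"
        using mn \<beta> by (intro powr_mono2) auto
      also have "\<dots> = 2 powr (2 - \<beta>) * real n powr (\<gamma> * (2 - \<beta>))" by (simp add: powr_mult powr_powr)
      also have "\<dots> \<le> 2 * real n powr (\<gamma> * (2 - \<beta>))"
        using powr_mono[of "2 - \<beta>" 1 2] \<beta> by (intro mult_right_mono) auto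
      finally have p1: "real (m n) powr (2 - \<beta>) \<le> 2 * real n powr (\<gamma> * (2 - \<beta>))" .
      have "real (m n) powr (1 - \<beta>) \<le> (real n powr \<gamma>) powr (1 - \<beta>)"
        using mn(1) n \<beta> by (intro powr_mono2') auto
      then have p2: "real (m n) powr (1 - \<beta>) \<le> real n powr (\<gamma> * (1 - \<beta>))" by (simp add: powr_powr)
      have t3: "real n * \<theta> n ^ 3 = real n powr (3 * \<alpha> - 1/2) * (s n ^ 3 / sqrt v0 ^ 3)"
      proof -
        have "real n * \<theta> n ^ 3 = real n * b n ^ 3 / sqrt (real n) ^ 3 * (s n ^ 3 / sqrt v0 ^ 3)"
          by (simp add: \<theta>_def power_mult_distrib power_divide)
        also have "real n * b n ^ 3 / sqrt (real n) ^ 3 = real n powr 1 * real n powr (3 * \<alpha>) / real n powr (3/2)"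
        proof -
          have "(real n powr q) ^ 3 = real n powr (3 * q)" for q
            by (simp add: power3_eq_cube powr_add[symmetric])
          from this[of \<alpha>] this[of "1/2"] show ?thesis
            unfolding sn b_def using n by simp
        qed
        also have "\<dots> = real n powr (3 * \<alpha> - 1/2)"
          unfolding powr_add[symmetric] powr_diff[symmetric]
          by (rule arg_cong[where f = "\<lambda>q. real n powr q"]) simp
        finally show ?thesis .
      qed
      have t2: "real n * (\<theta> n)\<^sup>2 = real n powr (2 * \<alpha>) * ((s n)\<^sup>2 / v0)"
      proof -
        have "real n * (\<theta> n)\<^sup>2 = (b n)\<^sup>2 * ((s n)\<^sup>2 / v0)"
          using n v0 by (simp add: \<theta>_def power_mult_distrib power_divide)
        also have "(b n)\<^sup>2 = real n powr (2 * \<alpha>)"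
          unfolding b_def by (simp add: power2_eq_square powr_add[symmetric])
        finally show ?thesis .
      qed
      have r0: "0 \<le> s n ^ 3 / sqrt v0 ^ 3" "0 \<le> (s n)\<^sup>2 / v0" using s v0 by auto
      have "real n * (\<theta> n ^ 3 * real (m n) powr (2 - \<beta>))
         = real n powr (3 * \<alpha> - 1/2) * (s n ^ 3 / sqrt v0 ^ 3) * real (m n) powr (2 - \<beta>)"
        by (simp only: mult.assoc[symmetric] t3)
      also have "\<dots> \<le> real n powr (3 * \<alpha> - 1/2) * (s n ^ 3 / sqrt v0 ^ 3) * (2 * real n powr (\<gamma> * (2 - \<beta>)))"
        by (intro mult_left_mono p1 mult_nonneg_nonneg r0) simp
      also have "\<dots> = 2 * (s n ^ 3 / sqrt v0 ^ 3) * real n powr (3 * \<alpha> - 1/2 + \<gamma> * (2 - \<beta>))"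
        by (simp add: powr_add)
      also have "\<dots> \<le> 2 * (s n ^ 3 / sqrt v0 ^ 3) * 1"
        using powr_mono[OF ex2, of "real n"] n by (intro mult_left_mono mult_nonneg_nonneg r0) auto
      finally have 1: "real n * (\<theta> n ^ 3 * real (m n) powr (2 - \<beta>)) \<le> 2 * (s n ^ 3 / sqrt v0 ^ 3)" by simp
      have "real n * ((\<theta> n)\<^sup>2 * real (m n) powr (1 - \<beta>)) = real n powr (2 * \<alpha>) * ((s n)\<^sup>2 / v0) * real (m n) powr (1 - \<beta>)"
        by (simp only: mult.assoc[symmetric] t2)
      also have "\<dots> \<le> real n powr (2 * \<alpha>) * ((s n)\<^sup>2 / v0) * real n powr (\<gamma> * (1 - \<beta>))"
        by (intro mult_left_mono p2 mult_nonneg_nonneg r0) simp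
      also have "\<dots> = (s n)\<^sup>2 / v0 * real n powr (2 * \<alpha> + \<gamma> * (1 - \<beta>))"
        by (simp add: powr_add)
      also have "\<dots> = (s n)\<^sup>2 / v0" unfolding ex1 using n by simp
      finally show "real n * (\<theta> n ^ 3 * real (m n) powr (2 - \<beta>) + (\<theta> n)\<^sup>2 * real (m n) powr (1 - \<beta>))
         \<le> 2 * (s n ^ 3 / sqrt v0 ^ 3) + (s n)\<^sup>2 / v0"
        using 1 by (simp add: distrib_left)
    qed
    have \<rho>a: "\<rho> n * a n = b n * s n"
    proof -
      have "s n * s n = a n / b n" unfolding s_def using a1[of n] b_pos[OF n(1)] by simp
      then have "b n * (s n * s n) = a n" using b_pos[OF n(1)] by simp
      then show ?thesis using s by (simp add: \<rho>_def field_simps)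
    qed
    have approx: "\<bar>expectation (\<lambda>\<omega>. logistic (\<kappa> * (W \<omega> - y))) - smoothed_tail \<kappa> y\<bar> \<le> 4 * err n * smoothed_tail \<kappa> y"
      if "\<kappa> \<in> {\<rho> n * a n, \<rho> n * a n / 2}" for \<kappa> y
    proof -
      have "0 < b n * s n" using b_pos[OF n(1)] s by simp
      then have "0 < \<kappa>" "\<kappa> \<le> b n * s n" using that unfolding \<rho>a by auto
      then show ?thesis
        unfolding W_def using \<theta>K \<theta>v e elim by (intro logistic_approx[OF v m1 m2 _ \<kappa>\<theta>]) auto
    qed
    have err_nonneg: "0 \<le> err n"
      unfolding err_def using lindeberg_const_nonneg s v0 by (intro mult_nonneg_nonneg add_nonneg_nonneg) auto
    have W: "W \<in> borel_measurable M" unfolding W_def by measurable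
    show ?case
    proof
      fix t assume t: "t \<in> {0..x n}"
      let ?p = "prob {\<omega> \<in> space M. W \<omega> \<ge> t}"
      have "?p \<le> ratio_upper (\<rho> n) (4 * err n) * normal_tail t"
        "ratio_lower (\<rho> n) (4 * err n) * normal_tail t \<le> ?p"
      proof -
        have h: "4 \<le> \<rho> n" "0 \<le> 4 * err n" "4 * err n \<le> 1" "0 \<le> t" "1 + t \<le> a n"
          using t elim err_nonneg by (auto simp: a_def)
        show "?p \<le> ratio_upper (\<rho> n) (4 * err n) * normal_tail t"
          by (rule tail_ratio_bounds(1)[OF W a1 h(1-3) approx h(4,5)])
        show "ratio_lower (\<rho> n) (4 * err n) * normal_tail t \<le> ?p"
          by (rule tail_ratio_bounds(2)[OF W a1 h(1-3) approx h(4,5)])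
      qed
      moreover have Q: "0 < normal_tail t" using t by (intro normal_tail_pos) simp
      ultimately have "?p / normal_tail t \<le> ratio_upper (\<rho> n) (4 * err n)"
        "ratio_lower (\<rho> n) (4 * err n) \<le> ?p / normal_tail t"
        by (auto simp: pos_divide_le_eq pos_le_divide_eq)
      moreover have "{\<omega> \<in> space M. W \<omega> \<ge> t} = {\<omega> \<in> space M. S n \<omega> / sqrt (real n) \<ge> t * sqrt ?v}"
        unfolding W_def using v n by (auto simp: real_sqrt_mult field_simps)
      ultimately show "\<bar>prob {\<omega> \<in> space M. S n \<omega> / sqrt (real n) \<ge> t * sqrt (mean_variance n)} / normal_tail t - 1\<bar>
        \<le> \<bar>ratio_upper (\<rho> n) (4 * err n) - 1\<bar> + \<bar>ratio_lower (\<rho> n) (4 * err n) - 1\<bar>"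
        by auto
    qed
  qed
  have e4: "(\<lambda>n. 4 * err n) \<longlonglongrightarrow> 0" using tendsto_mult_left[OF err0, of 4] by simp
  have lim: "(\<lambda>n. \<bar>ratio_upper (\<rho> n) (4 * err n) - 1\<bar> + \<bar>ratio_lower (\<rho> n) (4 * err n) - 1\<bar>) \<longlonglongrightarrow> 0"
    using tendsto_add[OF tendsto_rabs[OF tendsto_diff[OF ratio_limits(1)[OF \<rho>_top e4] tendsto_const[of 1]]]
        tendsto_rabs[OF tendsto_diff[OF ratio_limits(2)[OF \<rho>_top e4] tendsto_const[of 1]]]]
    by simp
  show ?thesis
  proof (rule tendsto_sandwich[OF _ _ tendsto_const lim])
    show "\<forall>\<^sub>F n in sequentially. (SUP t\<in>{0..x n}. \<bar>prob {\<omega> \<in> space M. S n \<omega> / sqrt (real n) \<ge> t * sqrt (mean_variance n)} / normal_tail t - 1\<bar>)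
       \<le> \<bar>ratio_upper (\<rho> n) (4 * err n) - 1\<bar> + \<bar>ratio_lower (\<rho> n) (4 * err n) - 1\<bar>"
      using bound
    proof eventually_elim
      case (elim n)
      then show ?case using x(1)[of n] by (intro cSUP_least) auto
    qed
    \<comment> \<open>The real supremum is meaningful only for a bounded nonempty family;
      \<open>bound\<close> gives the former and the point 0 the latter.\<close>
    show "\<forall>\<^sub>F n in sequentially. 0 \<le> (SUP t\<in>{0..x n}. \<bar>prob {\<omega> \<in> space M. S n \<omega> / sqrt (real n) \<ge> t * sqrt (mean_variance n)} / normal_tail t - 1\<bar>)"
      using bound
    proof eventually_elim
      case (elim n)
      have "0 \<le> \<bar>prob {\<omega> \<in> space M. S n \<omega> / sqrt (real n) \<ge> 0 * sqrt (mean_variance n)} / normal_tail 0 - 1\<bar>" by simp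
      also have "\<dots> \<le> (SUP t\<in>{0..x n}. \<bar>prob {\<omega> \<in> space M. S n \<omega> / sqrt (real n) \<ge> t * sqrt (mean_variance n)} / normal_tail t - 1\<bar>)"
        using x(1)[of n] elim by (intro cSUP_upper bdd_aboveI2) auto
      finally show ?case .
    qed
  qed
qed

end

end

section \<open>Uniform mixing coefficients\<close>

text \<open>Mean value theorem for the primitive \<open>- (z powr (1 - \<beta>))\<close>, whose
  derivative is decreasing.\<close>

lemma powr_tail_step:
  fixes t \<beta> :: real
  assumes "1 \<le> t" "1 < \<beta>"
  shows "(\<beta> - 1) * (t + 1) powr (- \<beta>) \<le> t powr (1 - \<beta>) - (t + 1) powr (1 - \<beta>)"
proof -
  have "\<exists>z. t < z \<and> z < t + 1 \<and>
      - ((t + 1) powr (1 - \<beta>)) - - (t powr (1 - \<beta>)) = (t + 1 - t) * ((\<beta> - 1) * z powr (- \<beta>))"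
  proof (rule MVT2[where f = "\<lambda>z. - (z powr (1 - \<beta>))" and f' = "\<lambda>z. (\<beta> - 1) * z powr (- \<beta>)"])
    fix z assume "t \<le> z" "z \<le> t + 1"
    then show "((\<lambda>z. - (z powr (1 - \<beta>))) has_real_derivative (\<beta> - 1) * z powr (- \<beta>)) (at z)"
      using assms by (auto intro!: derivative_eq_intros simp: algebra_simps)
  qed simp
  then obtain z where z: "t < z" "z < t + 1"
    "t powr (1 - \<beta>) - (t + 1) powr (1 - \<beta>) = (\<beta> - 1) * z powr (- \<beta>)" by auto
  have "(t + 1) powr (- \<beta>) \<le> z powr (- \<beta>)" using z assms by (intro powr_mono2') auto
  then show ?thesis unfolding z(3) using assms by (intro mult_left_mono) auto
qed

lemma sum_powr_tail:
  assumes "1 \<le> m" "1 < \<beta>"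
  shows "(\<Sum>j=m+1..k. real j powr (- \<beta>)) \<le> real m powr (1 - \<beta>) / (\<beta> - 1)"
proof -
  have "(\<beta> - 1) * (\<Sum>j=m+1..k. real j powr (- \<beta>)) \<le> real m powr (1 - \<beta>) - real k powr (1 - \<beta>)" if "m \<le> k"
    using that
  proof (induction k rule: dec_induct)
    case (step k)
    have "(\<beta> - 1) * real (Suc k) powr (- \<beta>) \<le> real k powr (1 - \<beta>) - real (Suc k) powr (1 - \<beta>)"
      using powr_tail_step[of "real k" \<beta>] step assms by (simp add: add.commute)
    then show ?case using step by (simp add: distrib_left)
  qed simp
  then have "(\<beta> - 1) * (\<Sum>j=m+1..k. real j powr (- \<beta>)) \<le> real m powr (1 - \<beta>)"
    by (cases "m \<le> k") (auto intro: order_trans)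
  then show ?thesis using assms by (simp add: pos_le_divide_eq mult.commute)
qed

lemma sum_powr_upto:
  assumes "1 \<le> m" "1 < \<beta>" "\<beta> < 2"
  shows "(\<Sum>j=1..m. real j powr (1 - \<beta>)) \<le> real m powr (2 - \<beta>) / (2 - \<beta>)"
proof -
  have "(2 - \<beta>) * (\<Sum>j=1..m. real j powr (1 - \<beta>)) \<le> real m powr (2 - \<beta>)"
    using assms(1)
  proof (induction m rule: dec_induct)
    case (step m)
    have "\<exists>z. real m < z \<and> z < real m + 1 \<and>
      (real m + 1) powr (2 - \<beta>) - real m powr (2 - \<beta>) = (real m + 1 - real m) * ((2 - \<beta>) * z powr (1 - \<beta>))"
    proof (rule MVT2[where f = "\<lambda>z. z powr (2 - \<beta>)" and f' = "\<lambda>z. (2 - \<beta>) * z powr (1 - \<beta>)"])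
      fix z assume "real m \<le> z" "z \<le> real m + 1"
      then show "((\<lambda>z. z powr (2 - \<beta>)) has_real_derivative (2 - \<beta>) * z powr (1 - \<beta>)) (at z)"
        using step by (auto intro!: derivative_eq_intros)
    qed simp
    then obtain z where z: "real m < z" "z < real m + 1"
      "(real m + 1) powr (2 - \<beta>) - real m powr (2 - \<beta>) = (2 - \<beta>) * z powr (1 - \<beta>)" by auto
    have "(real m + 1) powr (1 - \<beta>) \<le> z powr (1 - \<beta>)" using z assms by (intro powr_mono2') auto
    then have "(2 - \<beta>) * (real m + 1) powr (1 - \<beta>) \<le> (2 - \<beta>) * z powr (1 - \<beta>)"
      using assms by (intro mult_left_mono) auto
    then show ?case using step z(3) by (simp add: distrib_left add.commute)
  qed (use assms in simp)
  then show ?thesis using assms by (simp add: pos_le_divide_eq mult.commute)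
qed

lemma polynomial_decay_powr:
  assumes "0 \<le> D" "1 < \<beta>" "\<beta> < 2"
  shows "\<exists>P. polynomial_decay (\<lambda>j. D * real j powr (- \<beta>)) \<beta> P"
proof -
  define P where "P = 1 + D * (1 + 1 / (\<beta> - 1)) + 1 / (2 - \<beta>)"
  have i: "0 \<le> 1 / (\<beta> - 1)" "0 \<le> 1 / (2 - \<beta>)" using assms by auto
  have d: "0 \<le> D * (1 / (\<beta> - 1))" using assms i by (intro mult_nonneg_nonneg)
  have PD: "D * (1 + 1 / (\<beta> - 1)) \<le> P" "D \<le> P" "D * (1 / (\<beta> - 1)) \<le> P" "1 / (2 - \<beta>) \<le> P" "1 \<le> P"
    unfolding P_def distrib_left using d assms(1) i by linarith+
  have tail: "(\<Sum>j=m+1..k. D * real j powr (- \<beta>)) \<le> D * (1 / (\<beta> - 1)) * real m powr (1 - \<beta>)" if "1 \<le> m" for m k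
    using mult_left_mono[OF sum_powr_tail[OF that assms(2), of k] assms(1)]
    by (simp add: sum_distrib_left)
  have all: "(\<Sum>j=1..k. D * real j powr (- \<beta>)) \<le> P" for k
  proof (cases "k = 0")
    case False
    then have "{1..k} = insert 1 {1+1..k}" by auto
    then have "(\<Sum>j=1..k. D * real j powr (- \<beta>)) = D + (\<Sum>j=1+1..k. D * real j powr (- \<beta>))"
      by simp
    also have "\<dots> \<le> D + D * (1 / (\<beta> - 1))" using tail[of 1 k] by simp
    finally show ?thesis using PD(1) unfolding distrib_left by simp
  qed (use PD in auto)
  have "polynomial_decay (\<lambda>j. D * real j powr (- \<beta>)) \<beta> P"
    unfolding polynomial_decay_def
  proof (intro conjI allI impI)
    show "(\<Sum>j=1..k. D * real j powr (- \<beta>)) \<le> P" for k by (rule all)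
    fix m k :: nat assume m: "1 \<le> m"
    show "(\<Sum>j=m+1..k. D * real j powr (- \<beta>)) \<le> P * real m powr (1 - \<beta>)"
      using tail[OF m, of k] mult_right_mono[OF PD(3), of "real m powr (1 - \<beta>)"] by simp
    have "real m * real m powr (- \<beta>) = real m powr (1 - \<beta>)"
      using m powr_add[of "real m" 1 "- \<beta>"] by simp
    then have "real m * (D * real m powr (- \<beta>)) = D * real m powr (1 - \<beta>)" by simp
    also have "\<dots> \<le> P * real m powr (1 - \<beta>)" using PD by (intro mult_right_mono) auto
    finally show "real m * (D * real m powr (- \<beta>)) \<le> P * real m powr (1 - \<beta>)" .
    have "(\<Sum>j=1..m. real j powr (1 - \<beta>)) \<le> 1 / (2 - \<beta>) * real m powr (2 - \<beta>)"
      using sum_powr_upto[OF m assms(2,3)] by simp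
    also have "\<dots> \<le> P * real m powr (2 - \<beta>)" using PD by (intro mult_right_mono) auto
    finally show "(\<Sum>j=1..m. real j powr (1 - \<beta>)) \<le> P * real m powr (2 - \<beta>)" .
  qed (rule PD)
  then show ?thesis by blast
qed

section \<open>Covariance inequality for the phi coefficient\<close>

context
  fixes M F :: "'w measure" and Y :: "'w \<Rightarrow> 'y::polish_space"
  assumes prob: "prob_space M" and sub: "subalgebra M F" and Y: "Y \<in> borel_measurable M"
begin

interpretation prob_space M by (rule prob)

interpretation finite_measure_subalgebra M F
  by unfold_locales (rule sub)

text \<open>\<open>real_of_ereal\<close> preserves only finite values, sending infinities to 0, so
  the supremum is first trapped between 0 and 1. An essential supremum is attained as an almost sure
  bound.\<close>

lemma phi_coeff_AE:
  assumes "B \<in> sets borel"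
  shows "AE \<omega> in M. \<bar>real_cond_exp M F (indicator (Y -` B \<inter> space M)) \<omega> - measure (distr M borel Y) B\<bar> \<le> phi_coeff M F Y"
proof -
  define f where "f B \<omega> = ereal \<bar>real_cond_exp M F (indicator (Y -` B \<inter> space M)) \<omega> - measure (distr M borel Y) B\<bar>" for B \<omega>
  have ess: "esssup M (f B) \<le> 1" if B: "B \<in> sets borel" for B
  proof (rule esssup_I)
    have [measurable]: "Y -` B \<inter> space M \<in> sets M" using Y B by (rule measurable_sets)
    show "f B \<in> borel_measurable M" unfolding f_def by measurable
    interpret D: prob_space "distr M borel Y" using Y by (rule prob_space_distr)
    have int: "integrable M (indicator (Y -` B \<inter> space M) :: 'w \<Rightarrow> real)"
      by (rule integrable_const_bound[where B = 1]) auto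
    have "AE \<omega> in M. real_cond_exp M F (indicator (Y -` B \<inter> space M)) \<omega> \<le> 1"
      by (rule real_cond_exp_le_c[OF int]) (auto simp: indicator_def)
    moreover have "AE \<omega> in M. real_cond_exp M F (indicator (Y -` B \<inter> space M)) \<omega> \<ge> 0"
      by (rule real_cond_exp_ge_c[OF int]) (auto simp: indicator_def)
    ultimately show "AE \<omega> in M. f B \<omega> \<le> 1"
    proof eventually_elim
      case (elim \<omega>)
      then have "\<bar>real_cond_exp M F (indicator (Y -` B \<inter> space M)) \<omega> - measure (distr M borel Y) B\<bar> \<le> 1"
        using D.prob_le_1[of B] measure_nonneg[of "distr M borel Y" B] by linarith
      then show ?case unfolding f_def by simp
    qed
  qed
  have nonneg: "0 \<le> esssup M (f B)" if B: "B \<in> sets borel" for B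
  proof -
    have "AE \<omega> in M. 0 \<le> f B \<omega>" unfolding f_def by simp
    with esssup_AE[of "f B" M] have "AE \<omega> in M. 0 \<le> esssup M (f B)"
      by eventually_elim (rule order_trans)
    then show ?thesis by simp
  qed
  let ?S = "SUP B\<in>sets borel. esssup M (f B)"
  have "?S \<le> 1" by (rule SUP_least) (rule ess)
  moreover have le: "esssup M (f B) \<le> ?S" using assms by (rule SUP_upper)
  moreover have "0 \<le> ?S" using nonneg[OF assms] le by (rule order_trans)
  ultimately have S: "ereal (real_of_ereal ?S) = ?S"
    by (intro ereal_real') (auto simp: abs_eq_infinity_cases)
  have phi: "phi_coeff M F Y = real_of_ereal ?S"
    unfolding phi_coeff_def f_def ..
  show ?thesis using esssup_AE[of "f B" M]
  proof eventually_elim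
    case (elim \<omega>)
    then have "f B \<omega> \<le> ereal (real_of_ereal ?S)" unfolding S using le by (rule order_trans)
    then show ?case unfolding phi f_def ereal_less_eq .
  qed
qed

lemma phi_coeff_nonneg: "0 \<le> phi_coeff M F Y"
proof -
  have "AE \<omega> in M. 0 \<le> phi_coeff M F Y"
    using phi_coeff_AE[OF sets.top[of borel, unfolded space_borel]]
    by eventually_elim (rule order_trans[OF abs_ge_zero])
  then show ?thesis by simp
qed

text \<open>\<open>V\<close> is measurable for \<open>F\<close>, so the indicator may be replaced by
  its conditional expectation, which almost surely differs from the probability by at most the
  coefficient.\<close>

lemma phi_coeff_event:
  assumes V: "V \<in> borel_measurable F" "integrable M V" and E: "E \<in> sets (vimage_algebra (space M) Y borel)"
  shows "\<bar>expectation (\<lambda>\<omega>. V \<omega> * indicator E \<omega>) - expectation V * prob E\<bar> \<le> phi_coeff M F Y * expectation (\<lambda>\<omega>. \<bar>V \<omega>\<bar>)"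
proof -
  obtain B where B: "B \<in> sets borel" "E = Y -` B \<inter> space M"
    using E by (auto simp: sets_vimage_algebra2 )
  have [measurable]: "E \<in> sets M" unfolding B(2) using Y B(1) by (rule measurable_sets)
  let ?C = "real_cond_exp M F (indicator E)"
  have [measurable]: "V \<in> borel_measurable M" using V(2) by auto
  have VE: "integrable M (\<lambda>\<omega>. V \<omega> * indicator E \<omega>)"
    by (rule integrable_real_mult_indicator[OF _ V(2)]) simp
  have dist: "measure (distr M borel Y) B = prob E"
    unfolding B(2) using Y B(1) by (simp add: measure_distr)
  have i: "integrable M (\<lambda>\<omega>. V \<omega> * ?C \<omega>)" "expectation (\<lambda>\<omega>. V \<omega> * ?C \<omega>) = expectation (\<lambda>\<omega>. V \<omega> * indicator E \<omega>)"
    by (intro real_cond_exp_intg VE V; simp)+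
  have "expectation (\<lambda>\<omega>. V \<omega> * indicator E \<omega>) - expectation V * prob E = expectation (\<lambda>\<omega>. V \<omega> * ?C \<omega> - V \<omega> * prob E)"
    using i V(2) by simp
  also have "\<dots> = expectation (\<lambda>\<omega>. V \<omega> * (?C \<omega> - prob E))" by (simp add: right_diff_distrib)
  finally have eq: "expectation (\<lambda>\<omega>. V \<omega> * indicator E \<omega>) - expectation V * prob E = expectation (\<lambda>\<omega>. V \<omega> * (?C \<omega> - prob E))" .
  have "AE \<omega> in M. \<bar>V \<omega> * (?C \<omega> - prob E)\<bar> \<le> \<bar>V \<omega>\<bar> * phi_coeff M F Y"
    using phi_coeff_AE[OF B(1)] unfolding B(2)[symmetric] dist
    by eventually_elim (simp add: abs_mult mult_left_mono)
  moreover have "integrable M (\<lambda>\<omega>. V \<omega> * (?C \<omega> - prob E))"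
    using i V(2) by (simp add: right_diff_distrib)
  ultimately have "expectation (\<lambda>\<omega>. \<bar>V \<omega> * (?C \<omega> - prob E)\<bar>) \<le> expectation (\<lambda>\<omega>. \<bar>V \<omega>\<bar> * phi_coeff M F Y)"
    using V(2) by (intro integral_mono_AE) auto
  moreover have "\<bar>expectation (\<lambda>\<omega>. V \<omega> * (?C \<omega> - prob E))\<bar> \<le> expectation (\<lambda>\<omega>. \<bar>V \<omega> * (?C \<omega> - prob E)\<bar>)"
    by (rule integral_abs_bound)
  moreover have "expectation (\<lambda>\<omega>. \<bar>V \<omega>\<bar> * phi_coeff M F Y) = phi_coeff M F Y * expectation (\<lambda>\<omega>. \<bar>V \<omega>\<bar>)"
    by simp
  ultimately show ?thesis unfolding eq by linarith
qed

text \<open>A discrete layer-cake argument: \<open>G\<close> is within \<open>1 / N\<close> of the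
  average of the indicators of its level sets \<open>G \<ge> k / N\<close>, and averaging keeps the
  constant of the event case. The approximation enters once in each expectation of \<open>G\<close>
  and vanishes as \<open>N\<close> grows.\<close>

lemma phi_coeff_unit_interval:
  assumes V: "V \<in> borel_measurable F" "integrable M V"
    and G: "G \<in> borel_measurable (vimage_algebra (space M) Y borel)"
    and G01: "\<And>\<omega>. \<omega> \<in> space M \<Longrightarrow> 0 \<le> G \<omega> \<and> G \<omega> \<le> (1::real)"
  shows "\<bar>expectation (\<lambda>\<omega>. V \<omega> * G \<omega>) - expectation V * expectation G\<bar> \<le> phi_coeff M F Y * expectation (\<lambda>\<omega>. \<bar>V \<omega>\<bar>)"
proof -
  let ?N = "vimage_algebra (space M) Y borel"
  let ?EV = "expectation (\<lambda>\<omega>. \<bar>V \<omega>\<bar>)"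
  let ?\<Delta> = "\<lambda>g. expectation (\<lambda>\<omega>. V \<omega> * g \<omega>) - expectation V * expectation g"
  have sN: "sets ?N \<subseteq> sets M"
    using Y by (auto simp: sets_vimage_algebra2 intro: measurable_sets)
  have GM [measurable]: "G \<in> borel_measurable M"
    using G sN unfolding measurable_def by auto
  have [measurable]: "V \<in> borel_measurable M" using V(2) by auto
  have bound: "\<bar>?\<Delta> G\<bar> \<le> phi_coeff M F Y * ?EV + 2 * ?EV / real N" if N: "1 \<le> N" for N :: nat
  proof -
    define E where "E k = {\<omega> \<in> space M. real k / real N \<le> G \<omega>}" for k
    define g where "g \<omega> = (\<Sum>k=1..N. indicator (E k) \<omega>) / real N" for \<omega>
    have EN: "E k \<in> sets ?N" for k
    proof -
      have "{\<omega> \<in> space ?N. real k / real N \<le> G \<omega>} \<in> sets ?N" using G by measurable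
      then show ?thesis by (simp add: E_def)
    qed
    have EM [measurable]: "E k \<in> sets M" for k using EN sN by auto
    have intE: "integrable M (indicator (E k) :: 'w \<Rightarrow> real)" for k
      by (rule integrable_const_bound[where B = 1]) auto
    have intVE: "integrable M (\<lambda>\<omega>. V \<omega> * indicator (E k) \<omega>)" for k
      by (rule integrable_real_mult_indicator[OF _ V(2)]) simp
    have near: "\<bar>G \<omega> - g \<omega>\<bar> \<le> 1 / real N" if \<omega>: "\<omega> \<in> space M" for \<omega>
    proof -
      define q where "q = nat \<lfloor>G \<omega> * real N\<rfloor>"
      have G: "0 \<le> G \<omega>" "G \<omega> \<le> 1" using G01[OF \<omega>] by auto
      have GN: "0 \<le> G \<omega> * real N" "G \<omega> * real N \<le> real N"
        using G mult_right_mono[of "G \<omega>" 1 "real N"] by auto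
      have q: "real q \<le> G \<omega> * real N" "G \<omega> * real N < real q + 1"
        using GN unfolding q_def by linarith+
      have "q \<le> N" using q(1) GN(2) by linarith
      have "(\<Sum>k=1..N. indicator (E k) \<omega> :: real) = (\<Sum>k=1..N. if k \<le> q then 1 else 0)"
      proof (intro sum.cong refl)
        fix k assume "k \<in> {1..N}"
        have "real k / real N \<le> G \<omega> \<longleftrightarrow> real k \<le> G \<omega> * real N"
          using N by (simp add: pos_divide_le_eq)
        also have "\<dots> \<longleftrightarrow> k \<le> q" using q by linarith
        finally show "indicator (E k) \<omega> = (if k \<le> q then 1 else 0 :: real)"
          using \<omega> by (simp add: E_def indicator_def)
      qed
      also have "\<dots> = real (card ({1..N} \<inter> {k. k \<le> q}))"
        by (simp add: sum.If_cases)
      also have "{1..N} \<inter> {k. k \<le> q} = {1..q}" using \<open>q \<le> N\<close> by auto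
      finally have g: "g \<omega> = real q / real N" by (simp add: g_def)
      have "\<bar>G \<omega> - g \<omega>\<bar> = \<bar>G \<omega> * real N - real q\<bar> / real N"
      proof -
        have "G \<omega> - g \<omega> = (G \<omega> * real N - real q) / real N"
          unfolding g using N by (simp add: diff_divide_distrib)
        then show ?thesis by (simp add: abs_divide)
      qed
      also have "\<dots> \<le> 1 / real N" using q by (intro divide_right_mono) auto
      finally show ?thesis .
    qed
    have Vg: "(\<lambda>\<omega>. V \<omega> * g \<omega>) = (\<lambda>\<omega>. (\<Sum>k=1..N. V \<omega> * indicator (E k) \<omega>) / real N)"
      by (auto simp: g_def sum_distrib_left)
    have intVg: "integrable M (\<lambda>\<omega>. V \<omega> * g \<omega>)"
      unfolding Vg by (intro integrable_divide Bochner_Integration.integrable_sum intVE)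
    have intg: "integrable M g"
      unfolding g_def by (intro integrable_divide Bochner_Integration.integrable_sum intE)
    have "?\<Delta> g = (\<Sum>k=1..N. expectation (\<lambda>\<omega>. V \<omega> * indicator (E k) \<omega>) - expectation V * prob (E k)) / real N"
    proof -
      have "expectation (\<lambda>\<omega>. V \<omega> * g \<omega>) = (\<Sum>k=1..N. expectation (\<lambda>\<omega>. V \<omega> * indicator (E k) \<omega>)) / real N"
        unfolding Vg integral_divide_zero by (simp only: Bochner_Integration.integral_sum[OF intVE])
      moreover have "expectation g = (\<Sum>k=1..N. prob (E k)) / real N"
        unfolding g_def integral_divide_zero
        by (subst Bochner_Integration.integral_sum[OF intE]) simp
      ultimately show ?thesis
        by (simp add: sum_subtractf diff_divide_distrib sum_distrib_left)
    qed
    also have "\<bar>\<dots>\<bar> \<le> (\<Sum>k=1..N. phi_coeff M F Y * ?EV) / real N"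
      unfolding abs_divide abs_of_nat
      by (intro divide_right_mono order_trans[OF sum_abs] sum_mono phi_coeff_event V EN) simp
    also have "\<dots> = phi_coeff M F Y * ?EV" using N by simp
    finally have main: "\<bar>?\<Delta> g\<bar> \<le> phi_coeff M F Y * ?EV" .
    have intVG: "integrable M (\<lambda>\<omega>. V \<omega> * G \<omega>)"
    proof (rule Bochner_Integration.integrable_bound[OF V(2)])
      show "AE \<omega> in M. norm (V \<omega> * G \<omega>) \<le> norm (V \<omega>)"
        using G01 by (intro AE_I2) (simp add: abs_mult mult_left_le)
    qed measurable
    have intG: "integrable M G" using G01 by (intro integrable_const_bound[where B = 1]) auto
    have d1: "\<bar>expectation (\<lambda>\<omega>. V \<omega> * G \<omega>) - expectation (\<lambda>\<omega>. V \<omega> * g \<omega>)\<bar> \<le> ?EV / real N"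
    proof -
      have "\<bar>expectation (\<lambda>\<omega>. V \<omega> * G \<omega> - V \<omega> * g \<omega>)\<bar> \<le> expectation (\<lambda>\<omega>. \<bar>V \<omega>\<bar> / real N)"
      proof (rule abs_integral_le)
        fix \<omega> assume "\<omega> \<in> space M"
        then have "\<bar>V \<omega>\<bar> * \<bar>G \<omega> - g \<omega>\<bar> \<le> \<bar>V \<omega>\<bar> * (1 / real N)" by (intro mult_left_mono near) auto
        then show "\<bar>V \<omega> * G \<omega> - V \<omega> * g \<omega>\<bar> \<le> \<bar>V \<omega>\<bar> / real N"
          by (simp add: abs_mult right_diff_distrib[symmetric])
      qed (use V in simp)
      then show ?thesis using intVG intVg by simp
    qed
    have d2: "\<bar>expectation V * expectation G - expectation V * expectation g\<bar> \<le> ?EV / real N"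
    proof -
      have "\<bar>expectation (\<lambda>\<omega>. G \<omega> - g \<omega>)\<bar> \<le> expectation (\<lambda>\<omega>. 1 / real N)"
        by (rule abs_integral_le) (auto intro: near)
      then have "\<bar>expectation G - expectation g\<bar> \<le> 1 / real N"
        using intG intg by (simp add: prob_space)
      then have "\<bar>expectation V\<bar> * \<bar>expectation G - expectation g\<bar> \<le> ?EV * (1 / real N)"
        by (intro mult_mono integral_abs_bound) auto
      then show ?thesis by (simp add: abs_mult right_diff_distrib[symmetric])
    qed
    show ?thesis using main d1 d2 by (simp add: abs_le_iff)
  qed
  have "(\<lambda>N. phi_coeff M F Y * ?EV + 2 * ?EV / real N) \<longlonglongrightarrow> phi_coeff M F Y * ?EV + 0"
    by (intro tendsto_add tendsto_const lim_const_over_n)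
  then have "(\<lambda>N. phi_coeff M F Y * ?EV + 2 * ?EV / real N) \<longlonglongrightarrow> phi_coeff M F Y * ?EV" by simp
  then show ?thesis
    by (rule Lim_bounded2[of _ _ 1]) (use bound in auto)
qed

text \<open>The affine map from \<open>[-C, C]\<close> onto the unit interval has slope
  \<open>1 / (2 * C)\<close>, and covariances ignore its constant part.\<close>

lemma phi_coeff_covariance:
  assumes V: "V \<in> borel_measurable F" "integrable M V"
    and G: "G \<in> borel_measurable (vimage_algebra (space M) Y borel)"
    and C: "0 < C" and GC: "\<And>\<omega>. \<omega> \<in> space M \<Longrightarrow> \<bar>G \<omega>\<bar> \<le> (C::real)"
  shows "\<bar>expectation (\<lambda>\<omega>. V \<omega> * G \<omega>) - expectation V * expectation G\<bar> \<le> 2 * C * phi_coeff M F Y * expectation (\<lambda>\<omega>. \<bar>V \<omega>\<bar>)"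
proof -
  define g where "g \<omega> = (G \<omega> + C) / (2 * C)" for \<omega>
  have gm: "g \<in> borel_measurable (vimage_algebra (space M) Y borel)" unfolding g_def using G by measurable
  have g01: "0 \<le> g \<omega> \<and> g \<omega> \<le> 1" if "\<omega> \<in> space M" for \<omega>
    using GC[OF that] C by (auto simp: g_def abs_le_iff)
  have sN: "sets (vimage_algebra (space M) Y borel) \<subseteq> sets M"
    using Y by (auto simp: sets_vimage_algebra2 intro: measurable_sets)
  have [measurable]: "g \<in> borel_measurable M" using gm sN unfolding measurable_def by auto
  have [measurable]: "V \<in> borel_measurable M" using V(2) by auto
  have intg: "integrable M g" using g01 by (intro integrable_const_bound[where B = 1]) auto
  have intVg: "integrable M (\<lambda>\<omega>. V \<omega> * g \<omega>)"
  proof (rule Bochner_Integration.integrable_bound[OF V(2)])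
    show "AE \<omega> in M. norm (V \<omega> * g \<omega>) \<le> norm (V \<omega>)"
      using g01 by (intro AE_I2) (simp add: abs_mult mult_left_le)
  qed measurable
  have G_eq: "G = (\<lambda>\<omega>. 2 * C * g \<omega> - C)" using C by (auto simp: g_def)
  have "(\<lambda>\<omega>. V \<omega> * G \<omega>) = (\<lambda>\<omega>. 2 * C * (V \<omega> * g \<omega>) - C * V \<omega>)" by (auto simp: G_eq algebra_simps)
  then have e1: "expectation (\<lambda>\<omega>. V \<omega> * G \<omega>) = 2 * C * expectation (\<lambda>\<omega>. V \<omega> * g \<omega>) - C * expectation V"
    using intVg V(2) by simp
  have e2: "expectation G = 2 * C * expectation g - C" unfolding G_eq using intg by (simp add: prob_space)
  have "expectation (\<lambda>\<omega>. V \<omega> * G \<omega>) - expectation V * expectation G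
     = 2 * C * (expectation (\<lambda>\<omega>. V \<omega> * g \<omega>) - expectation V * expectation g)"
    unfolding e1 e2 by (simp add: algebra_simps)
  then have "\<bar>expectation (\<lambda>\<omega>. V \<omega> * G \<omega>) - expectation V * expectation G\<bar>
     = 2 * C * \<bar>expectation (\<lambda>\<omega>. V \<omega> * g \<omega>) - expectation V * expectation g\<bar>"
    using C by (simp add: abs_mult)
  also have "\<dots> \<le> 2 * C * (phi_coeff M F Y * expectation (\<lambda>\<omega>. \<bar>V \<omega>\<bar>))"
    using C by (intro mult_left_mono phi_coeff_unit_interval V gm g01) auto
  finally show ?thesis by simp
qed

end

section \<open>Functionals of a stationary process\<close>

locale stationary_process = prob_space M for M :: "'w measure" +
  fixes T :: "'w \<Rightarrow> 'w" and A :: "'x::polish_space set" and e :: "int \<Rightarrow> 'w \<Rightarrow> 'x"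
  assumes T: "bimeasurable_mp M T"
    and e0: "e 0 \<in> measurable M (restrict_space borel A)"
    and e: "\<And>i \<omega>. \<omega> \<in> space M \<Longrightarrow> e i \<omega> = e 0 (int_iterate M T i \<omega>)"
begin

abbreviation "T' \<equiv> the_inv_into (space M) T"
abbreviation "\<tau> \<equiv> int_iterate M T"

lemma bij: "bij_betw T (space M) (space M)"
  and T_measurable [measurable]: "T \<in> measurable M M"
  and T'_measurable [measurable]: "T' \<in> measurable M M"
  and distr_T: "distr M M T = M"
  using T by (auto simp: bimeasurable_mp_def)

lemma T_space: "\<omega> \<in> space M \<Longrightarrow> T \<omega> \<in> space M" and T'_space: "\<omega> \<in> space M \<Longrightarrow> T' \<omega> \<in> space M"
  using measurable_space[OF T_measurable] measurable_space[OF T'_measurable] by auto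

lemma T'_T: "\<omega> \<in> space M \<Longrightarrow> T' (T \<omega>) = \<omega>" and T_T': "\<omega> \<in> space M \<Longrightarrow> T (T' \<omega>) = \<omega>"
  using bij by (auto simp: bij_betw_def the_inv_into_f_f f_the_inv_into_f)

lemma distr_T': "distr M M T' = M"
proof -
  have "distr M M T' = distr (distr M M T) M T'" by (simp add: distr_T)
  also have "\<dots> = distr M M (T' \<circ> T)" by (simp add: distr_distr)
  also have "\<dots> = distr M M (\<lambda>\<omega>. \<omega>)" by (rule distr_cong) (auto simp: T'_T)
  finally show ?thesis by simp
qed

lemma funpow_measure_preserving:
  assumes "f \<in> measurable M M" "distr M M f = M"
  shows "f ^^ n \<in> measurable M M \<and> distr M M (f ^^ n) = M"
proof (induction n)
  case 0
  show ?case by (simp add: id_def)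
next
  case (Suc n)
  have "distr (distr M M (f ^^ n)) M f = distr M M (f \<circ> f ^^ n)"
    using Suc assms by (intro distr_distr) auto
  then have "distr M M (f \<circ> f ^^ n) = M" using Suc assms by simp
  moreover have "f \<circ> f ^^ n \<in> measurable M M" using Suc assms by (intro measurable_comp) auto
  ultimately show ?case by (simp only: funpow.simps simp_thms)
qed

lemma \<tau>_measurable [measurable]: "\<tau> k \<in> measurable M M"
  and distr_\<tau>: "distr M M (\<tau> k) = M"
  using funpow_measure_preserving[OF T_measurable distr_T] funpow_measure_preserving[OF T'_measurable distr_T']
  by (auto simp: int_iterate_def)

lemma \<tau>_space: "\<omega> \<in> space M \<Longrightarrow> \<tau> k \<omega> \<in> space M"
  by (rule measurable_space[OF \<tau>_measurable])

lemma \<tau>_step: assumes "\<omega> \<in> space M" shows "\<tau> k (T \<omega>) = \<tau> (k + 1) \<omega>"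
proof (cases "0 \<le> k")
  case True
  then have "nat (k + 1) = Suc (nat k)" by simp
  then show ?thesis using True by (simp add: int_iterate_def funpow_swap1)
next
  case False
  then obtain n where n: "nat (- k) = Suc n" by (cases "nat (- k)") auto
  then have k: "k = - int (Suc n)" using False by simp
  have "\<tau> k (T \<omega>) = (T' ^^ Suc n) (T \<omega>)" using False n by (simp add: int_iterate_def)
  also have "\<dots> = (T' ^^ n) \<omega>" by (simp add: funpow_swap1 T'_T[OF assms])
  also have "\<dots> = \<tau> (k + 1) \<omega>"

  \<comment> \<open>For \<open>n = 0\<close> the index \<open>k + 1\<close> is 0, where
    \<open>int_iterate\<close> changes from the inverse to \<open>T\<close>.\<close>
  proof (cases n)
    case (Suc j)
    have "\<not> 0 \<le> k + 1" "nat (- (k + 1)) = n" using Suc k by linarith+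
    then show ?thesis by (simp only: int_iterate_def if_False)
  qed (simp add: int_iterate_def k)
  finally show ?thesis .
qed

lemma \<tau>_add: "\<omega> \<in> space M \<Longrightarrow> \<tau> i (\<tau> k \<omega>) = \<tau> (i + k) \<omega>"
proof (induction k arbitrary: \<omega> rule: int_induct[where k = 0])
  case base
  then show ?case by (simp add: int_iterate_def)
next
  case (step1 k)
  have "\<tau> i (\<tau> (k + 1) \<omega>) = \<tau> i (\<tau> k (T \<omega>))" using step1.prems by (simp add: \<tau>_step)
  also have "\<dots> = \<tau> (i + k) (T \<omega>)" using step1.prems by (intro step1.IH T_space)
  finally show ?case using step1.prems by (simp add: \<tau>_step add.assoc)
next
  case (step2 k)
  have t: "\<tau> (j - 1) \<omega> = \<tau> j (T' \<omega>)" for j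
    using \<tau>_step[OF T'_space[OF step2.prems], of "j - 1"] by (simp add: T_T'[OF step2.prems])
  have "\<tau> i (\<tau> (k - 1) \<omega>) = \<tau> i (\<tau> k (T' \<omega>))" by (simp add: t)
  also have "\<dots> = \<tau> (i + k) (T' \<omega>)" using step2.prems by (intro step2.IH T'_space)
  finally show ?case using t[of "i + k"] by (simp add: algebra_simps)
qed

lemma e_shift: "\<omega> \<in> space M \<Longrightarrow> e i (\<tau> k \<omega>) = e (i + k) \<omega>"
  using e[of "\<tau> k \<omega>" i] e[of \<omega> "i + k"] by (simp add: \<tau>_space \<tau>_add)

lemma e_measurable_A: "e i \<in> measurable M (restrict_space borel A)"
proof -
  have "(\<lambda>\<omega>. e 0 (\<tau> i \<omega>)) \<in> measurable M (restrict_space borel A)"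
    using \<tau>_measurable e0 by (rule measurable_compose)
  then show ?thesis using e by (simp cong: measurable_cong)
qed

lemma e_in_A: "\<omega> \<in> space M \<Longrightarrow> e i \<omega> \<in> A"
  using measurable_space[OF e_measurable_A] by (simp add: space_restrict_space)

lemma e_measurable [measurable]: "e i \<in> borel_measurable M"
  using e_measurable_A by (simp add: measurable_restrict_space2_iff)

section \<open>Stationarity, past and future sigma-fields\<close>

lemma integral_shift:
  fixes f :: "'w \<Rightarrow> real"
  assumes "f \<in> borel_measurable M"
  shows "(\<integral>\<omega>. f (\<tau> k \<omega>) \<partial>M) = (\<integral>\<omega>. f \<omega> \<partial>M)"
  using integral_distr[OF \<tau>_measurable assms, of k] by (simp add: distr_\<tau>)

lemma integrable_shift:
  fixes f :: "'w \<Rightarrow> real"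
  assumes "integrable M f"
  shows "integrable M (\<lambda>\<omega>. f (\<tau> k \<omega>))"
  using assms integrable_distr[OF \<tau>_measurable, of k f] by (simp add: distr_\<tau>)

text \<open>Written as the time-0 past of a translated process, so that \<open>past 0\<close> is the
  algebra in the definition of \<open>phi_mix\<close>.\<close>

definition past :: "int \<Rightarrow> 'w measure" where
  "past a = past_algebra M (\<lambda>i. e (i + a))"

lemma space_past [simp]: "space (past a) = space M"
  by (simp add: past_def past_algebra_def space_measure_of_conv)

lemma sets_past: "sets (past a) = sigma_sets (space M) {e i -` B \<inter> space M | i B. i \<le> a \<and> B \<in> sets borel}"
proof -
  have "{e (i + a) -` B \<inter> space M | i B. i \<le> 0 \<and> B \<in> sets borel}
     = {e i -` B \<inter> space M | i B. i \<le> a \<and> B \<in> sets borel}"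
  proof (intro set_eqI iffI)
    fix E assume "E \<in> {e i -` B \<inter> space M | i B. i \<le> a \<and> B \<in> sets borel}"
    then obtain i B where "E = e ((i - a) + a) -` B \<inter> space M" "i - a \<le> 0" "B \<in> sets borel" by auto
    then show "E \<in> {e (i + a) -` B \<inter> space M | i B. i \<le> 0 \<and> B \<in> sets borel}" by blast
  next
    fix E assume "E \<in> {e (i + a) -` B \<inter> space M | i B. i \<le> 0 \<and> B \<in> sets borel}"
    then obtain i B where "E = e (i + a) -` B \<inter> space M" "i + a \<le> a" "B \<in> sets borel" by auto
    then show "E \<in> {e i -` B \<inter> space M | i B. i \<le> a \<and> B \<in> sets borel}" by blast
  qed
  then show ?thesis
    unfolding past_def past_algebra_def by (subst sets_measure_of) auto
qed

lemma past_mono: "a \<le> b \<Longrightarrow> subalgebra (past b) (past a)"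
  unfolding subalgebra_def sets_past by (intro conjI sigma_sets_mono') (force, force)

lemma past_subalgebra: "subalgebra M (past a)"
  unfolding subalgebra_def sets_past
  by (auto intro!: sets.sigma_sets_subset intro: measurable_sets)

lemma e_past: "i \<le> a \<Longrightarrow> e i \<in> borel_measurable (past a)"
  by (rule measurableI) (auto simp: sets_past)

lemma e_measurable_A_of:
  assumes "space N = space M" "e i \<in> borel_measurable N"
  shows "e i \<in> measurable N (restrict_space borel A)"
  using assms e_in_A by (auto simp: measurable_restrict_space2_iff)

text \<open>Mixing coefficients refer to the past at time 0; composing with
  \<open>\<tau> (- a)\<close> brings a variable known at time \<open>a\<close> there.\<close>

lemma shift_past:
  assumes "V \<in> borel_measurable (past a)"
  shows "(\<lambda>\<omega>. V (\<tau> (- a) \<omega>)) \<in> borel_measurable (past 0)"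
proof -
  have "\<tau> (- a) \<in> measurable (past 0) (past a)"
  proof (rule measurable_sigma_sets[OF sets_past])
    show "{e i -` B \<inter> space M | i B. i \<le> a \<and> B \<in> sets borel} \<subseteq> Pow (space M)" by auto
    show "\<tau> (- a) \<in> space (past 0) \<rightarrow> space M" by (auto simp: \<tau>_space)
    fix E assume "E \<in> {e i -` B \<inter> space M | i B. i \<le> a \<and> B \<in> sets borel}"
    then obtain i B where E: "E = e i -` B \<inter> space M" "i \<le> a" "B \<in> sets borel" by auto
    have "\<tau> (- a) -` E \<inter> space (past 0) = e (i - a) -` B \<inter> space (past 0)"
      unfolding E using e_shift[of _ i "- a"] \<tau>_space by auto
    also have "\<dots> \<in> sets (past 0)" using E by (intro measurable_sets[OF e_past]) auto
    finally show "\<tau> (- a) -` E \<inter> space (past 0) \<in> sets (past 0)" .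
  qed
  then show ?thesis using assms by (rule measurable_compose)
qed

definition future :: "nat \<Rightarrow> 'w \<Rightarrow> nat \<Rightarrow> 'x" where
  "future n \<omega> = (\<lambda>j. e (int n + int j) \<omega>)"

text \<open>On a countable product of Polish spaces the product sigma-field is the Borel one, so
  measurability can be checked by coordinates.\<close>

lemma future_measurable: "future n \<in> borel_measurable M"
proof -
  have "future n \<in> measurable M (Pi\<^sub>M UNIV (\<lambda>_. borel))"
    unfolding future_def by (rule measurable_PiM_single') auto
  then show ?thesis
    by (simp only: measurable_cong_sets[OF refl sets_PiM_equal_borel])
qed

lemma e_future:
  assumes "int n \<le> i"
  shows "e i \<in> borel_measurable (vimage_algebra (space M) (future n) borel)"
proof -
  have "(\<lambda>f :: nat \<Rightarrow> 'x. f (nat (i - int n))) \<in> borel_measurable (Pi\<^sub>M UNIV (\<lambda>_. borel))"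
    by (rule measurable_component_singleton) simp
  then have "(\<lambda>f :: nat \<Rightarrow> 'x. f (nat (i - int n))) \<in> borel_measurable borel"
    by (simp only: measurable_cong_sets[OF sets_PiM_equal_borel refl])
  then have "(\<lambda>\<omega>. future n \<omega> (nat (i - int n))) \<in> borel_measurable (vimage_algebra (space M) (future n) borel)"
    by (rule measurable_compose[OF measurable_vimage_algebra1, rotated]) auto
  then show ?thesis using assms by (simp add: future_def)
qed

lemma phi_mix_eq: "phi_mix M e n = phi_coeff M (past 0) (future n)"
  by (simp add: phi_mix_def past_def future_def[abs_def])

lemma phi_mix_nonneg: "0 \<le> phi_mix M e n"
  unfolding phi_mix_eq by (rule phi_coeff_nonneg[OF prob_space_axioms past_subalgebra future_measurable])

text \<open>\<open>Z\<close> may depend on the whole past, so the covariance inequality is applied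
  to an approximation \<open>G\<close> known from the future at \<open>n\<close>. The exchange costs
  \<delta> in the mixed expectation and \<delta> in the mean.\<close>

lemma phi_mix_approx:
  fixes V Z G :: "'w \<Rightarrow> real"
  assumes V: "V \<in> borel_measurable (past 0)" "integrable M V"
    and G: "G \<in> borel_measurable (vimage_algebra (space M) (future n) borel)"
    and C: "0 < C" "\<And>\<omega>. \<omega> \<in> space M \<Longrightarrow> \<bar>G \<omega>\<bar> \<le> C"
    and Z: "Z \<in> borel_measurable M" "\<And>\<omega>. \<omega> \<in> space M \<Longrightarrow> \<bar>Z \<omega> - G \<omega>\<bar> \<le> \<delta>"
  shows "\<bar>expectation (\<lambda>\<omega>. V \<omega> * (Z \<omega> - expectation Z))\<bar>
    \<le> (2 * C * phi_mix M e n + 2 * \<delta>) * expectation (\<lambda>\<omega>. \<bar>V \<omega>\<bar>)"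
proof -
  let ?EV = "expectation (\<lambda>\<omega>. \<bar>V \<omega>\<bar>)"
  have sN: "sets (vimage_algebra (space M) (future n) borel) \<subseteq> sets M"
    using future_measurable[of n] by (auto simp: sets_vimage_algebra2 intro: measurable_sets)
  have [measurable]: "G \<in> borel_measurable M" using G sN unfolding measurable_def by auto
  note [measurable] = Z(1)
  have [measurable]: "V \<in> borel_measurable M" using V(2) by auto
  have Zb: "\<bar>Z \<omega>\<bar> \<le> C + \<delta>" if "\<omega> \<in> space M" for \<omega>
    using C(2)[OF that] Z(2)[OF that] by linarith
  have int: "integrable M G" "integrable M Z"
    using integrable_const_bound[of G C] integrable_const_bound[of Z "C + \<delta>"] C Zb by auto
  have intV: "integrable M (\<lambda>\<omega>. V \<omega> * f \<omega>)"
    if "f \<in> borel_measurable M" "\<And>\<omega>. \<omega> \<in> space M \<Longrightarrow> \<bar>f \<omega>\<bar> \<le> B" for f and B :: real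
  proof (rule Bochner_Integration.integrable_bound)
    show "integrable M (\<lambda>\<omega>. B * V \<omega>)" using V by simp
    show "AE \<omega> in M. norm (V \<omega> * f \<omega>) \<le> norm (B * V \<omega>)"
    proof (rule AE_I2)
      fix \<omega> assume "\<omega> \<in> space M"
      then have "\<bar>f \<omega>\<bar> \<le> \<bar>B\<bar>" using that(2)[of \<omega>] by linarith
      then show "norm (V \<omega> * f \<omega>) \<le> norm (B * V \<omega>)"
        using mult_left_mono[of "\<bar>f \<omega>\<bar>" "\<bar>B\<bar>" "\<bar>V \<omega>\<bar>"] by (simp add: abs_mult mult.commute)
    qed
  qed (use that in measurable)
  have iVG: "integrable M (\<lambda>\<omega>. V \<omega> * G \<omega>)" and iVZ: "integrable M (\<lambda>\<omega>. V \<omega> * Z \<omega>)"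
    using intV[of G C] intV[of Z "C + \<delta>"] C Zb by auto
  have main: "\<bar>expectation (\<lambda>\<omega>. V \<omega> * G \<omega>) - expectation V * expectation G\<bar> \<le> 2 * C * phi_mix M e n * ?EV"
    unfolding phi_mix_eq
    by (rule phi_coeff_covariance[OF prob_space_axioms past_subalgebra future_measurable V G C])
  have d1: "\<bar>expectation (\<lambda>\<omega>. V \<omega> * Z \<omega>) - expectation (\<lambda>\<omega>. V \<omega> * G \<omega>)\<bar> \<le> \<delta> * ?EV"
  proof -
    have "\<bar>expectation (\<lambda>\<omega>. V \<omega> * Z \<omega> - V \<omega> * G \<omega>)\<bar> \<le> expectation (\<lambda>\<omega>. \<delta> * \<bar>V \<omega>\<bar>)"
    proof (rule abs_integral_le)
      fix \<omega> assume "\<omega> \<in> space M"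
      then have "\<bar>V \<omega>\<bar> * \<bar>Z \<omega> - G \<omega>\<bar> \<le> \<bar>V \<omega>\<bar> * \<delta>" by (intro mult_left_mono Z) auto
      then show "\<bar>V \<omega> * Z \<omega> - V \<omega> * G \<omega>\<bar> \<le> \<delta> * \<bar>V \<omega>\<bar>"
        unfolding right_diff_distrib[symmetric] abs_mult by (simp only: mult.commute)
    qed (use V in simp)
    then show ?thesis using iVG iVZ by simp
  qed
  have d2: "\<bar>expectation V * expectation Z - expectation V * expectation G\<bar> \<le> \<delta> * ?EV"
  proof -
    have "\<bar>expectation (\<lambda>\<omega>. Z \<omega> - G \<omega>)\<bar> \<le> expectation (\<lambda>\<omega>. \<delta>)"
      by (rule abs_integral_le) (auto intro: Z)
    then have "\<bar>expectation Z - expectation G\<bar> \<le> \<delta>"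
      using int by (simp add: prob_space)
    then have "\<bar>expectation V\<bar> * \<bar>expectation Z - expectation G\<bar> \<le> ?EV * \<delta>"
      by (intro mult_mono integral_abs_bound) auto
    then show ?thesis unfolding right_diff_distrib[symmetric] abs_mult by (simp only: mult.commute)
  qed
  have "expectation (\<lambda>\<omega>. V \<omega> * (Z \<omega> - expectation Z)) = expectation (\<lambda>\<omega>. V \<omega> * Z \<omega>) - expectation V * expectation Z"
    using iVZ V by (simp add: right_diff_distrib)
  then show ?thesis using main d1 d2 unfolding distrib_right by linarith
qed

end

section \<open>Causal functionals and their approximation with finite memory\<close>

locale causal_process = stationary_process M T A e
  for M :: "'w measure" and T :: "'w \<Rightarrow> 'w" and A :: "'x::polish_space set" and e :: "int \<Rightarrow> 'w \<Rightarrow> 'x" +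
  fixes H :: "(nat \<Rightarrow> 'x) \<Rightarrow> real" and X :: "int \<Rightarrow> 'w \<Rightarrow> real" and R :: "nat \<Rightarrow> real"
  assumes H: "H \<in> borel_measurable (PiM UNIV (\<lambda>_::nat. restrict_space borel A))"
    and X: "\<And>k \<omega>. \<omega> \<in> space M \<Longrightarrow>
              X k \<omega> = H (\<lambda>i. e (k - int i) \<omega>) - (\<integral>\<omega>'. H (\<lambda>i. e (k - int i) \<omega>') \<partial>M)"
    and HR: "\<And>i x y. (\<forall>j. x j \<in> A) \<Longrightarrow> (\<forall>j. y j \<in> A) \<Longrightarrow> \<bar>H x - H (splice_at i x y)\<bar> \<le> R i"
    and R: "decseq R" "R \<longlonglongrightarrow> 0"
begin

lemma R_nonneg: "0 \<le> R n"
  using decseq_ge[OF R] .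

text \<open>Splicing at index 0 discards \<open>x\<close> altogether, so \<open>R 0\<close> bounds
  the full oscillation of \<open>H\<close>.\<close>

lemma H_oscillation:
  assumes "\<forall>j. x j \<in> A" "\<forall>j. y j \<in> A" shows "\<bar>H x - H y\<bar> \<le> R 0"
proof -
  have "splice_at 0 x y = y" by (simp add: splice_at_def)
  then show ?thesis using HR[OF assms, of 0] by simp
qed

definition reversed :: "int \<Rightarrow> 'w \<Rightarrow> nat \<Rightarrow> 'x" where
  "reversed k \<omega> = (\<lambda>i. e (k - int i) \<omega>)"

lemma reversed_in_A: "\<omega> \<in> space M \<Longrightarrow> \<forall>j. reversed k \<omega> j \<in> A"
  by (simp add: reversed_def e_in_A)

lemma H_reversed_measurable:
  assumes "space N = space M" "\<And>i. i \<le> k \<Longrightarrow> e i \<in> borel_measurable N"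
  shows "(\<lambda>\<omega>. H (reversed k \<omega>)) \<in> borel_measurable N"
  unfolding reversed_def
  by (rule measurable_compose[OF _ H], rule measurable_PiM_single')
     (use assms in \<open>auto intro!: e_measurable_A_of simp: space_restrict_space e_in_A\<close>)

lemma H_reversed_shift: "\<omega> \<in> space M \<Longrightarrow> H (reversed k (\<tau> j \<omega>)) = H (reversed (k + j) \<omega>)"
  by (simp add: reversed_def e_shift algebra_simps)

definition \<mu> :: real where
  "\<mu> = expectation (\<lambda>\<omega>. H (reversed 0 \<omega>))"

lemma expectation_H: "expectation (\<lambda>\<omega>. H (reversed k \<omega>)) = \<mu>"
proof -
  have "expectation (\<lambda>\<omega>. H (reversed 0 (\<tau> k \<omega>))) = expectation (\<lambda>\<omega>. H (reversed 0 \<omega>))"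
    by (rule integral_shift[OF H_reversed_measurable]) auto
  moreover have "expectation (\<lambda>\<omega>. H (reversed 0 (\<tau> k \<omega>))) = expectation (\<lambda>\<omega>. H (reversed k \<omega>))"
    by (rule Bochner_Integration.integral_cong) (auto simp: H_reversed_shift)
  ultimately show ?thesis by (simp add: \<mu>_def)
qed

lemma X_eq: "\<omega> \<in> space M \<Longrightarrow> X k \<omega> = H (reversed k \<omega>) - \<mu>"
  using X[of \<omega> k] expectation_H[of k] by (simp add: reversed_def)

lemma X_measurable_of:
  assumes "space N = space M" "\<And>i. i \<le> k \<Longrightarrow> e i \<in> borel_measurable N"
  shows "X k \<in> borel_measurable N"
proof -
  have "(\<lambda>\<omega>. H (reversed k \<omega>) - \<mu>) \<in> borel_measurable N"
    using H_reversed_measurable[OF assms] by simp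
  moreover have "X k \<omega> = H (reversed k \<omega>) - \<mu>" if "\<omega> \<in> space N" for \<omega>
    using that assms(1) by (simp add: X_eq)
  ultimately show ?thesis by (subst measurable_cong) auto
qed

lemma X_shift: "\<omega> \<in> space M \<Longrightarrow> X k (\<tau> j \<omega>) = X (k + j) \<omega>"
  by (simp add: X_eq \<tau>_space H_reversed_shift)

lemma H_integrable: "integrable M (\<lambda>\<omega>. H (reversed k \<omega>))"
proof -
  obtain \<omega>0 where \<omega>0: "\<omega>0 \<in> space M" using not_empty by blast
  have "\<bar>H (reversed k \<omega>)\<bar> \<le> \<bar>H (reversed k \<omega>0)\<bar> + R 0" if "\<omega> \<in> space M" for \<omega>
    using H_oscillation[OF reversed_in_A[OF that] reversed_in_A[OF \<omega>0], of k k] by linarith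
  then show ?thesis
    by (intro integrable_const_bound[where B = "\<bar>H (reversed k \<omega>0)\<bar> + R 0"] AE_I2)
       (auto intro!: H_reversed_measurable)
qed

text \<open>\<mu> is an average of values of \<open>H\<close> on sequences in \<open>A\<close>, all
  within \<open>R 0\<close> of \<open>H z\<close>.\<close>

lemma H_minus_\<mu>_bound:
  assumes "\<forall>j. z j \<in> A" shows "\<bar>H z - \<mu>\<bar> \<le> R 0"
proof -
  have "H z - \<mu> = expectation (\<lambda>\<omega>. H z - H (reversed 0 \<omega>))"
    using H_integrable[of 0] by (simp add: \<mu>_def prob_space)
  also have "\<dots> \<le> expectation (\<lambda>\<omega>. R 0)"
    using H_integrable[of 0] H_oscillation[OF assms reversed_in_A, of _ 0]
    by (intro integral_mono) (auto simp: abs_le_iff)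
  finally have 1: "H z - \<mu> \<le> R 0" by (simp add: prob_space)
  have "\<mu> - H z = expectation (\<lambda>\<omega>. H (reversed 0 \<omega>) - H z)"
    using H_integrable[of 0] by (simp add: \<mu>_def prob_space)
  also have "\<dots> \<le> expectation (\<lambda>\<omega>. R 0)"
    using H_integrable[of 0] H_oscillation[OF assms reversed_in_A, of _ 0]
    by (intro integral_mono) (auto simp: abs_le_iff)
  finally show ?thesis using 1 by (simp add: prob_space abs_le_iff)
qed

lemma X_bound: "\<omega> \<in> space M \<Longrightarrow> \<bar>X k \<omega>\<bar> \<le> R 0"
  using H_minus_\<mu>_bound[OF reversed_in_A] by (simp add: X_eq)

lemma expectation_X: "expectation (X k) = 0"
proof -
  have "expectation (X k) = expectation (\<lambda>\<omega>. H (reversed k \<omega>) - \<mu>)"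
    by (rule Bochner_Integration.integral_cong) (auto simp: X_eq)
  then show ?thesis using H_integrable[of k] by (simp add: expectation_H prob_space)
qed

lemma X_borel [measurable]: "X k \<in> borel_measurable M"
  by (rule X_measurable_of) auto

lemma covariance_shift: "expectation (\<lambda>\<omega>. X i \<omega> * X (i + j) \<omega>) = expectation (\<lambda>\<omega>. X 0 \<omega> * X j \<omega>)"
proof -
  have "expectation (\<lambda>\<omega>. X 0 (\<tau> i \<omega>) * X j (\<tau> i \<omega>)) = expectation (\<lambda>\<omega>. X 0 \<omega> * X j \<omega>)"
    by (rule integral_shift) measurable
  moreover have "expectation (\<lambda>\<omega>. X 0 (\<tau> i \<omega>) * X j (\<tau> i \<omega>)) = expectation (\<lambda>\<omega>. X i \<omega> * X (i + j) \<omega>)"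
    by (rule Bochner_Integration.integral_cong) (auto simp: X_shift add.commute)
  ultimately show ?thesis by simp
qed

definition base_point :: 'x where
  "base_point = e 0 (SOME \<omega>. \<omega> \<in> space M)"

lemma base_point_in_A: "base_point \<in> A"
proof -
  have "\<exists>\<omega>. \<omega> \<in> space M" using not_empty by blast
  then show ?thesis unfolding base_point_def by (intro e_in_A) (rule someI_ex)
qed

text \<open>All but the latest \<open>r\<close> coordinates are frozen at a point of
  \<open>A\<close>, so the variable involves only times after \<open>k - r\<close>. Subtracting the
  original mean \<mu> makes its distance to \<open>X k\<close> at most \<open>R r\<close>.\<close>

definition truncated :: "int \<Rightarrow> nat \<Rightarrow> 'w \<Rightarrow> real" where
  "truncated k r \<omega> = H (splice_at r (reversed k \<omega>) (\<lambda>_. base_point)) - \<mu>"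

lemma truncated_bound: "\<omega> \<in> space M \<Longrightarrow> \<bar>truncated k r \<omega>\<bar> \<le> R 0"
  unfolding truncated_def
  by (rule H_minus_\<mu>_bound) (auto simp: splice_at_def base_point_in_A reversed_in_A)

lemma truncated_error: "\<omega> \<in> space M \<Longrightarrow> \<bar>X k \<omega> - truncated k r \<omega>\<bar> \<le> R r"
  unfolding truncated_def X_eq using HR[OF reversed_in_A, of \<omega> "\<lambda>_. base_point" k r]
  by (simp add: base_point_in_A)

lemma truncated_future:
  assumes "\<And>j. j < r \<Longrightarrow> int n \<le> k - int j"
  shows "truncated k r \<in> borel_measurable (vimage_algebra (space M) (future n) borel)"
proof -
  let ?N = "vimage_algebra (space M) (future n) borel"
  have "(\<lambda>\<omega>. splice_at r (reversed k \<omega>) (\<lambda>_. base_point)) \<in> measurable ?N (PiM UNIV (\<lambda>_::nat. restrict_space borel A))"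
  proof (rule measurable_PiM_single')
    fix j :: nat
    show "(\<lambda>\<omega>. splice_at r (reversed k \<omega>) (\<lambda>_. base_point) j) \<in> measurable ?N (restrict_space borel A)"
    proof (cases "j < r")
      case True
      then show ?thesis
        using assms[OF True] e_future[of n "k - int j"]
        by (simp add: splice_at_def reversed_def e_measurable_A_of)
    qed (simp add: splice_at_def space_restrict_space base_point_in_A)
  qed (auto simp: splice_at_def space_restrict_space base_point_in_A reversed_in_A)
  from measurable_compose[OF this H] show ?thesis
    unfolding truncated_def by (intro borel_measurable_diff) simp_all
qed

definition K :: real where "K = max 1 (R 0)"

lemma K_bounds: "1 \<le> K" "R 0 \<le> K" "K \<le> K\<^sup>2"
proof -
  show "1 \<le> K" by (simp add: K_def)
  then show "K \<le> K\<^sup>2" using self_le_power[of K 2] by simp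
qed (simp add: K_def)

text \<open>Invariance under \<open>\<tau> (- a)\<close> turns a past at time \<open>a\<close> into
  one at time 0, where \<open>bound\<close> holds for every past variable.\<close>

lemma shift_expectation:
  fixes V Z :: "'w \<Rightarrow> real"
  assumes V: "V \<in> borel_measurable (past a)" "integrable M V"
    and Z: "Z \<in> borel_measurable M"
    and bound: "\<And>V. V \<in> borel_measurable (past 0) \<Longrightarrow> integrable M V \<Longrightarrow>
        \<bar>expectation (\<lambda>\<omega>. V \<omega> * Z \<omega>)\<bar> \<le> b * expectation (\<lambda>\<omega>. \<bar>V \<omega>\<bar>)"
    and Z': "\<And>\<omega>. \<omega> \<in> space M \<Longrightarrow> Z' (\<tau> (- a) \<omega>) = Z \<omega>" "Z' \<in> borel_measurable M"
  shows "\<bar>expectation (\<lambda>\<omega>. V \<omega> * Z' \<omega>)\<bar> \<le> b * expectation (\<lambda>\<omega>. \<bar>V \<omega>\<bar>)"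
proof -
  have [measurable]: "V \<in> borel_measurable M" "Z' \<in> borel_measurable M" using V(2) Z' by auto
  have "expectation (\<lambda>\<omega>. V \<omega> * Z' \<omega>) = expectation (\<lambda>\<omega>. V (\<tau> (- a) \<omega>) * Z' (\<tau> (- a) \<omega>))"
    by (rule integral_shift[symmetric]) measurable
  also have "\<dots> = expectation (\<lambda>\<omega>. V (\<tau> (- a) \<omega>) * Z \<omega>)"
    by (rule Bochner_Integration.integral_cong) (auto simp: Z')
  also have "\<bar>\<dots>\<bar> \<le> b * expectation (\<lambda>\<omega>. \<bar>V (\<tau> (- a) \<omega>)\<bar>)"
    by (intro bound shift_past integrable_shift V)
  also have "expectation (\<lambda>\<omega>. \<bar>V (\<tau> (- a) \<omega>)\<bar>) = expectation (\<lambda>\<omega>. \<bar>V \<omega>\<bar>)"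
    by (rule integral_shift) measurable
  finally show ?thesis .
qed

context
  fixes \<beta> D :: real
  assumes \<beta>: "1 < \<beta>" "\<beta> < 2" and D: "0 \<le> D"
    and R_decay: "\<And>n. 1 \<le> n \<Longrightarrow> R n \<le> D * real n powr (- \<beta>)"
    and phi_decay: "\<And>n. 1 \<le> n \<Longrightarrow> phi_mix M e n \<le> D * real n powr (- \<beta>)"
begin

text \<open>24 is 6 times 4: the covariance inequality gives \<open>2 * K\<^sup>2\<close>, the
  truncation gives \<open>4 * K\<^sup>2\<close>, and halving the lag costs
  \<open>2 powr \<beta>\<close>, at most 4.\<close>

definition \<psi> :: "nat \<Rightarrow> real" where
  "\<psi> l = 24 * K\<^sup>2 * D * real l powr (- \<beta>)"

text \<open>A lag \<open>l\<close> is shared between memory and mixing: keeping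
  \<open>r = (l + 1) div 2\<close> coordinates of \<open>X l\<close> leaves the oldest at time
  \<open>l + 1 - r\<close>, and both numbers are at least \<open>l / 2\<close>.\<close>

lemma \<psi>_bound:
  assumes "1 \<le> l" and C: "0 \<le> C" "C \<le> K\<^sup>2" and \<delta>: "\<delta> \<le> 2 * K * R ((l + 1) div 2)"
  shows "2 * C * phi_mix M e (l + 1 - (l + 1) div 2) + 2 * \<delta> \<le> \<psi> l"
proof -
  have half: "D * real n powr (- \<beta>) \<le> 4 * (D * real l powr (- \<beta>))" if "real l / 2 \<le> real n" for n
  proof -
    have "real n powr (- \<beta>) \<le> (real l / 2) powr (- \<beta>)"
      using that assms(1) \<beta> by (intro powr_mono2') auto
    also have "\<dots> = 2 powr \<beta> * real l powr (- \<beta>)"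
      by (simp add: powr_divide powr_minus divide_simps)
    also have "\<dots> \<le> 2 powr 2 * real l powr (- \<beta>)"
      using \<beta> by (intro mult_right_mono powr_mono) auto
    finally show ?thesis using D by (simp add: mult_left_mono mult.left_commute)
  qed
  let ?r = "(l + 1) div 2"
  let ?b = "4 * (D * real l powr (- \<beta>))"
  have b0: "0 \<le> ?b" using D by simp
  have r: "1 \<le> ?r" "real l / 2 \<le> real ?r" "1 \<le> l + 1 - ?r" "real l / 2 \<le> real (l + 1 - ?r)"
    using assms(1) by linarith+
  have "R ?r \<le> ?b" using R_decay[OF r(1)] half[OF r(2)] by linarith
  then have "2 * \<delta> \<le> 4 * K * ?b"
    using \<delta> mult_left_mono[of "R ?r" ?b "2 * K"] K_bounds(1) by linarith
  also have "\<dots> \<le> 4 * K\<^sup>2 * ?b" using K_bounds b0 by (intro mult_right_mono) auto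
  finally have 1: "2 * \<delta> \<le> 4 * K\<^sup>2 * ?b" .
  have "phi_mix M e (l + 1 - ?r) \<le> ?b" using phi_decay[OF r(3)] half[OF r(4)] by linarith
  then have "2 * C * phi_mix M e (l + 1 - ?r) \<le> 2 * K\<^sup>2 * ?b"
    using C phi_mix_nonneg b0 by (intro mult_mono) auto
  moreover have "\<psi> l = 2 * K\<^sup>2 * ?b + 4 * K\<^sup>2 * ?b" by (simp add: \<psi>_def)
  ultimately show ?thesis using 1 by linarith
qed

lemma mixing_linear:
  assumes V: "V \<in> borel_measurable (past a)" "integrable M V" and l: "1 \<le> l"
  shows "\<bar>expectation (\<lambda>\<omega>. V \<omega> * X (a + int l) \<omega>)\<bar> \<le> \<psi> l * expectation (\<lambda>\<omega>. \<bar>V \<omega>\<bar>)"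
proof (rule shift_expectation[OF V])
  let ?r = "(l + 1) div 2"
  show "X (a + int l) (\<tau> (- a) \<omega>) = X (int l) \<omega>" if "\<omega> \<in> space M" for \<omega>
    using that by (simp add: X_shift)
  fix V :: "'w \<Rightarrow> real" assume V: "V \<in> borel_measurable (past 0)" "integrable M V"
  have K0: "0 < K" "K \<le> K\<^sup>2" using K_bounds by auto
  have "\<bar>expectation (\<lambda>\<omega>. V \<omega> * (X (int l) \<omega> - expectation (X (int l))))\<bar>
      \<le> (2 * K * phi_mix M e (l + 1 - ?r) + 2 * R ?r) * expectation (\<lambda>\<omega>. \<bar>V \<omega>\<bar>)"
  proof (rule phi_mix_approx[OF V truncated_future])
    show "int (l + 1 - ?r) \<le> int l - int j" if "j < ?r" for j using that by linarith
    show "\<bar>truncated (int l) ?r \<omega>\<bar> \<le> K" if "\<omega> \<in> space M" for \<omega>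
      using truncated_bound[OF that] K_bounds(2) by (rule order_trans)
    show "\<bar>X (int l) \<omega> - truncated (int l) ?r \<omega>\<bar> \<le> R ?r" if "\<omega> \<in> space M" for \<omega>
      by (rule truncated_error[OF that])
  qed (use K0 in auto)
  also have "\<dots> \<le> \<psi> l * expectation (\<lambda>\<omega>. \<bar>V \<omega>\<bar>)"
  proof (intro mult_right_mono \<psi>_bound l)
    have "1 * R ?r \<le> 2 * K * R ?r" using K_bounds R_nonneg by (intro mult_right_mono) auto
    then show "R ?r \<le> 2 * K * R ?r" by simp
  qed (use K0 in auto)
  finally show "\<bar>expectation (\<lambda>\<omega>. V \<omega> * X (int l) \<omega>)\<bar> \<le> \<psi> l * expectation (\<lambda>\<omega>. \<bar>V \<omega>\<bar>)"
    by (simp add: expectation_X)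
qed auto

lemma mixing_quadratic:
  assumes V: "V \<in> borel_measurable (past a)" "integrable M V" and l: "1 \<le> l"
  shows "\<bar>expectation (\<lambda>\<omega>. V \<omega> * (X (a + int l) \<omega> * X (a + int l + int j) \<omega> - expectation (\<lambda>\<omega>. X 0 \<omega> * X (int j) \<omega>)))\<bar>
     \<le> \<psi> l * expectation (\<lambda>\<omega>. \<bar>V \<omega>\<bar>)"
proof (rule shift_expectation[OF V])
  let ?r = "(l + 1) div 2" and ?c = "expectation (\<lambda>\<omega>. X 0 \<omega> * X (int j) \<omega>)"
  let ?Z = "\<lambda>\<omega>. X (int l) \<omega> * X (int l + int j) \<omega>"
  \<comment> \<open>Keeping \<open>j\<close> more coordinates in the later factor gives both factors
    the same oldest time, and its truncation error is still at most \<open>R ?r\<close> because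
    \<open>R\<close> decreases.\<close>
  let ?G = "\<lambda>\<omega>. truncated (int l) ?r \<omega> * truncated (int l + int j) (?r + j) \<omega>"
  show "X (a + int l) (\<tau> (- a) \<omega>) * X (a + int l + int j) (\<tau> (- a) \<omega>) - ?c = ?Z \<omega> - ?c" if "\<omega> \<in> space M" for \<omega>
    using that by (simp add: X_shift)
  fix V :: "'w \<Rightarrow> real" assume V: "V \<in> borel_measurable (past 0)" "integrable M V"
  have K0: "0 < K\<^sup>2" "0 \<le> K" using K_bounds by auto
  have bd: "\<bar>X k \<omega>\<bar> \<le> K" "\<bar>truncated k i \<omega>\<bar> \<le> K" if "\<omega> \<in> space M" for \<omega> k i
    using X_bound[OF that, of k] truncated_bound[OF that, of k i] K_bounds(2) by linarith+
  have "\<bar>expectation (\<lambda>\<omega>. V \<omega> * (?Z \<omega> - expectation ?Z))\<bar>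
      \<le> (2 * K\<^sup>2 * phi_mix M e (l + 1 - ?r) + 2 * (2 * K * R ?r)) * expectation (\<lambda>\<omega>. \<bar>V \<omega>\<bar>)"
  proof (rule phi_mix_approx[OF V])
    show "?G \<in> borel_measurable (vimage_algebra (space M) (future (l + 1 - ?r)) borel)"
      by (intro borel_measurable_times truncated_future) linarith+
    fix \<omega> assume \<omega>: "\<omega> \<in> space M"
    show "\<bar>?G \<omega>\<bar> \<le> K\<^sup>2"
      unfolding abs_mult power2_eq_square using bd[OF \<omega>] K0 by (intro mult_mono) auto
    have "?Z \<omega> - ?G \<omega> = X (int l) \<omega> * (X (int l + int j) \<omega> - truncated (int l + int j) (?r + j) \<omega>)
        + truncated (int l + int j) (?r + j) \<omega> * (X (int l) \<omega> - truncated (int l) ?r \<omega>)"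
      by (simp add: algebra_simps)
    also have "\<bar>\<dots>\<bar> \<le> K * R (?r + j) + K * R ?r"
      using bd[OF \<omega>] truncated_error[OF \<omega>] K0
      by (intro order_trans[OF abs_triangle_ineq] add_mono) (auto simp: abs_mult intro!: mult_mono)
    also have "\<dots> \<le> 2 * K * R ?r"
      using mult_left_mono[OF decseqD[OF R(1), of ?r "?r + j"] K0(2)] by simp
    finally show "\<bar>?Z \<omega> - ?G \<omega>\<bar> \<le> 2 * K * R ?r" .
  qed (use K0 in auto)
  also have "\<dots> \<le> \<psi> l * expectation (\<lambda>\<omega>. \<bar>V \<omega>\<bar>)"
    using \<psi>_bound[OF l, of "K\<^sup>2" "2 * K * R ?r"] by (intro mult_right_mono) auto
  finally show "\<bar>expectation (\<lambda>\<omega>. V \<omega> * (?Z \<omega> - ?c))\<bar> \<le> \<psi> l * expectation (\<lambda>\<omega>. \<bar>V \<omega>\<bar>)"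
    by (simp only: covariance_shift)
qed auto

lemma mixing_sequence_X:
  "mixing_sequence M (\<lambda>a. past (int a)) (\<lambda>i. X (int i)) (\<lambda>j. expectation (\<lambda>\<omega>. X 0 \<omega> * X (int j) \<omega>)) \<psi> K"
proof unfold_locales
  show "subalgebra M (past (int i))" for i by (rule past_subalgebra)
  show "subalgebra (past (int j)) (past (int i))" if "i \<le> j" for i j using that by (intro past_mono) simp
  show "X (int i) \<in> borel_measurable (past (int i))" for i
    by (rule X_measurable_of) (auto intro: e_past)
  show "\<bar>X (int i) \<omega>\<bar> \<le> K" if "\<omega> \<in> space M" for i \<omega>
    using X_bound[OF that] K_bounds(2) by (rule order_trans)
  show "0 \<le> \<psi> i" for i using D by (simp add: \<psi>_def)
qed (use K_bounds expectation_X covariance_shift mixing_linear mixing_quadratic in auto)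

end

text \<open>The unordered sum is read along the symmetric intervals from \<open>- n\<close> to
  \<open>n\<close>, and stationarity makes the covariance an even function of the lag.\<close>

lemma variance_limit:
  assumes "(\<Sum>\<^sub>\<infinity>k\<in>UNIV. expectation (\<lambda>\<omega>. X 0 \<omega> * X k \<omega>)) > 0"
  shows "(\<lambda>n. expectation (\<lambda>\<omega>. X 0 \<omega> * X (int 0) \<omega>) + 2 * (\<Sum>j=1..n. expectation (\<lambda>\<omega>. X 0 \<omega> * X (int j) \<omega>)))
     \<longlonglongrightarrow> (\<Sum>\<^sub>\<infinity>k\<in>UNIV. expectation (\<lambda>\<omega>. X 0 \<omega> * X k \<omega>))"
proof -
  define c where "c k = expectation (\<lambda>\<omega>. X 0 \<omega> * X k \<omega>)" for k
  have "c summable_on UNIV"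
  \<comment> \<open>A family that is not summable has \<open>infsum\<close> equal to 0, so
    positivity of the sum forces summability.\<close>
  proof (rule ccontr)
    assume "\<not> c summable_on UNIV"
    then have "infsum c UNIV = 0" by (rule infsum_not_exists)
    then show False using assms by (simp add: c_def[abs_def])
  qed
  then have "(sum c \<longlongrightarrow> infsum c UNIV) (finite_subsets_at_top UNIV)"
    using has_sum_infsum unfolding has_sum_def by blast
  moreover have "filterlim (\<lambda>n. {- int n..int n}) (finite_subsets_at_top UNIV) sequentially"
    unfolding filterlim_finite_subsets_at_top
  proof (intro allI impI)
    fix B :: "int set" assume "finite B \<and> B \<subseteq> UNIV"
    then obtain m where m: "\<And>k. k \<in> B \<Longrightarrow> \<bar>k\<bar> \<le> m"
      using finite_nat_set_iff_bounded_le by (metis Max_ge finite_imageI image_eqI)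
    show "\<forall>\<^sub>F n in sequentially. finite {- int n..int n} \<and> B \<subseteq> {- int n..int n} \<and> {- int n..int n} \<subseteq> UNIV"
      using eventually_ge_at_top[of "nat m"]
    proof eventually_elim
      case (elim n)
      then have "k \<in> {- int n..int n}" if "k \<in> B" for k
        using m[OF that] by auto
      then show ?case by auto
    qed
  qed
  ultimately have lim: "(\<lambda>n. sum c {- int n..int n}) \<longlonglongrightarrow> infsum c UNIV"
    by (rule filterlim_compose)
  have sym: "c (- k) = c k" for k
    using covariance_shift[of "- k" k] by (simp add: c_def mult.commute)
  have "sum c {- int n..int n} = c 0 + 2 * (\<Sum>j=1..n. c (int j))" for n
  proof (induction n)
    case (Suc n)
    have "{- int (Suc n)..int (Suc n)} = insert (- int (Suc n)) (insert (int (Suc n)) {- int n..int n})"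
      by auto
    then have "sum c {- int (Suc n)..int (Suc n)} = c (- int (Suc n)) + (c (int (Suc n)) + sum c {- int n..int n})"
      by simp
    then show ?case using Suc by (simp only: sym) simp
  qed simp
  then show ?thesis using lim by (simp add: c_def[abs_def])
qed

end

section \<open>From the rate assumption to the two ranges of \<beta>\<close>

lemma powr_bound_everywhere:
  fixes f :: "nat \<Rightarrow> real"
  assumes "\<forall>\<^sub>F n in sequentially. f n \<le> C * real n powr b"
  shows "\<exists>D. \<forall>n\<ge>1. f n \<le> D * real n powr b"
proof -
  obtain N where N: "\<And>n. n \<ge> N \<Longrightarrow> f n \<le> C * real n powr b"
    using assms by (auto simp: eventually_sequentially)
  \<comment> \<open>The finitely many exceptional ratios are added to the constant. The bound starts
    at 1 because \<open>0 powr b\<close> is 0.\<close>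
  define D where "D = \<bar>C\<bar> + (\<Sum>n<N. \<bar>f n\<bar> / real n powr b)"
  have s0: "0 \<le> (\<Sum>n<N. \<bar>f n\<bar> / real n powr b)" by (intro sum_nonneg) simp
  have "f n \<le> D * real n powr b" if n: "1 \<le> n" for n
  proof (cases "n < N")
    case True
    have "\<bar>f n\<bar> / real n powr b \<le> (\<Sum>n<N. \<bar>f n\<bar> / real n powr b)"
      using True by (intro member_le_sum) auto
    then have "\<bar>f n\<bar> / real n powr b \<le> D" by (simp add: D_def)
    then show ?thesis using n by (simp add: pos_divide_le_eq)
  next
    case False
    then have "f n \<le> C * real n powr b" by (intro N) simp
    also have "\<dots> \<le> D * real n powr b" using s0 by (intro mult_right_mono) (auto simp: D_def)
    finally show ?thesis .
  qed
  then show ?thesis by blast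
qed

theorem proposition3p2:
  fixes M :: "'w measure"
    and T :: "'w \<Rightarrow> 'w"
    and A :: "'x::polish_space set"
    and e :: "int \<Rightarrow> 'w \<Rightarrow> 'x"
    and H :: "(nat \<Rightarrow> 'x) \<Rightarrow> real"
    and X :: "int \<Rightarrow> 'w \<Rightarrow> real"
    and R :: "nat \<Rightarrow> real"
    and \<beta> :: real
  assumes prob: "prob_space M"
    and T: "bimeasurable_mp M T"
    and e0: "e 0 \<in> measurable M (restrict_space borel A)"
    and e: "\<And>i \<omega>. \<omega> \<in> space M \<Longrightarrow> e i \<omega> = e 0 (int_iterate M T i \<omega>)"
    and mixing: "phi_mix M e \<longlonglongrightarrow> 0"
    and H: "H \<in> borel_measurable (PiM UNIV (\<lambda>_::nat. restrict_space borel A))"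
    and X: "\<And>k \<omega>. \<omega> \<in> space M \<Longrightarrow>
              X k \<omega> = H (\<lambda>i. e (k - int i) \<omega>)
                       - (\<integral>\<omega>'. H (\<lambda>i. e (k - int i) \<omega>') \<partial>M)"
    and HR: "\<And>i x y. (\<forall>j. x j \<in> A) \<Longrightarrow> (\<forall>j. y j \<in> A) \<Longrightarrow>
              \<bar>H x - H (splice_at i x y)\<bar> \<le> R i"
    and R: "decseq R" "R \<longlonglongrightarrow> 0"
    and \<beta>: "\<beta> > 1"
    and rate: "(\<lambda>n. R n + (\<Sum>i=1..n. R (n - i) * phi_mix M e i)) \<in> O(\<lambda>n. real n powr (- \<beta>))"
    and variance: "(\<Sum>\<^sub>\<infinity>k\<in>UNIV. \<integral>\<omega>. X 0 \<omega> * X k \<omega> \<partial>M) > 0"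
  shows "(\<beta> \<ge> 3/2 \<longrightarrow>
           tends_to_one_uniformly (normal_tail_ratio M X)
             (\<lambda>n. real n powr (1/14) / sqrt (ln (real n))))
       \<and> (\<beta> \<in> {1<..<3/2} \<longrightarrow>
           tends_to_one_uniformly (normal_tail_ratio M X)
             (\<lambda>n. real n powr ((\<beta> - 1) / (6 * \<beta> - 2))))"
proof -
  interpret prob_space M by (rule prob)
  interpret causal_process M T A e H X R
    by unfold_locales (fact T e0 e H X HR R)+
  \<comment> \<open>\<open>R 0\<close> is the factor of \<open>phi_mix M e n\<close> in the rate, so
    it must be positive to extract a decay of the mixing coefficient. If it were 0, all variables
    and hence the variance would vanish.\<close>
  have R0: "0 < R 0"
  proof (rule ccontr)
    assume "\<not> 0 < R 0"
    then have "X k \<omega> = 0" if "\<omega> \<in> space M" for k \<omega> using X_bound[OF that, of k] by simp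
    then have "(\<integral>\<omega>. X 0 \<omega> * X k \<omega> \<partial>M) = (\<integral>\<omega>. 0 \<partial>M)" for k
      by (intro Bochner_Integration.integral_cong) auto
    then show False using variance by simp
  qed
  \<comment> \<open>The exponent \<open>(\<beta>' - 1) / (6 * \<beta>' - 2)\<close> is
    \<open>1/14\<close> at \<open>3/2\<close>; the minimum also keeps the exponent below 2, as the
    sums of near lags require.\<close>
  define \<beta>' where "\<beta>' = min \<beta> (3/2)"
  have \<beta>': "1 < \<beta>'" "\<beta>' < 2" "\<beta>' \<le> \<beta>" using \<beta> by (auto simp: \<beta>'_def)
  obtain C where C: "\<forall>\<^sub>F n in sequentially.
      R n + (\<Sum>i=1..n. R (n - i) * phi_mix M e i) \<le> C * real n powr (- \<beta>)"
  proof -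
    from rate obtain C where "\<forall>\<^sub>F n in sequentially.
      norm (R n + (\<Sum>i=1..n. R (n - i) * phi_mix M e i)) \<le> C * norm (real n powr (- \<beta>))"
      by (auto simp: bigo_def)
    then have "\<forall>\<^sub>F n in sequentially. R n + (\<Sum>i=1..n. R (n - i) * phi_mix M e i) \<le> C * real n powr (- \<beta>)"
      by eventually_elim simp
    then show ?thesis by (rule that)
  qed
  have terms: "0 \<le> R (n - i) * phi_mix M e i" for n i
    by (intro mult_nonneg_nonneg R_nonneg phi_mix_nonneg)
  have "\<forall>\<^sub>F n in sequentially. R n + R 0 * phi_mix M e n \<le> \<bar>C\<bar> * real n powr (- \<beta>')"
    using C eventually_ge_at_top[of 1]
  proof eventually_elim
    case (elim n)
    \<comment> \<open>Of the convolution only the term \<open>i = n\<close> is kept; all others are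
      nonnegative.\<close>
    have "R (n - n) * phi_mix M e n \<le> (\<Sum>i=1..n. R (n - i) * phi_mix M e i)"
      using elim(2) by (intro member_le_sum[where f = "\<lambda>i. R (n - i) * phi_mix M e i"] terms) auto
    then have "R n + R 0 * phi_mix M e n \<le> C * real n powr (- \<beta>)" using elim(1) by simp
    also have "\<dots> \<le> \<bar>C\<bar> * real n powr (- \<beta>')"
      using elim(2) \<beta>' by (intro mult_mono powr_mono) auto
    finally show ?case .
  qed
  then obtain D0 where D0: "\<And>n. 1 \<le> n \<Longrightarrow> R n + R 0 * phi_mix M e n \<le> D0 * real n powr (- \<beta>')"
    using powr_bound_everywhere[of "\<lambda>n. R n + R 0 * phi_mix M e n"] by blast
  define D where "D = max D0 (D0 / R 0)"
  have D0_nonneg: "0 \<le> D0"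
  proof -
    have "0 \<le> R 1 + R 0 * phi_mix M e 1"
      by (intro add_nonneg_nonneg mult_nonneg_nonneg R_nonneg phi_mix_nonneg)
    also have "\<dots> \<le> D0" using D0[of 1] by simp
    finally show ?thesis .
  qed
  have D: "0 \<le> D" using D0_nonneg by (simp add: D_def)
  have R_decay: "R n \<le> D * real n powr (- \<beta>')" if "1 \<le> n" for n
  proof -
    have "R n \<le> D0 * real n powr (- \<beta>')"
      using D0[OF that] mult_nonneg_nonneg[OF R_nonneg[of 0] phi_mix_nonneg[of n]] by linarith
    also have "\<dots> \<le> D * real n powr (- \<beta>')" by (intro mult_right_mono) (auto simp: D_def)
    finally show ?thesis .
  qed
  have phi_decay: "phi_mix M e n \<le> D * real n powr (- \<beta>')" if "1 \<le> n" for n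
  proof -
    have "R 0 * phi_mix M e n \<le> D0 * real n powr (- \<beta>')"
      using D0[OF that] R_nonneg[of n] by linarith
    then have "phi_mix M e n \<le> D0 / R 0 * real n powr (- \<beta>')"
      using R0 by (simp add: pos_le_divide_eq mult.commute)
    also have "\<dots> \<le> D * real n powr (- \<beta>')" by (intro mult_right_mono) (auto simp: D_def)
    finally show ?thesis .
  qed
  have \<psi>: "\<psi> \<beta>' D = (\<lambda>j. 24 * K\<^sup>2 * D * real j powr (- \<beta>'))"
    by (rule ext) (rule \<psi>_def[OF \<beta>'(1,2) D R_decay phi_decay])
  interpret ms: mixing_sequence M "\<lambda>a. past (int a)" "\<lambda>i. X (int i)"
      "\<lambda>j. expectation (\<lambda>\<omega>. X 0 \<omega> * X (int j) \<omega>)" "\<psi> \<beta>' D" K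
    by (rule mixing_sequence_X[OF \<beta>'(1,2) D R_decay phi_decay])
  have "0 \<le> 24 * K\<^sup>2 * D" using D by simp
  then obtain P where P: "polynomial_decay (\<psi> \<beta>' D) \<beta>' P"
    unfolding \<psi> using polynomial_decay_powr \<beta>' by blast
  have sum_eq: "normalized_sum X n = (\<lambda>\<omega>. ms.S n \<omega> / sqrt (real n))" for n
    by (simp add: normalized_sum_def[abs_def] ms.S_def)
  have sd_eq: "normalized_sd M X n = sqrt (ms.mean_variance n)" for n
    unfolding normalized_sd_def sum_eq ms.mean_variance_def by (simp add: power_divide)
  have main: "(\<lambda>n. SUP x\<in>{0..u n}. \<bar>normal_tail_ratio M X n x - 1\<bar>) \<longlonglongrightarrow> 0"
    if "\<forall>n. 0 \<le> u n" "u \<in> o(\<lambda>n. real n powr ((\<beta>' - 1) / (6 * \<beta>' - 2)))" for u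
    using ms.moderate_deviations[OF P \<beta>'(1,2) variance_limit[OF variance] variance _ that(2)] that(1)
    unfolding normal_tail_ratio_def sum_eq sd_eq normal_tail_eq by blast
  have "tends_to_one_uniformly (normal_tail_ratio M X) (\<lambda>n. real n powr (1/14) / sqrt (ln (real n)))" if "3/2 \<le> \<beta>"
    unfolding tends_to_one_uniformly_def
  proof (intro allI impI)
    fix u :: "nat \<Rightarrow> real"
    assume u0: "\<forall>n. 0 \<le> u n" and u: "u \<in> o(\<lambda>n. real n powr (1/14) / sqrt (ln (real n)))"
    \<comment> \<open>The logarithm only narrows the range, so the case follows from the range
      \<open>n powr (1/14)\<close>.\<close>
    have "(\<lambda>n::nat. real n powr (1/14) / sqrt (ln (real n))) \<in> O(\<lambda>n. real n powr (1/14))"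
      by real_asymp
    with u have "u \<in> o(\<lambda>n. real n powr (1/14))" by (rule landau_o.small_big_trans)
    moreover have "(\<beta>' - 1) / (6 * \<beta>' - 2) = 1/14" using that by (simp add: \<beta>'_def)
    ultimately show "(\<lambda>n. SUP x\<in>{0..u n}. \<bar>normal_tail_ratio M X n x - 1\<bar>) \<longlonglongrightarrow> 0"
      by (intro main[OF u0]) (simp only:)
  qed
  moreover have "tends_to_one_uniformly (normal_tail_ratio M X) (\<lambda>n. real n powr ((\<beta> - 1) / (6 * \<beta> - 2)))"
    if "\<beta> \<in> {1<..<3/2}"
  proof -
    have "\<beta>' = \<beta>" using that by (simp add: \<beta>'_def)
    then show ?thesis using main unfolding tends_to_one_uniformly_def by simp
  qed
  ultimately show ?thesis by blast
qed

end
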